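(* Let $G=(V,w)$ be a weighted graph, let $o\in V$ be a vertex and $z\subset V$ a vertex set with $\mathrm{dist}(o,z)\ge n+1$ for some integer $n\ge 0$. Let $g$ be either (a) the solution $g>1$ of $(g-1)^2g^{\,n-2}=2w_z/w_o$, or (b) $g=(w_z\,r_{oz})^{1/n}$ (for $n\ge 1$ and $r_{oz}<\infty$). Then $$\mathbf E\,T_{oz}\ \ge\ m_g\,n+1,$$ and, for every $a$ with $1<a<m_g$, $$\mathbf P(T_{oz}\le an+1)\ \le\ e^{-I_g(a)n}.$$
   Context: A weighted graph $G=(V,w)$ is a set $V$ of vertices with a symmetric function $w:V\times V\to[0,\infty)$; the edges are the pairs on which $w$ is positive. The weight of a vertex is $w_x=\sum_y w(x,y)$ (with $0<w_x<\infty$), and the weight of a vertex set $z$ is $w_z=\sum_{x\in z}w_x$. The random walk on $G$ moves from $x$ to $y$ with probability $w(x,y)/w_x$. $T_{oz}$ is the first time the walk started at $o$ at time $0$ visits $z$, and $\mathrm{dist}$ is graph distance. $r_{oz}$ is the effective resistance between $o$ and $z$ (with $z$ regarded as a single vertex) when $G$ is thought of as an electric network with conductances given by the edge weights. For $g>1$, let $T'_{01}$ be the hitting time of $1$ from $0$ for biased simple random walk on $\mathbb Z$ with odds $1$ and $g$ of going left and right (i.e. steps $+1$ with probability $g/(g+1)$ and $-1$ with probability $1/(g+1)$). $m_g$ denotes its mean and $I_g(a)$ its large deviation rate function; explicitly $$m_g=\mathbf E T'_{01}=\frac{g+1}{g-1},\qquad e^{-I_g(a)}=\frac{g}{a+1}\Big(\frac{g}{a^2-1}\Big)^{\frac{a-1}{2}}\Big(\frac{2a}{g+1}\Big)^a\quad(a>1).$$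 *)

theory Defs
  imports "HOL-Probability.Probability"
begin

section \<open>Weighted graphs\<close>

text \<open>The vertex set is the whole type \<open>'v\<close> (of any cardinality, in particular possibly
  infinite). Loops are allowed; connectedness and local finiteness are not required.\<close>

definition vertex_weight :: "('v \<Rightarrow> 'v \<Rightarrow> real) \<Rightarrow> 'v \<Rightarrow> real" where
  "vertex_weight w x = (\<Sum>\<^sub>\<infinity>y. w x y)"

locale weighted_graph =
  fixes w :: "'v \<Rightarrow> 'v \<Rightarrow> real"
  assumes weight_sym: "w x y = w y x"
    and weight_nonneg: "0 \<le> w x y"
    and weight_summable: "w x summable_on UNIV"
    and vertex_weight_pos: "0 < vertex_weight w x"

definition set_weight :: "('v \<Rightarrow> 'v \<Rightarrow> real) \<Rightarrow> 'v set \<Rightarrow> ennreal" where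
  "set_weight w Z = (\<Sum>\<^sub>\<infinity>x\<in>Z. ennreal (vertex_weight w x))"

definition edges :: "('v \<Rightarrow> 'v \<Rightarrow> real) \<Rightarrow> 'v rel" where
  "edges w = {(x, y). 0 < w x y}"

text \<open>Distance from a vertex to a set; it is \<open>\<infinity>\<close> if the set cannot be reached.\<close>

definition graph_dist :: "('v \<Rightarrow> 'v \<Rightarrow> real) \<Rightarrow> 'v \<Rightarrow> 'v set \<Rightarrow> enat" where
  "graph_dist w u Z = Inf {enat k | k y. y \<in> Z \<and> (u, y) \<in> edges w ^^ k}"


section \<open>Effective resistance\<close>

text \<open>In the finite network spanned by the vertices in \<open>K\<close>, \<open>v\<close> is the voltage when
  \<open>Z\<close> is grounded as a single vertex and a unit current flows into the network at \<open>u\<close>: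
  the first condition makes all of \<open>Z\<close> one node (no Kirchhoff law is imposed on its
  individual members), the others are Kirchhoff's current law, with the current from \<open>x\<close>
  to \<open>y\<close> given by Ohm's law.\<close>

definition unit_current_voltage ::
  "('v \<Rightarrow> 'v \<Rightarrow> real) \<Rightarrow> 'v set \<Rightarrow> 'v \<Rightarrow> 'v set \<Rightarrow> ('v \<Rightarrow> real) \<Rightarrow> bool" where
  "unit_current_voltage w K u Z v \<longleftrightarrow>
     (\<forall>x\<in>Z. v x = 0) \<and>
     (\<Sum>y\<in>K. w u y * (v u - v y)) = 1 \<and>
     (\<forall>x\<in>K - insert u Z. (\<Sum>y\<in>K. w x y * (v x - v y)) = 0)"

text \<open>The effective resistance of the finite network on \<open>K\<close> is the potential difference
  \<open>v u\<close>, which does not depend on the choice of \<open>v\<close>; there is no such \<open>v\<close>, and the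
  resistance is \<open>\<infinity>\<close>, if \<open>Z\<close> cannot be reached from \<open>u\<close> within \<open>K\<close>. By Rayleigh
  monotonicity it decreases as \<open>K\<close> grows, so that the infimum below is the limit along
  finite subnetworks exhausting the graph, and simply the value at \<open>K = UNIV\<close> if the
  graph is finite.\<close>

definition eff_resistance :: "('v \<Rightarrow> 'v \<Rightarrow> real) \<Rightarrow> 'v \<Rightarrow> 'v set \<Rightarrow> ennreal" where
  "eff_resistance w u Z =
     (INF (K, v) \<in> {(K, v). finite K \<and> u \<in> K \<and> unit_current_voltage w K u Z v}. ennreal (v u))"


section \<open>Random walk and hitting times\<close>

text \<open>\<open>X\<close> is, on the probability space \<open>M\<close>, a random walk on the weighted graph \<open>w\<close>
  started at \<open>u\<close>: its finite-dimensional distributions are those of the Markov chain with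
  transition probabilities \<open>w x y / vertex_weight w x\<close>.\<close>

definition random_walk ::
  "('v \<Rightarrow> 'v \<Rightarrow> real) \<Rightarrow> 'v \<Rightarrow> 'a measure \<Rightarrow> (nat \<Rightarrow> 'a \<Rightarrow> 'v) \<Rightarrow> bool" where
  "random_walk w u M X \<longleftrightarrow>
     prob_space M \<and>
     (\<forall>t. X t \<in> measurable M (count_space UNIV)) \<and>
     (\<forall>t p. measure M {\<omega> \<in> space M. \<forall>i\<le>t. X i \<omega> = p i} =
        (if p 0 = u then \<Prod>i<t. w (p i) (p (Suc i)) / vertex_weight w (p i) else 0))"

definition hitting_time :: "(nat \<Rightarrow> 'a \<Rightarrow> 'v) \<Rightarrow> 'v set \<Rightarrow> 'a \<Rightarrow> enat" where
  "hitting_time X Z \<omega> = Inf (enat ` {t. X t \<omega> \<in> Z})"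


section \<open>The biased walk on the integers\<close>

text \<open>Independent steps, each to the right (\<open>True\<close>) with probability \<open>g / (g + 1)\<close>
  and to the left with probability \<open>1 / (g + 1)\<close>.\<close>

definition biased_steps :: "real \<Rightarrow> (nat \<Rightarrow> bool) measure" where
  "biased_steps g = (\<Pi>\<^sub>M i\<in>UNIV. measure_pmf (bernoulli_pmf (g / (g + 1))))"

definition biased_walk :: "nat \<Rightarrow> (nat \<Rightarrow> bool) \<Rightarrow> int" where
  "biased_walk t \<omega> = (\<Sum>i<t. if \<omega> i then 1 else - 1)"

definition biased_time :: "(nat \<Rightarrow> bool) \<Rightarrow> enat" where
  "biased_time = hitting_time biased_walk {1}"

definition biased_mean :: "real \<Rightarrow> real" where
  "biased_mean g = enn2real (\<integral>\<^sup>+\<omega>. ennreal_of_enat (biased_time \<omega>) \<partial>biased_steps g)"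

text \<open>For \<open>g > 1\<close> the hitting time is almost surely finite, so the value at \<open>\<infinity>\<close> is
  immaterial.\<close>

definition biased_mgf :: "real \<Rightarrow> real \<Rightarrow> ennreal" where
  "biased_mgf g l =
     (\<integral>\<^sup>+\<omega>. (case biased_time \<omega> of enat t \<Rightarrow> ennreal (exp (l * real t)) | \<infinity> \<Rightarrow> 0)
        \<partial>biased_steps g)"

text \<open>The large deviation rate function, i.e. the Legendre transform of the logarithmic moment
  generating function. Arguments where the latter is infinite do not contribute to the
  supremum and are left out.\<close>

definition biased_rate :: "real \<Rightarrow> real \<Rightarrow> real" where
  "biased_rate g a =
     (SUP l\<in>{l. biased_mgf g l < \<infinity>}. l * a - ln (enn2real (biased_mgf g l)))"


section \<open>Explicit formulas for the biased walk\<close>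

text \<open>The mean and the rate function defined above have the closed forms
  \<open>biased_mean_eq\<close> and \<open>exp_biased_rate_eq\<close> at the end of this section. The
  hitting time of \<open>1\<close> from a general starting point \<open>x\<close> is used to set up
  first-step recursions.\<close>

lemma Inf_enat_Suc: "Inf (enat ` Suc ` A) = eSuc (Inf (enat ` A))"
proof (cases "A = {}")
  case True
  then show ?thesis by (simp add: top_enat_def)
next
  case False
  define k where "k = (LEAST k. k \<in> A)"
  have k: "k \<in> A" "\<And>j. j \<in> A \<Longrightarrow> k \<le> j"
    using False unfolding k_def by (auto intro: LeastI Least_le)
  have "Inf (enat ` A) = enat k"
    by (rule antisym) (auto intro!: Inf_lower Inf_greatest k)
  moreover have "Inf (enat ` Suc ` A) = enat (Suc k)"
    by (rule antisym) (auto intro!: Inf_lower Inf_greatest k)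
  ultimately show ?thesis by (simp add: eSuc_enat)
qed

definition btime :: "int \<Rightarrow> (nat \<Rightarrow> bool) \<Rightarrow> enat" where
  "btime x = hitting_time (\<lambda>t \<omega>. x + biased_walk t \<omega>) {1}"

lemma btime_0: "btime 0 = biased_time"
  by (simp add: btime_def biased_time_def)

lemma btime_1: "btime 1 \<omega> = 0"
proof -
  have "Inf (enat ` {t. 1 + biased_walk t \<omega> \<in> {1}}) \<le> enat 0"
    by (intro Inf_lower imageI) (simp add: biased_walk_def)
  then show ?thesis by (simp add: btime_def hitting_time_def zero_enat_def[symmetric])
qed

lemma btime_step:
  assumes "x \<noteq> 1"
  shows "btime x (case_nat b \<omega>) = eSuc (btime (x + (if b then 1 else - 1)) \<omega>)"
proof -
  have W: "biased_walk (Suc t) (case_nat b \<omega>) = (if b then 1 else - 1) + biased_walk t \<omega>" for t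
    by (simp add: biased_walk_def sum.lessThan_Suc_shift del: sum.lessThan_Suc)
  have "{t. x + biased_walk t (case_nat b \<omega>) \<in> {1}}
      = Suc ` {t. x + (if b then 1 else - 1) + biased_walk t \<omega> \<in> {1}}"
  proof (intro set_eqI iffI)
    fix t assume t: "t \<in> {t. x + biased_walk t (case_nat b \<omega>) \<in> {1}}"
    with assms have "t \<noteq> 0" by (intro notI) (simp add: biased_walk_def)
    then obtain s where "t = Suc s" by (cases t) auto
    with t W[of s] show "t \<in> Suc ` {t. x + (if b then 1 else - 1) + biased_walk t \<omega> \<in> {1}}"
      by auto
  qed (use W in auto)
  then show ?thesis
    unfolding btime_def hitting_time_def Inf_enat_Suc[symmetric] by simp
qed

locale biased =
  fixes g :: real
  assumes g: "1 < g"
begin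

definition "p = g / (g + 1)"
definition "q = 1 / (g + 1)"

lemma pq: "0 < p" "0 < q" "p + q = 1" "q < p" "p < 1" "1 - p = q"
  using g by (auto simp: p_def q_def field_simps)

sublocale sequence_space "measure_pmf (bernoulli_pmf p)"
  by unfold_locales

lemma S_eq: "biased_steps g = S"
  by (simp add: biased_steps_def p_def)

lemma walk_measurable [measurable]: "biased_walk t \<in> measurable S (count_space UNIV)"
proof (induction t)
  case 0
  then show ?case by (simp add: biased_walk_def)
next
  case (Suc t)
  note [measurable] = Suc
  have [measurable]: "(\<lambda>\<omega>. \<omega> t) \<in> measurable S (count_space UNIV)"
    using measurable_component_singleton[of t UNIV "\<lambda>_. measure_pmf (bernoulli_pmf p)"] by simp
  have "(\<lambda>\<omega>. biased_walk t \<omega> + (if \<omega> t then 1 else - 1)) \<in> measurable S (count_space UNIV)"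
    by measurable
  then show ?case by (simp add: biased_walk_def[abs_def])
qed

lemma btime_measurable [measurable]: "btime x \<in> measurable S (count_space UNIV)"
proof -
  have [measurable]: "Measurable.pred S (\<lambda>\<omega>. x + biased_walk t \<omega> \<in> {1})" for t
    by measurable
  have ge: "enat k \<le> btime x \<omega> \<longleftrightarrow> (\<forall>t<k. x + biased_walk t \<omega> \<notin> {1})" for k \<omega>
    unfolding btime_def hitting_time_def le_Inf_iff
    by (auto simp: not_less[symmetric])
  have "Measurable.pred S (\<lambda>\<omega>. btime x \<omega> = k)" for k
  proof (cases k)
    case (enat j)
    have "btime x \<omega> = k \<longleftrightarrow> enat j \<le> btime x \<omega> \<and> \<not> enat (Suc j) \<le> btime x \<omega>" for \<omega>
      unfolding enat by (cases "btime x \<omega>") auto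
    then show ?thesis unfolding ge by simp
  next
    case infinity
    have "btime x \<omega> = k \<longleftrightarrow> (\<forall>j. enat j \<le> btime x \<omega>)" for \<omega>
      unfolding infinity
    proof (cases "btime x \<omega>")
      case (enat i)
      then show "btime x \<omega> = \<infinity> \<longleftrightarrow> (\<forall>j. enat j \<le> btime x \<omega>)" by (auto intro!: exI[of _ "Suc i"])
    qed auto
    then show ?thesis unfolding ge by simp
  qed
  then show ?thesis
    by (subst measurable_count_space_eq2_countable) (auto simp: pred_def vimage_def Int_def conj_commute)
qed

definition A :: "(enat \<Rightarrow> ennreal) \<Rightarrow> int \<Rightarrow> ennreal" where
  "A f x = (\<integral>\<^sup>+\<omega>. f (btime x \<omega>) \<partial>S)"

lemma A_1: "A f 1 = f 0"
  by (simp add: A_def btime_1 emeasure_space_1)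

lemma A_step:
  assumes "x \<noteq> 1"
  shows "A f x = ennreal p * A (f \<circ> eSuc) (x + 1) + ennreal q * A (f \<circ> eSuc) (x - 1)"
proof -
  have cn: "(\<lambda>(s, \<omega>). case_nat s \<omega>) \<in> measurable (measure_pmf (bernoulli_pmf p) \<Otimes>\<^sub>M S) S"
    unfolding split_beta' by measurable
  have [measurable]: "(\<lambda>\<omega>. f (btime y \<omega>)) \<in> borel_measurable S" for f :: "enat \<Rightarrow> ennreal" and y
    using measurable_compose[OF btime_measurable] by simp
  have "A f x = (\<integral>\<^sup>+\<omega>. f (btime x \<omega>) \<partial>distr (measure_pmf (bernoulli_pmf p) \<Otimes>\<^sub>M S) S (\<lambda>(s, \<omega>). case_nat s \<omega>))"
    by (simp add: A_def PiM_iter)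
  also have "\<dots> = (\<integral>\<^sup>+z. f (btime x (case_nat (fst z) (snd z))) \<partial>(measure_pmf (bernoulli_pmf p) \<Otimes>\<^sub>M S))"
    by (subst nn_integral_distr[OF cn]) (auto simp: split_beta')
  also have "\<dots> = (\<integral>\<^sup>+b. \<integral>\<^sup>+\<omega>. f (btime x (case_nat b \<omega>)) \<partial>S \<partial>measure_pmf (bernoulli_pmf p))"
    by (subst nn_integral_fst[symmetric]) (use cn in \<open>auto simp: split_beta' intro!: measurable_compose[OF cn[unfolded split_beta']]\<close>)
  also have "\<dots> = (\<integral>\<^sup>+b. A (f \<circ> eSuc) (x + (if b then 1 else - 1)) \<partial>measure_pmf (bernoulli_pmf p))"
    by (simp add: A_def btime_step[OF assms] comp_def)
  also have "\<dots> = ennreal p * A (f \<circ> eSuc) (x + 1) + ennreal q * A (f \<circ> eSuc) (x - 1)"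
    using pq by (subst nn_integral_bernoulli_pmf) (auto simp: mult.commute)
  finally show ?thesis .
qed


lemma A_step':
  "A f (1 - int (Suc k)) =
     ennreal p * A (f \<circ> eSuc) (1 - int k) + ennreal q * A (f \<circ> eSuc) (1 - int (Suc (Suc k)))"
proof -
  have 1: "1 - int (Suc k) + 1 = 1 - int k" and 2: "1 - int (Suc k) - 1 = 1 - int (Suc (Suc k))"
    and 3: "1 - int (Suc k) \<noteq> 1"
    by auto
  show ?thesis by (rule A_step[OF 3, of f, unfolded 1 2])
qed

lemma A_mono: "(\<And>k. f k \<le> h k) \<Longrightarrow> A f x \<le> A h x"
  by (simp add: A_def nn_integral_mono)

lemma f_measurable [measurable]: "(\<lambda>\<omega>. f (btime y \<omega>)) \<in> borel_measurable S" for f :: "enat \<Rightarrow> ennreal"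
  using measurable_compose[OF btime_measurable] by simp

definition trunc :: "nat \<Rightarrow> enat \<Rightarrow> ennreal" where
  "trunc N k = ennreal_of_enat (min k (enat N))"

definition "m = (g + 1) / (g - 1)"

lemma m_pos: "0 < m" and m_pq: "m * p - m * q = 1"
proof -
  show "0 < m" using g by (simp add: m_def)
  have "p - q = (g - 1) / (g + 1)" by (simp add: p_def q_def diff_divide_distrib)
  then have "m * (p - q) = 1" using g by (simp add: m_def)
  then show "m * p - m * q = 1" by (simp add: algebra_simps)
qed

lemma A_trunc_Suc:
  "A (trunc (Suc N)) (1 - int (Suc k)) =
     1 + ennreal p * A (trunc N) (1 - int k) + ennreal q * A (trunc N) (1 - int (Suc (Suc k)))"
proof -
  have *: "trunc (Suc N) \<circ> eSuc = (\<lambda>k. 1 + trunc N k)"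
    by (rule ext) (auto simp: trunc_def eSuc_enat[symmetric] min_def)
  have **: "A (\<lambda>k. 1 + trunc N k) x = 1 + A (trunc N) x" for x
    unfolding A_def by (subst nn_integral_add) (auto simp: emeasure_space_1)
  have "A (trunc (Suc N)) (1 - int (Suc k)) =
      ennreal p * (1 + A (trunc N) (1 - int k)) + ennreal q * (1 + A (trunc N) (1 - int (Suc (Suc k))))"
    by (subst A_step', simp only: * **)
  also have "\<dots> = (ennreal p + ennreal q) + ennreal p * A (trunc N) (1 - int k) + ennreal q * A (trunc N) (1 - int (Suc (Suc k)))"
    by (simp add: distrib_left algebra_simps)
  also have "ennreal p + ennreal q = 1" using pq by (simp flip: ennreal_plus)
  finally show ?thesis .
qed

lemma trunc_upper: "A (trunc N) (1 - int k) \<le> ennreal (real k * m)"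
proof (induction N arbitrary: k)
  case 0
  then show ?case by (simp add: trunc_def A_def zero_enat_def[symmetric])
next
  case (Suc N)
  show ?case
  proof (cases k)
    case 0
    then show ?thesis by (simp add: A_1 trunc_def)
  next
    case (Suc j)
    have "A (trunc (Suc N)) (1 - int k) \<le>
       1 + ennreal p * ennreal (real j * m) + ennreal q * ennreal (real (Suc (Suc j)) * m)"
      unfolding Suc A_trunc_Suc by (intro add_mono mult_left_mono Suc.IH order_refl) auto
    also have "\<dots> = ennreal (1 + p * (real j * m) + q * (real (Suc (Suc j)) * m))"
      using pq m_pos by (simp add: ennreal_mult' ennreal_plus)
    also have "1 + p * (real j * m) + q * (real (Suc (Suc j)) * m) = real k * m"
    proof -
      have "1 + p * (real j * m) + q * (real (Suc (Suc j)) * m)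
          = 1 + (p + q) * (real j * m) + 2 * (q * m)"
        by (simp add: algebra_simps)
      also have "\<dots> = 1 + real j * m + 2 * (q * m)" using pq by simp
      moreover have "1 + 2 * (q * m) = m"
      proof -
        have "m = m * (p + q)" using pq by simp
        then show ?thesis using m_pq by (simp add: algebra_simps)
      qed
      ultimately show ?thesis by (simp add: Suc algebra_simps)
    qed
    finally show ?thesis .
  qed
qed

lemma trunc_lower:
  fixes r C :: real
  assumes r: "1 < r" and C: "C = m / (r - 1)"
  defines "\<rho> \<equiv> p / r + q * r"
  shows "ennreal (real k * m - C * \<rho> ^ N * r ^ k) \<le> A (trunc N) (1 - int k)"
proof (induction N arbitrary: k)
  case 0
  have "real k * (r - 1) \<le> r ^ k"
    using Bernoulli_inequality[of "r - 1" k] r by (simp add: algebra_simps)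
  then have "real k * m \<le> C * r ^ k"
    using r m_pos by (simp add: C divide_simps)
  then show ?case by (simp add: ennreal_neg)
next
  case (Suc N)
  show ?case
  proof (cases k)
    case 0
    have "0 \<le> C * \<rho> ^ Suc N" using r m_pos pq by (simp add: C \<rho>_def)
    then show ?thesis by (simp add: 0 ennreal_neg)
  next
    case (Suc j)
    let ?e = "\<lambda>k. real k * m - C * \<rho> ^ N * r ^ k"
    have rr: "p * r ^ j + q * r ^ Suc (Suc j) = \<rho> * r ^ Suc j"
      using r by (simp add: \<rho>_def field_simps)
    have m2: "1 + 2 * (q * m) = m"
    proof -
      have "m = m * (p + q)" using pq by simp
      then show ?thesis using m_pq by (simp add: algebra_simps)
    qed
    have "1 + p * ?e j + q * ?e (Suc (Suc j))
        = (1 + 2 * (q * m)) + (p + q) * (real j * m) - C * \<rho> ^ N * (p * r ^ j + q * r ^ Suc (Suc j))"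
      by (simp add: algebra_simps)
    also have "\<dots> = real k * m - C * \<rho> ^ Suc N * r ^ k"
      unfolding rr m2 using pq by (simp add: Suc algebra_simps)
    finally have eq: "real k * m - C * \<rho> ^ Suc N * r ^ k = 1 + p * ?e j + q * ?e (Suc (Suc j))" ..
    have "ennreal (real k * m - C * \<rho> ^ Suc N * r ^ k)
        \<le> ennreal (1 + p * max 0 (?e j) + q * max 0 (?e (Suc (Suc j))))"
      unfolding eq using pq by (intro ennreal_leI add_mono mult_left_mono) auto
    also have "\<dots> = 1 + ennreal p * ennreal (?e j) + ennreal q * ennreal (?e (Suc (Suc j)))"
      using pq by (subst ennreal_plus, auto simp: ennreal_mult' ennreal_plus max_def ennreal_neg)
    also have "\<dots> \<le> A (trunc (Suc N)) (1 - int k)"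
      unfolding Suc A_trunc_Suc by (intro add_mono mult_left_mono Suc.IH order_refl) auto
    finally show ?thesis .
  qed
qed

lemma mean_nn: "(\<integral>\<^sup>+\<omega>. ennreal_of_enat (biased_time \<omega>) \<partial>S) = ennreal m"
proof -
  have A0: "(\<integral>\<^sup>+\<omega>. ennreal_of_enat (biased_time \<omega>) \<partial>S) = A ennreal_of_enat 0"
    by (simp add: A_def btime_0)
  have sup: "ennreal_of_enat k = (SUP N. trunc N k)" for k
  proof (rule antisym)
    show "ennreal_of_enat k \<le> (SUP N. trunc N k)"
    proof (cases k)
      case (enat j)
      then have "ennreal_of_enat k = trunc j k" by (simp add: trunc_def)
      then show ?thesis by (auto intro: SUP_upper)
    next
      case infinity
      then show ?thesis by (simp add: trunc_def ennreal_SUP_of_nat_eq_top)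
    qed
  qed (auto intro!: SUP_least simp: trunc_def)
  have "A ennreal_of_enat 0 = (SUP N. A (trunc N) 0)"
    unfolding A_def sup
  proof (rule nn_integral_monotone_convergence_SUP)
    have "trunc i k \<le> trunc j k" if "i \<le> j" for i j k
      unfolding trunc_def ennreal_of_enat_le_iff using that by (intro min.mono) auto
    then show "incseq (\<lambda>N \<omega>. trunc N (btime 0 \<omega>))"
      by (simp add: incseq_def le_fun_def)
  qed simp
  also have "\<dots> \<le> ennreal m"
    using trunc_upper[of _ 1] by (auto intro!: SUP_least)
  finally have up: "A ennreal_of_enat 0 \<le> ennreal m" .
  define r where "r = (1 + g) / 2"
  define \<rho> where "\<rho> = p / r + q * r"
  have r: "1 < r" "r < g" using g by (auto simp: r_def)
  have "(g - r) * (r - 1) > 0" using r by simp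
  then have "g + r * r < r * (g + 1)" by (simp add: algebra_simps)
  moreover have \<rho>_eq: "\<rho> = (g + r * r) / (r * (g + 1))"
  proof -
    have "p / r = g / (r * (g + 1))" "q * r = r * r / (r * (g + 1))"
      using r g by (simp_all add: p_def q_def)
    then show ?thesis by (simp add: \<rho>_def add_divide_distrib)
  qed
  moreover have "0 < r * (g + 1)" using r g by simp
  ultimately have \<rho>: "0 \<le> \<rho>" "\<rho> < 1"
    using r g unfolding \<rho>_eq by (simp, simp only: pos_divide_less_eq mult_1_left)
  have "(\<lambda>N. m - m / (r - 1) * \<rho> ^ N * r) \<longlonglongrightarrow> m - m / (r - 1) * 0 * r"
    using \<rho> by (intro tendsto_intros LIMSEQ_power_zero) auto
  then have "(\<lambda>N. ennreal (m - m / (r - 1) * \<rho> ^ N * r)) \<longlonglongrightarrow> ennreal m"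
    by (intro tendsto_ennrealI) simp
  moreover have "ennreal (m - m / (r - 1) * \<rho> ^ N * r) \<le> A ennreal_of_enat 0" for N
    using trunc_lower[OF r(1) refl, of 1 N] A_mono[of "trunc N" ennreal_of_enat 0]
    by (auto simp: trunc_def \<rho>_def intro: order_trans)
  ultimately have "ennreal m \<le> A ennreal_of_enat 0"
    by (intro LIMSEQ_le_const2) auto
  with up A0 show ?thesis by simp
qed

lemma mean: "biased_mean g = m"
  using m_pos by (simp add: biased_mean_def S_eq mean_nn)

definition expo :: "real \<Rightarrow> enat \<Rightarrow> ennreal" where
  "expo l k = (case k of enat t \<Rightarrow> ennreal (exp (l * real t)) | \<infinity> \<Rightarrow> 0)"

lemma mgf_A: "biased_mgf g l = A (expo l) 0"
  by (simp add: biased_mgf_def A_def S_eq btime_0 expo_def)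

lemma mgf_root:
  assumes l: "l < 0" and F: "0 < F" "F \<le> 1" and s: "exp l * (p + q * F\<^sup>2) = F"
  shows "biased_mgf g l = ennreal F"
proof -
  define a where "a k = enn2real (A (expo l) (1 - int k))" for k
  have le1: "A (expo l) x \<le> 1" for x
  proof -
    have "A (expo l) x \<le> A (\<lambda>_. 1) x"
      using l by (intro A_mono) (auto simp: expo_def mult_nonpos_nonneg split: enat.split)
    then show ?thesis by (simp add: A_def emeasure_space_1)
  qed
  have a: "A (expo l) (1 - int k) = ennreal (a k)" for k
    using le1[of "1 - int k"] unfolding a_def
    by (subst ennreal_enn2real) (auto intro: le_less_trans)
  have a01: "0 \<le> a k" "a k \<le> 1" for k
    using le1[of "1 - int k"] by (auto simp: a a_def[symmetric]) (simp add: a_def)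
  have a0: "a 0 = 1" by (simp add: a_def A_1 expo_def zero_enat_def)
  have *: "expo l \<circ> eSuc = (\<lambda>k. ennreal (exp l) * expo l k)"
    by (rule ext) (auto simp: expo_def eSuc_def algebra_simps exp_add ennreal_mult'[symmetric] split: enat.split)
  have **: "A (\<lambda>k. ennreal (exp l) * expo l k) x = ennreal (exp l) * A (expo l) x" for x
    unfolding A_def by (rule nn_integral_cmult) auto
  have step: "a (Suc k) = exp l * (p * a k + q * a (Suc (Suc k)))" for k
  proof -
    have "ennreal (a (Suc k)) = ennreal p * (ennreal (exp l) * ennreal (a k))
        + ennreal q * (ennreal (exp l) * ennreal (a (Suc (Suc k))))"
      unfolding a[symmetric] by (subst A_step', simp only: * **)
    also have "\<dots> = ennreal (exp l * (p * a k + q * a (Suc (Suc k))))"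
      using pq a01 by (simp add: ennreal_mult'[symmetric] ennreal_plus[symmetric] algebra_simps del: ennreal_plus)
    finally show ?thesis using a01 pq by (subst (asm) ennreal_inj) auto
  qed
  have stepF: "F ^ Suc k = exp l * (p * F ^ k + q * F ^ Suc (Suc k))" for k
  proof -
    have "F ^ Suc k = exp l * (p + q * F\<^sup>2) * F ^ k" by (simp add: s)
    also have "\<dots> = exp l * (p * F ^ k + q * F ^ Suc (Suc k))"
      by (simp add: distrib_left distrib_right power2_eq_square mult_ac)
    finally show ?thesis .
  qed
  have bound: "\<bar>a k - F ^ k\<bar> \<le> exp l ^ N" for N k
  proof (induction N arbitrary: k)
    case 0
    have "0 \<le> F ^ k" "F ^ k \<le> 1" using F by (auto intro: power_le_one)
    with a01[of k] show ?case by (auto simp: abs_if)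
  next
    case (Suc N)
    show ?case
    proof (cases k)
      case 0
      then show ?thesis by (simp add: a0)
    next
      case (Suc j)
      have "a k - F ^ k = exp l * (p * (a j - F ^ j) + q * (a (Suc (Suc j)) - F ^ Suc (Suc j)))"
        unfolding Suc step[of j] stepF[of j] by (simp add: algebra_simps)
      also have "\<bar>\<dots>\<bar> = exp l * \<bar>p * (a j - F ^ j) + q * (a (Suc (Suc j)) - F ^ Suc (Suc j))\<bar>"
        by (simp add: abs_mult)
      also have "\<dots> \<le> exp l * (p * \<bar>a j - F ^ j\<bar> + q * \<bar>a (Suc (Suc j)) - F ^ Suc (Suc j)\<bar>)"
        using pq abs_triangle_ineq[of "p * (a j - F ^ j)" "q * (a (Suc (Suc j)) - F ^ Suc (Suc j))"]
        by (simp add: abs_mult)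
      also have "\<dots> \<le> exp l * (p * exp l ^ N + q * exp l ^ N)"
        using pq by (intro mult_left_mono add_mono Suc.IH) auto
      also have "\<dots> = exp l * ((p + q) * exp l ^ N)" by (simp only: distrib_right)
      also have "\<dots> = exp l ^ Suc N" using pq by simp
      finally show ?thesis .
    qed
  qed
  have "(\<lambda>N. exp l ^ N) \<longlonglongrightarrow> 0" using l by (intro LIMSEQ_power_zero) auto
  then have "\<bar>a 1 - F ^ 1\<bar> \<le> 0"
    by (rule LIMSEQ_le_const) (use bound in blast)
  then have "a 1 = F" by simp
  with a[of 1] show ?thesis by (simp add: mgf_A)
qed

lemma mgf_root_exists:
  assumes "l < 0"
  obtains F where "0 < F" "F < 1" "exp l * (p + q * F\<^sup>2) = F"
proof -
  let ?f = "\<lambda>F. F - exp l * (p + q * F\<^sup>2)"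
  have c: "continuous_on {0..1} ?f"
    by (intro continuous_intros)
  have 1: "0 \<le> ?f 1"
    using assms by (simp only: power_one mult_1_right pq(3)) simp
  have 0: "?f 0 \<le> 0"
    using pq(1) by simp
  have "\<exists>F\<ge>0. F \<le> 1 \<and> ?f F = 0"
    by (rule IVT'[OF 0 1 zero_le_one c])
  then obtain F where F: "0 \<le> F" "F \<le> 1" "F - exp l * (p + q * F\<^sup>2) = 0" by blast
  from F(3) have eq: "exp l * (p + q * F\<^sup>2) = F" by linarith
  have "F \<noteq> 0"
  proof
    assume "F = 0"
    with eq have "exp l * p = 0" by simp
    with pq(1) show False by simp
  qed
  moreover have "F \<noteq> 1"
  proof
    assume "F = 1"
    with eq have "exp l * (p + q) = 1" by simp
    then have "exp l = 1" by (simp only: pq(3) mult_1_right)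
    with assms show False by simp
  qed
  ultimately show ?thesis using F(1,2) by (intro that[OF _ _ eq]) linarith+
qed

lemma mgf_nonneg:
  assumes l: "0 \<le> l"
  shows "ennreal (exp (l * m)) \<le> biased_mgf g l"
proof -
  have T: "(\<lambda>\<omega>. ennreal_of_enat (biased_time \<omega>)) \<in> borel_measurable S"
    using f_measurable[of ennreal_of_enat 0] unfolding btime_0 .
  have E: "(\<lambda>\<omega>. expo l (biased_time \<omega>)) \<in> borel_measurable S"
    using f_measurable[of "expo l" 0] unfolding btime_0 .
  have "(\<integral>\<^sup>+\<omega>. ennreal_of_enat (biased_time \<omega>) \<partial>S) \<noteq> \<infinity>"
    unfolding mean_nn by simp
  then have "AE \<omega> in S. ennreal_of_enat (biased_time \<omega>) \<noteq> \<infinity>"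
    by (rule nn_integral_noteq_infinite[OF T])
  then have fin: "AE \<omega> in S. biased_time \<omega> \<noteq> \<infinity>"
    by (rule eventually_mono) (metis ennreal_of_enat_infty)
  let ?c = "exp (l * m)"
  have pw: "ennreal ?c + ennreal (?c * l) * of_nat t \<le> ennreal (?c * l * m) + ennreal (exp (l * real t))" for t
  proof -
    have "1 + l * (real t - m) \<le> exp (l * (real t - m))" by (rule exp_ge_add_one_self)
    then have "?c * (1 + l * (real t - m)) \<le> ?c * exp (l * (real t - m))" by simp
    also have "\<dots> = exp (l * real t)" by (simp add: exp_add[symmetric] algebra_simps)
    finally have "?c + ?c * l * real t \<le> ?c * l * m + exp (l * real t)" by (simp add: algebra_simps)
    then have "ennreal (?c + ?c * l * real t) \<le> ennreal (?c * l * m + exp (l * real t))"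
      by (rule ennreal_leI)
    moreover have "ennreal (?c + ?c * l * real t) = ennreal ?c + ennreal (?c * l) * of_nat t"
      using l unfolding ennreal_of_nat_eq_real_of_nat
      by (subst ennreal_plus) (simp_all add: ennreal_mult')
    moreover have "ennreal (?c * l * m + exp (l * real t)) = ennreal (?c * l * m) + ennreal (exp (l * real t))"
      using l m_pos by (intro ennreal_plus) auto
    ultimately show ?thesis by (simp only:)
  qed
  have "ennreal (?c * l) * ennreal m + ennreal ?c
      = ennreal ?c + ennreal (?c * l) * (\<integral>\<^sup>+\<omega>. ennreal_of_enat (biased_time \<omega>) \<partial>S)"
    by (simp only: mean_nn add.commute)
  also have "\<dots> = (\<integral>\<^sup>+\<omega>. ennreal ?c + ennreal (?c * l) * ennreal_of_enat (biased_time \<omega>) \<partial>S)"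
    by (simp only: nn_integral_add[OF borel_measurable_const borel_measurable_times_ennreal[OF borel_measurable_const T]]
        nn_integral_cmult[OF T] nn_integral_const emeasure_space_1 mult_1_right)
  also have "\<dots> \<le> (\<integral>\<^sup>+\<omega>. ennreal (?c * l * m) + expo l (biased_time \<omega>) \<partial>S)"
  proof (rule nn_integral_mono_AE, rule eventually_mono[OF fin])
    fix \<omega> assume "biased_time \<omega> \<noteq> \<infinity>"
    then obtain t where "biased_time \<omega> = enat t" by blast
    then show "ennreal ?c + ennreal (?c * l) * ennreal_of_enat (biased_time \<omega>)
        \<le> ennreal (?c * l * m) + expo l (biased_time \<omega>)"
      unfolding expo_def using pw[of t] by simp
  qed
  also have "\<dots> = ennreal (?c * l * m) + biased_mgf g l"
    by (simp only: mgf_A A_def btime_0 nn_integral_add[OF borel_measurable_const E]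
        nn_integral_const emeasure_space_1 mult_1_right)
  also have "ennreal (?c * l * m) = ennreal (?c * l) * ennreal m"
    using l by (intro ennreal_mult') simp
  finally show ?thesis
    by (rule ennreal_add_left_cancel_le[THEN iffD1, THEN disjE]) (simp_all add: ennreal_mult_eq_top_iff)
qed

lemma rate:
  assumes a: "1 < a" "a < m"
  shows "exp (- biased_rate g a) =
    g / (a + 1) * (g / (a\<^sup>2 - 1)) powr ((a - 1) / 2) * (2 * a / (g + 1)) powr a"
proof -
  define al be where "al = (a + 1) / (2 * a)" and "be = (a - 1) / (2 * a)"
  have ab: "0 < al" "0 < be" "al + be = 1"
    using a by (auto simp: al_def be_def field_simps)
  define J where "J = - ((a + 1) / 2) * ln (p / al) - (a - 1) / 2 * ln (q / be)"
  have young: "(a - 1) * ln F - a * ln (p + q * F\<^sup>2) \<le> J" if F: "0 < F" for F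
  proof -
    define D where "D = p + q * F\<^sup>2"
    have D: "0 < D" using pq F by (simp add: D_def add_pos_pos)
    have 1: "ln (p / al) - ln D \<le> p / al / D - 1"
      using ln_le_minus_one[of "p / al / D"] ln_divide_pos[of "p / al" D] pq ab D by simp
    have 2: "ln (q / be) + 2 * ln F - ln D \<le> q * F\<^sup>2 / be / D - 1"
    proof -
      have "ln (q * F\<^sup>2 / be / D) = ln (q / be) + 2 * ln F - ln D"
        using pq ab D F ln_divide_pos[of "q * F\<^sup>2 / be" D] ln_mult_pos[of "q / be" "F\<^sup>2"]
        by (simp add: ln_realpow)
      then show ?thesis
        using ln_le_minus_one[of "q * F\<^sup>2 / be / D"] pq ab D F by simp
    qed
    have "al * (ln (p / al) - ln D) + be * (ln (q / be) + 2 * ln F - ln D)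
        \<le> al * (p / al / D - 1) + be * (q * F\<^sup>2 / be / D - 1)"
      using 1 2 ab by (intro add_mono mult_left_mono) auto
    also have "\<dots> = (p + q * F\<^sup>2) / D - (al + be)"
      using ab by (simp add: right_diff_distrib add_divide_distrib)
    also have "\<dots> = 0" using D ab by (simp add: D_def)
    finally have "al * ln (p / al) + be * (ln (q / be) + 2 * ln F) \<le> (al + be) * ln D"
      by (simp add: algebra_simps)
    then have "al * ln (p / al) + be * (ln (q / be) + 2 * ln F) \<le> ln D" using ab by simp
    then have "a * (al * ln (p / al) + be * (ln (q / be) + 2 * ln F)) \<le> a * ln D"
      using a by simp
    moreover have "a * al = (a + 1) / 2" "a * be = (a - 1) / 2"
      using a by (auto simp: al_def be_def)
    then have "a * (al * ln (p / al) + be * (ln (q / be) + 2 * ln F))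
        = (a + 1) / 2 * ln (p / al) + (a - 1) / 2 * (ln (q / be) + 2 * ln F)"
      by (simp only: distrib_left mult.assoc[symmetric])
    moreover have "(a - 1) / 2 * (y + 2 * z) = (a - 1) / 2 * y + (a - 1) * z" for y z
      by (simp add: field_simps)
    ultimately have "(a + 1) / 2 * ln (p / al) + ((a - 1) / 2 * ln (q / be) + (a - 1) * ln F) \<le> a * ln D"
      by (simp only:)
    then show ?thesis unfolding J_def D_def minus_mult_left[symmetric] by linarith
  qed
  have ub: "l * a - ln (enn2real (biased_mgf g l)) \<le> J" if fin: "biased_mgf g l < \<infinity>" for l
  proof (cases "l < 0")
    case True
    obtain F where F: "0 < F" "F < 1" "exp l * (p + q * F\<^sup>2) = F"
      using mgf_root_exists[OF True] .
    have mg: "biased_mgf g l = ennreal F" using F by (intro mgf_root[OF True]) auto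
    have D: "0 < p + q * F\<^sup>2" using pq F by (simp add: add_pos_pos)
    have "ln F = ln (exp l * (p + q * F\<^sup>2))" by (simp only: F)
    also have "\<dots> = l + ln (p + q * F\<^sup>2)" using D by (simp add: ln_mult)
    finally have l: "l = ln F - ln (p + q * F\<^sup>2)" by simp
    show ?thesis using young[OF F(1)] F(1) unfolding mg unfolding l by (simp add: algebra_simps)
  next
    case False
    have "exp (l * m) \<le> enn2real (biased_mgf g l)"
      using enn2real_mono[OF mgf_nonneg[of l]] False fin by simp
    then have "l * m \<le> ln (enn2real (biased_mgf g l))"
      using ln_mono[of "exp (l * m)" "enn2real (biased_mgf g l)"] by simp
    moreover have "l * a \<le> l * m" using False a by (intro mult_left_mono) auto
    moreover have "0 \<le> J" using young[of 1] pq by simp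
    ultimately show ?thesis by simp
  qed
  define F where "F = sqrt (g * (a - 1) / (a + 1))"
  have F0: "0 < F" using a g by (simp add: F_def)
  have F2: "F\<^sup>2 = g * (a - 1) / (a + 1)" using a g by (simp add: F_def)
  have "a * (g - 1) < g + 1" using a g by (simp add: m_def pos_less_divide_eq)
  then have "g * (a - 1) < a + 1" by (simp add: algebra_simps)
  then have "F\<^sup>2 < 1" unfolding F2 using a by simp
  then have F1: "F < 1" using F0 by (simp add: power_less_one_iff)
  have gne: "g + 1 \<noteq> 0" "a + 1 \<noteq> 0" using g a by auto
  have D: "p + q * F\<^sup>2 = p / al"
  proof -
    have "p + q * F\<^sup>2 = g / (g + 1) * (1 + (a - 1) / (a + 1))"
      unfolding F2 p_def q_def by (simp add: distrib_left)
    also have "1 + (a - 1) / (a + 1) = 2 * a / (a + 1)"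
      using a by (simp add: field_simps)
    finally show ?thesis by (simp add: p_def al_def)
  qed
  have D2: "q * F\<^sup>2 / be = p / al"
  proof -
    have "q * F\<^sup>2 / be = g / (g + 1) * (((a - 1) / be) / (a + 1))"
      unfolding F2 q_def by simp
    also have "(a - 1) / be = 2 * a" using a by (simp add: be_def)
    finally show ?thesis by (simp add: p_def al_def)
  qed
  define l where "l = ln F - ln (p / al)"
  have Dpos: "0 < p / al" using pq ab by simp
  have el: "exp l * (p + q * F\<^sup>2) = F"
  proof -
    have "exp l = F / (p / al)" unfolding l_def using F0 Dpos by (simp only: exp_diff exp_ln)
    moreover have "F / x * x = F" if "0 < x" for x using that by simp
    ultimately show ?thesis unfolding D by (simp only: Dpos)
  qed
  have "p + q * F\<^sup>2 - F > 0"
  proof -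
    have "p + q * F\<^sup>2 - (p + q) * F = (1 - F) * (p - q * F)"
      by (simp add: algebra_simps power2_eq_square)
    then have "p + q * F\<^sup>2 - F = (1 - F) * (p - q * F)"
      by (simp only: pq(3) mult_1_left)
    moreover have "q * F < p"
      using mult_strict_left_mono[OF F1 pq(2)] pq(4) by simp
    ultimately show ?thesis using F1 by simp
  qed
  then have "F < p / al" using D by simp
  then have l0: "l < 0" using F0 by (simp add: l_def)
  have mg: "biased_mgf g l = ennreal F" using F0 F1 el by (intro mgf_root[OF l0]) auto
  have "ln (q / be) + 2 * ln F = ln (p / al)"
  proof -
    have "q / be * F\<^sup>2 = p / al" using D2 by simp
    then have "ln (p / al) = ln (q / be * F\<^sup>2)" by (simp only:)
    also have "\<dots> = ln (q / be) + ln (F\<^sup>2)" using pq ab F0 by (intro ln_mult_pos) auto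
    finally show ?thesis using F0 by (simp add: ln_realpow)
  qed
  then have qb: "ln (q / be) = ln (p / al) - 2 * ln F" by simp
  have att: "l * a - ln (enn2real (biased_mgf g l)) = J"
  proof -
    have "(y - x) * a - y = - ((a + 1) / 2) * x - (a - 1) / 2 * (x - 2 * y)" for x y
      by (simp add: field_simps)
    then show ?thesis
      unfolding mg unfolding J_def qb l_def by (simp only: enn2real_ennreal[OF less_imp_le[OF F0]])
  qed
  have rJ: "biased_rate g a = J"
    unfolding biased_rate_def
  proof (rule cSup_eq_maximum)
    show "J \<in> (\<lambda>l. l * a - ln (enn2real (biased_mgf g l))) ` {l. biased_mgf g l < \<infinity>}"
      by (rule image_eqI[of _ _ l]) (rule att[symmetric], simp add: mg)
  next
    fix x assume "x \<in> (\<lambda>l. l * a - ln (enn2real (biased_mgf g l))) ` {l. biased_mgf g l < \<infinity>}"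
    then show "x \<le> J" using ub by blast
  qed
  have lnp: "ln (p / al) = ln g - ln (g + 1) + ln (2 * a) - ln (a + 1)"
    unfolding p_def al_def using g a by (simp add: ln_div ln_mult)
  have lnq: "ln (q / be) = - ln (g + 1) + ln (2 * a) - ln (a - 1)"
    unfolding q_def be_def using g a by (simp add: ln_div ln_mult)
  have a21: "a\<^sup>2 - 1 = (a + 1) * (a - 1)" by (simp add: algebra_simps power2_eq_square)
  have "0 < a\<^sup>2 - 1" unfolding a21 using a by simp
  have "g / (a + 1) * (g / (a\<^sup>2 - 1)) powr ((a - 1) / 2) * (2 * a / (g + 1)) powr a
      = exp (ln g - ln (a + 1)) * exp ((a - 1) / 2 * (ln g - (ln (a + 1) + ln (a - 1))))
          * exp (a * (ln (2 * a) - ln (g + 1)))"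
  proof -
    have "g / (a + 1) = exp (ln g - ln (a + 1))"
      using g a by (simp add: exp_diff)
    moreover have "ln (g / (a\<^sup>2 - 1)) = ln g - (ln (a + 1) + ln (a - 1))"
      unfolding a21 using g a by (simp add: ln_divide_pos ln_mult_pos)
    moreover have "ln (2 * a / (g + 1)) = ln (2 * a) - ln (g + 1)"
      using g a by (intro ln_divide_pos) auto
    moreover have "g / (a\<^sup>2 - 1) \<noteq> 0"
      using divide_pos_pos[OF _ \<open>0 < a\<^sup>2 - 1\<close>, of g] g by linarith
    moreover have "2 * a / (g + 1) \<noteq> 0" using g a by simp
    ultimately show ?thesis by (simp only: powr_def if_False)
  qed
  also have "\<dots> = exp (- J)"
  proof -
    have "x - y + (a - 1) / 2 * (x - (y + z)) + a * (v - w)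
        = - (- ((a + 1) / 2) * (x - w + v - y) - (a - 1) / 2 * (- w + v - z))" for v w x y z
      by (simp add: field_simps)
    then show ?thesis
      unfolding exp_add[symmetric] J_def lnp lnq by (simp only:)
  qed
  finally show ?thesis by (simp add: rJ)
qed

end

theorem biased_mean_eq:
  assumes "1 < g"
  shows "biased_mean g = (g + 1) / (g - 1)"
proof -
  interpret biased g using assms by unfold_locales
  show ?thesis using mean by (simp add: m_def)
qed

theorem exp_biased_rate_eq:
  assumes "1 < g" "1 < a" "a < biased_mean g"
  shows "exp (- biased_rate g a) =
    g / (a + 1) * (g / (a\<^sup>2 - 1)) powr ((a - 1) / 2) * (2 * a / (g + 1)) powr a"
proof -
  interpret biased g using assms by unfold_locales
  show ?thesis using assms(2,3) by (intro rate) (simp_all only: mean)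
qed

end

theory Submission
  imports Defs
begin

text \<open>
  Discount time by a factor \<open>l < 1\<close>, let \<open>f x\<close> be the expectation of \<open>l ^ T\<close> for the walk
  from \<open>x\<close>, where \<open>T\<close> is the hitting time of \<open>Z\<close>, and let \<open>v x\<close> be the discounted Green function
  of the walk from \<open>u\<close> stopped at \<open>Z\<close>, divided by the weight of \<open>x\<close>. The walk biased by \<open>l ^ T\<close> is
  reversible with conductances \<open>l * w x y * f x * f y\<close> (Doob transform). In it the net
  number of crossings of an edge from \<open>x\<close> to \<open>y\<close> is proportional to
  \<open>w x y * (v x * f y - f x * v y)\<close>, a flow of \<open>f u\<close> units from \<open>u\<close> to \<open>Z\<close> that runs down the
  potential \<open>v / f\<close>, and the number of crossings in both directions is proportional to
  \<open>w x y * (v x * f y + f x * v y)\<close>. If the potential drops by a factor \<open>t\<close> along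
  the edge, the ratio of all crossings to net crossings is \<open>(t + 1) / (t - 1)\<close>, the hyperbolic
  cotangent of \<open>ln t / 2\<close>, which is convex in \<open>ln t\<close>. The mean time under the bias is the
  total number of crossings. Every unit of flow uses at least \<open>n\<close> edges before its last one, while the
  total drop of \<open>ln (v / f)\<close> that it suffers there is bounded on average in terms of the weight of
  \<open>Z\<close> and the resistance. Hence the time is smallest if each of \<open>n\<close> edges
  has the same factor \<open>G\<close>, and it is at least \<open>1 + n * (G + 1) / (G - 1)\<close>. In place of Jensen's
  inequality, which would need a decomposition of the flow into paths, the tangent to the convex function
  is used on each edge (\<open>edge_bound\<close>); all that remains of the paths is that the
  distance to \<open>Z\<close> is 1-Lipschitz (\<open>traffic_lower_bound\<close>). This gives
  \<open>total_time_resistance\<close>. If instead of the resistance only the weight of \<open>u\<close> is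
  known, then the time spent at \<open>u\<close> itself enters the balance: a large resistance means many
  returns to \<open>u\<close> (\<open>total_time_volume\<close>).

  The mean time under the bias is also the logarithmic derivative of \<open>f u\<close> with respect to \<open>l\<close>
  (\<open>total_time_hit\<close>). Write \<open>f u = l * F ^ n\<close>. The bias replaces \<open>g\<close> by \<open>G = g / F\<^sup>2\<close>, so the
  bound becomes a differential inequality for \<open>F\<close> as a function of \<open>l\<close>. The generating
  function \<open>Phi\<close> of the hitting time of 1 by the biased walk on the integers satisfies it with
  equality, being the root of \<open>Phi * (g + 1) = l * (g + Phi\<^sup>2)\<close>. Both functions are at most 1 as
  \<open>l\<close> tends to 1, so comparison gives \<open>F \<le> Phi\<close> (\<open>growth_comparison\<close>), that is, the expectation of
  \<open>l ^ T\<close> is at most \<open>l * Phi ^ n\<close>: in the Laplace transform order, \<open>T - 1\<close> dominates a sum of \<open>n\<close>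
  independent copies of the biased hitting time. The bound on the mean is the derivative of
  this inequality at \<open>l = 1\<close>, and the large deviation bound is Markov's inequality at the
  optimal \<open>l\<close>.

  To keep all sums finite, the walk is first killed outside a finite set \<open>K\<close> of vertices. This only makes
  vertex weights larger than the sum of the weights of their remaining edges, and the identities
  above stay valid. The sets \<open>K\<close> exhaust the graph in the sense that a walk of fixed
  length stays in a large \<open>K\<close> with probability close to 1 (\<open>stay_prob\<close>).
\<close>

section \<open>Tangent inequalities\<close>

text \<open>The function \<open>(t + 1) / (t - 1)\<close> is convex in \<open>ln t\<close>; this is its tangent at \<open>t = G\<close>. With
  \<open>q = t / G\<close> the difference of the two sides reduces to \<open>ln q \<ge> 1 - 1 / q\<close>.\<close>
lemma coth_tangent:
  fixes t G :: real
  assumes "1 < t" "1 < G"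
  shows "(t + 1) / (t - 1) \<ge> (G + 1) / (G - 1) - 2 * G / (G - 1)\<^sup>2 * (ln t - ln G)"
proof -
  define q where "q = t / G"
  have q: "0 < q" "t = G * q" "1 < G * q" using assms by (auto simp: q_def)
  have "1 - 1 / q \<le> ln q"
    using ln_le_minus_one[of "1 / q"] q by (simp add: ln_div)
  moreover have "1 - 1 / q - (q - 1) * (G - 1) / (G * q - 1) = (q - 1)\<^sup>2 / (q * (G * q - 1))"
    using q assms by (simp add: divide_simps power2_eq_square) (simp add: algebra_simps)
  moreover have "0 \<le> (q - 1)\<^sup>2 / (q * (G * q - 1))" using q by simp
  ultimately have "(q - 1) * (G - 1) / (G * q - 1) \<le> ln q" by linarith
  then have "2 * G / (G - 1)\<^sup>2 * ((q - 1) * (G - 1) / (G * q - 1)) \<le> 2 * G / (G - 1)\<^sup>2 * ln q"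
    using assms by (intro mult_left_mono) auto
  moreover have "2 * G / (G - 1)\<^sup>2 * ((q - 1) * (G - 1) / (G * q - 1)) = (G + 1) / (G - 1) - (t + 1) / (t - 1)"
    using q(3) assms unfolding q(2) by (simp add: divide_simps power2_eq_square) (simp add: algebra_simps)
  moreover have "ln q = ln t - ln G" using assms by (simp add: q_def ln_div)
  ultimately show ?thesis by simp
qed

text \<open>The previous inequality for \<open>t = a / b\<close>, multiplied by \<open>a - b\<close>. The form is symmetric in \<open>a\<close> and
  \<open>b\<close>, so that it can be summed over ordered pairs of vertices.\<close>
lemma edge_tangent:
  fixes a b G :: real
  assumes "0 < a" "0 < b" "1 < G"
  shows "a + b \<ge> \<bar>a - b\<bar> * ((G + 1) / (G - 1) + 2 * G / (G - 1)\<^sup>2 * ln G)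
      - 2 * G / (G - 1)\<^sup>2 * ((a - b) * (ln a - ln b))"
proof -
  let ?m = "(G + 1) / (G - 1)" and ?k = "2 * G / (G - 1)\<^sup>2"
  have ordered: "c + d \<ge> (c - d) * (?m + ?k * ln G) - ?k * ((c - d) * (ln c - ln d))"
    if cd: "0 < d" "d < c" for c d :: real
  proof -
    have "(c / d + 1) / (c / d - 1) \<ge> ?m - ?k * (ln (c / d) - ln G)"
      using cd assms by (intro coth_tangent) auto
    moreover have "(c / d + 1) / (c / d - 1) = (c + d) / (c - d)"
      using cd by (simp add: divide_simps)
    moreover have "ln (c / d) = ln c - ln d" using cd by (simp add: ln_div)
    ultimately have "?m - ?k * (ln c - ln d - ln G) \<le> (c + d) / (c - d)" by simp
    then have "(?m - ?k * (ln c - ln d - ln G)) * (c - d) \<le> c + d"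
      using cd by (subst (asm) pos_le_divide_eq) auto
    moreover have "(?m - ?k * (l - l' - l'')) * z = z * (?m + ?k * l'') - ?k * (z * (l - l'))" for l l' l'' z
      by (simp only: algebra_simps)
    ultimately show ?thesis by simp
  qed
  consider "a = b" | "b < a" | "a < b" by linarith
  then show ?thesis
  proof cases
    case 2
    then show ?thesis using ordered[of b a] assms by simp
  next
    case 3
    have "(b - a) * (ln b - ln a) = (a - b) * (ln a - ln b)" by (simp add: algebra_simps)
    then show ?thesis using ordered[of a b] 3 assms by simp
  qed (use assms in simp)
qed

lemma ln_le_tangent:
  fixes x c :: real
  assumes "0 < x" "0 < c"
  shows "ln x \<le> ln c + (x / c - 1)"
  using ln_le_minus_one[of "x / c"] assms by (simp add: ln_div)

text \<open>If the weights \<open>p\<close> have total mass 1 and \<open>c\<close> is the mean of \<open>x\<close>, then summing this inequality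
  bounds the mean of \<open>ln x\<close> under the tilted weights \<open>p * (c + d - x) / d\<close>, which
  favour small \<open>x\<close>, by \<open>ln c\<close>: Chebyshev's and Jensen's inequalities in one, in a form
  that holds pointwise.\<close>
lemma ln_chebyshev_tangent:
  fixes x c d :: real
  assumes "0 < x" "0 < c" "0 < d"
  shows "(c + d - x) * (ln x - ln c) \<le> d * (x - c) / c"
proof -
  have ln: "ln x - ln c \<le> (x - c) / c"
    using ln_le_tangent[of x c] assms by (simp add: diff_divide_distrib)
  show ?thesis
  proof (cases "x \<le> c + d")
    case True
    then have "(c + d - x) * (ln x - ln c) \<le> (c + d - x) * ((x - c) / c)"
      using ln by (intro mult_left_mono) auto
    also have "\<dots> = (d * (x - c) - (x - c)\<^sup>2) / c"
      by (simp add: algebra_simps power2_eq_square)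
    also have "\<dots> \<le> d * (x - c) / c" using assms by (intro divide_right_mono) auto
    finally show ?thesis .
  next
    case False
    then have "0 \<le> ln x - ln c" using assms by simp
    then have "(c + d - x) * (ln x - ln c) \<le> 0"
      using False by (intro mult_nonpos_nonneg) auto
    also have "0 \<le> d * (x - c) / c" using False assms by simp
    finally show ?thesis .
  qed
qed

text \<open>Summation by parts for a flow \<open>h\<close> and a potential \<open>D\<close>.\<close>
lemma sum_antisym_weighted:
  fixes h :: "'v \<Rightarrow> 'v \<Rightarrow> real"
  assumes "\<And>x y. h y x = - h x y"
  shows "(\<Sum>x\<in>A. \<Sum>y\<in>A. h x y * (D x - D y)) = 2 * (\<Sum>x\<in>A. D x * (\<Sum>y\<in>A. h x y))"
proof -
  have "(\<Sum>x\<in>A. \<Sum>y\<in>A. h x y * D y) = (\<Sum>y\<in>A. \<Sum>x\<in>A. h x y * D y)" by (rule sum.swap)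
  also have "\<dots> = - (\<Sum>x\<in>A. \<Sum>y\<in>A. h x y * D x)"
    by (subst assms) (simp add: sum_negf)
  finally show ?thesis
    by (simp add: right_diff_distrib sum_subtractf sum_distrib_left mult.commute)
qed

section \<open>The flow of the discounted walk on a finite network\<close>

text \<open>The quantity through which the weight of \<open>Z\<close> enters all estimates.\<close>
definition cut_weight :: "('v \<Rightarrow> 'v \<Rightarrow> real) \<Rightarrow> 'v set \<Rightarrow> 'v set \<Rightarrow> real" where
  "cut_weight w K Z = (\<Sum>x\<in>K - Z. \<Sum>z\<in>K \<inter> Z. w x z)"

text \<open>The data of the discounted walk on the finite set \<open>K\<close>: \<open>f\<close> stands for the generating function of the
  hitting time of \<open>Z\<close>, and \<open>v\<close> for the Green function with pole \<open>u\<close> over the vertex weight. The vertex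
  weights \<open>W\<close> are not tied to the sums of \<open>w\<close> over \<open>K\<close>; the difference is the rate at which
  the walk is killed on leaving \<open>K\<close>.\<close>
locale voltage_pair =
  fixes w :: "'v \<Rightarrow> 'v \<Rightarrow> real" and W :: "'v \<Rightarrow> real" and K Z :: "'v set" and u :: 'v
    and lam :: real and f v :: "'v \<Rightarrow> real"
  assumes K: "finite K" and u: "u \<in> K" "u \<notin> Z"
    and w_sym: "\<And>x y. w x y = w y x" and w_nonneg: "\<And>x y. 0 \<le> w x y"
    and W_pos: "\<And>x. 0 < W x" and lam: "0 < lam"
    and f_nonneg: "\<And>x. 0 \<le> f x" and v_nonneg: "\<And>x. 0 \<le> v x"
    and f_Z: "\<And>x. x \<in> Z \<Longrightarrow> f x = 1" and f_le: "\<And>x. x \<notin> Z \<Longrightarrow> f x \<le> lam"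
    and v_Z: "\<And>x. x \<in> Z \<Longrightarrow> v x = 0"
    and f_eq: "\<And>x. x \<notin> Z \<Longrightarrow> W x * f x = lam * (\<Sum>y\<in>K. w x y * f y)"
    and v_eq: "\<And>x. x \<notin> Z \<Longrightarrow> W x * v x = (if x = u then 1 else 0) + lam * (\<Sum>y\<in>K. w x y * v y)"
    and fu: "0 < f u"
begin

text \<open>\<open>cur\<close> and \<open>traffic\<close> are the expected net and total numbers of crossings of an edge by the walk
  biased by \<open>lam ^ T\<close>, \<open>leave\<close> is the expected number of passages from a vertex into \<open>Z\<close>, and
  \<open>total_time\<close> is the expected number of steps, all four multiplied by \<open>f u\<close>. The flow \<open>cur\<close> runs
  from higher to lower values of \<open>pot\<close>.\<close>
definition cur where "cur x y = lam * w x y * (v x * f y - f x * v y)"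
definition traffic where "traffic x y = lam * w x y * (v x * f y + f x * v y)"
definition pot where "pot x = ln (v x) - ln (f x)"
definition leave where "leave x = lam * v x * (\<Sum>z\<in>K \<inter> Z. w x z)"
definition total_time where "total_time = (\<Sum>x\<in>K - Z. W x * v x * f x)"

lemma cur_antisym: "cur y x = - cur x y"
  by (simp add: cur_def w_sym[of y x] algebra_simps)

lemma traffic_nonneg: "0 \<le> traffic x y"
  using lam w_nonneg f_nonneg v_nonneg by (simp add: traffic_def)

lemma abs_cur_le_traffic: "\<bar>cur x y\<bar> \<le> traffic x y"
proof -
  have "\<bar>v x * f y - f x * v y\<bar> \<le> v x * f y + f x * v y"
    using mult_nonneg_nonneg[OF v_nonneg[of x] f_nonneg[of y]]
      mult_nonneg_nonneg[OF f_nonneg[of x] v_nonneg[of y]] by linarith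
  then show ?thesis
    using lam w_nonneg[of x y] by (simp add: cur_def traffic_def abs_mult mult_left_mono)
qed

lemma sum_split_Z: "(\<Sum>y\<in>K. h y) = (\<Sum>y\<in>K - Z. h y) + (\<Sum>z\<in>K \<inter> Z. h z)" for h :: "'v \<Rightarrow> real"
  using sum.Int_Diff[OF K, of h Z] by simp

lemma div_cur: "x \<notin> Z \<Longrightarrow> (\<Sum>y\<in>K. cur x y) = (if x = u then f u else 0)"
proof -
  assume x: "x \<notin> Z"
  have "(\<Sum>y\<in>K. cur x y) = v x * (lam * (\<Sum>y\<in>K. w x y * f y)) - f x * (lam * (\<Sum>y\<in>K. w x y * v y))"
    by (simp add: cur_def sum_distrib_left sum_subtractf[symmetric] algebra_simps)
  also have "\<dots> = v x * (W x * f x) - f x * (W x * v x - (if x = u then 1 else 0))"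
    using f_eq[OF x] v_eq[OF x] by simp
  finally show ?thesis by (auto simp: algebra_simps)
qed

lemma sum_traffic:
  "x \<notin> Z \<Longrightarrow> (\<Sum>y\<in>K. traffic x y) = 2 * (W x * v x * f x) - (if x = u then f u else 0)"
proof -
  assume x: "x \<notin> Z"
  have "(\<Sum>y\<in>K. traffic x y) = v x * (lam * (\<Sum>y\<in>K. w x y * f y)) + f x * (lam * (\<Sum>y\<in>K. w x y * v y))"
    by (simp add: traffic_def sum_distrib_left sum.distrib[symmetric] algebra_simps)
  also have "\<dots> = v x * (W x * f x) + f x * (W x * v x - (if x = u then 1 else 0))"
    using f_eq[OF x] v_eq[OF x] by simp
  finally show ?thesis by (auto simp: algebra_simps)
qed

lemma sum_cur_Z: "(\<Sum>z\<in>K \<inter> Z. cur x z) = leave x"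
proof -
  have "(\<Sum>z\<in>K \<inter> Z. cur x z) = (\<Sum>z\<in>K \<inter> Z. lam * v x * w x z)"
    by (intro sum.cong) (auto simp: cur_def f_Z v_Z)
  then show ?thesis by (simp add: leave_def sum_distrib_left)
qed

lemma sum_traffic_Z: "(\<Sum>z\<in>K \<inter> Z. traffic x z) = leave x"
proof -
  have "(\<Sum>z\<in>K \<inter> Z. traffic x z) = (\<Sum>z\<in>K \<inter> Z. lam * v x * w x z)"
    by (intro sum.cong) (auto simp: traffic_def f_Z v_Z)
  then show ?thesis by (simp add: leave_def sum_distrib_left)
qed

lemma leave_nonneg: "0 \<le> leave x"
  using lam v_nonneg w_nonneg by (simp add: leave_def sum_nonneg)

text \<open>The flow out of \<open>u\<close> has to end in \<open>Z\<close>, since it has no other sources or sinks and \<open>K\<close> is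
  finite.\<close>
lemma sum_leave: "(\<Sum>x\<in>K - Z. leave x) = f u"
proof -
  have "(\<Sum>x\<in>K - Z. \<Sum>y\<in>K. cur x y) = (\<Sum>x\<in>K - Z. if x = u then f u else 0)"
    by (intro sum.cong refl div_cur) auto
  also have "\<dots> = f u" using K u by simp
  also have "(\<Sum>x\<in>K - Z. \<Sum>y\<in>K. cur x y) = (\<Sum>x\<in>K - Z. \<Sum>y\<in>K - Z. cur x y) + (\<Sum>x\<in>K - Z. leave x)"
    by (simp add: sum_split_Z[of "cur _"] sum.distrib sum_cur_Z)
  also have "(\<Sum>x\<in>K - Z. \<Sum>y\<in>K - Z. cur x y) = 0"
    using sum_antisym_weighted[of cur "\<lambda>_. 1" "K - Z", OF cur_antisym] by simp
  finally show ?thesis by simp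
qed

lemma leave_pos_imp:
  assumes "leave x \<noteq> 0"
  obtains z where "z \<in> K \<inter> Z" "0 < w x z" "0 < v x"
proof -
  have "v x \<noteq> 0" "(\<Sum>z\<in>K \<inter> Z. w x z) \<noteq> 0" using assms by (auto simp: leave_def)
  then obtain z where "z \<in> K \<inter> Z" "w x z \<noteq> 0" by (meson sum.neutral)
  then show ?thesis
    using that \<open>v x \<noteq> 0\<close> v_nonneg[of x] w_nonneg[of x z] by force
qed

text \<open>Positivity of \<open>f\<close> and \<open>v\<close> spreads along edges; hence logarithms are taken only of positive numbers
  wherever the current does not vanish.\<close>
lemma f_pos_step:
  assumes "x \<notin> Z" "y \<in> K" "0 < w x y" "0 < f y"
  shows "0 < f x"
proof -
  have "0 < w x y * f y" using assms by simp
  also have "\<dots> \<le> (\<Sum>y\<in>K. w x y * f y)"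
    using assms K w_nonneg f_nonneg by (intro member_le_sum) auto
  finally have "0 < W x * f x" using f_eq[OF assms(1)] lam by simp
  then show ?thesis using W_pos[of x] by (simp add: zero_less_mult_iff)
qed

lemma v_pos_step:
  assumes "x \<notin> Z" "y \<in> K" "0 < w x y" "0 < v y"
  shows "0 < v x"
proof -
  have "0 < w x y * v y" using assms by simp
  also have "\<dots> \<le> (\<Sum>y\<in>K. w x y * v y)"
    using assms K w_nonneg v_nonneg by (intro member_le_sum) auto
  finally have "0 < lam * (\<Sum>y\<in>K. w x y * v y)" using lam by simp
  then have "0 < W x * v x" unfolding v_eq[OF assms(1)] by (auto split: if_splits)
  then show ?thesis using W_pos[of x] by (simp add: zero_less_mult_iff)
qed

lemma leave_f_pos: "leave x \<noteq> 0 \<Longrightarrow> x \<notin> Z \<Longrightarrow> 0 < f x"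
  by (rule leave_pos_imp) (use f_Z f_pos_step in auto)

lemma v_u: "0 < v u"
proof -
  have "0 \<le> lam * (\<Sum>y\<in>K. w u y * v y)"
    using lam w_nonneg v_nonneg by (simp add: sum_nonneg)
  then have "0 < W u * v u" using v_eq[OF u(2)] by simp
  then show ?thesis using W_pos[of u] by (simp add: zero_less_mult_iff)
qed

lemma cut_weight_pos: "0 < cut_weight w K Z"
proof -
  obtain x where x: "x \<in> K - Z" "leave x \<noteq> 0"
    using sum_leave fu by (metis less_irrefl sum.neutral)
  obtain z where z: "z \<in> K \<inter> Z" "0 < w x z" using leave_pos_imp[OF x(2)] by blast
  have "w x z \<le> (\<Sum>z\<in>K \<inter> Z. w x z)" using z K w_nonneg by (intro member_le_sum) auto
  also have "\<dots> \<le> cut_weight w K Z" unfolding cut_weight_def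
    using x K w_nonneg by (intro member_le_sum) (auto intro: sum_nonneg)
  finally show ?thesis using z by simp
qed

lemma edge_bound:
  assumes xy: "x \<in> K - Z" "y \<in> K - Z" and G: "1 < G"
  shows "traffic x y \<ge> \<bar>cur x y\<bar> * ((G + 1) / (G - 1) + 2 * G / (G - 1)\<^sup>2 * ln G)
      - 2 * G / (G - 1)\<^sup>2 * (cur x y * (pot x - pot y))"
proof (cases "0 < w x y \<and> 0 < v x \<and> 0 < f x")
  case True
  then have pos: "0 < v x" "0 < f x" "0 < v y" "0 < f y" "0 < w y x"
    using v_pos_step[of y x] f_pos_step[of y x] xy w_sym[of x y] by (simp_all add: True)
  let ?c = "lam * w x y"
  have c: "0 < ?c" using True lam by simp
  have "?c * (v x * f y + f x * v y) \<ge> ?c * (\<bar>v x * f y - f x * v y\<bar> * ((G + 1) / (G - 1) + 2 * G / (G - 1)\<^sup>2 * ln G)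
      - 2 * G / (G - 1)\<^sup>2 * ((v x * f y - f x * v y) * (ln (v x * f y) - ln (f x * v y))))"
    by (rule mult_left_mono[OF edge_tangent]) (use c pos G in simp_all)
  moreover have "ln (v x * f y) - ln (f x * v y) = pot x - pot y"
    using pos by (simp add: pot_def ln_mult)
  moreover have "\<bar>cur x y\<bar> = ?c * \<bar>v x * f y - f x * v y\<bar>"
    unfolding cur_def abs_mult[of ?c] using c by (simp only: abs_of_pos)
  moreover have "c * (a * M - k * (d * P)) = (c * a) * M - k * ((c * d) * P)" for c a M k d P :: real
    by (simp add: algebra_simps)
  ultimately show ?thesis unfolding traffic_def cur_def by (simp only:)
next
  case False
  have "cur x y = 0"
  proof (cases "w x y = 0")
    case False
    then have wp: "0 < w x y" "0 < w y x" using w_nonneg[of x y] w_sym[of x y] by auto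
    with \<open>\<not> (0 < w x y \<and> 0 < v x \<and> 0 < f x)\<close> consider "v x = 0" | "f x = 0"
      using v_nonneg[of x] f_nonneg[of x] by linarith
    then show ?thesis
    proof cases
      case 1
      then have "v y = 0" using v_pos_step[of x y] wp xy v_nonneg[of y] by force
      then show ?thesis using 1 by (simp add: cur_def)
    next
      case 2
      then have "f y = 0" using f_pos_step[of x y] wp xy f_nonneg[of y] by force
      then show ?thesis using 2 by (simp add: cur_def)
    qed
  qed (simp add: cur_def)
  then show ?thesis using traffic_nonneg by simp
qed

text \<open>The edge inequality summed over all edges inside \<open>A\<close>. The \<open>flow\<close> hypothesis is a lower bound for the number of
  edges of \<open>A\<close> that the flow uses, expressed through a 1-Lipschitz function \<open>D\<close>; the drops of \<open>pot\<close>
  telescope to a boundary term by summation by parts.\<close>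
lemma traffic_lower_bound:
  assumes A: "A \<subseteq> K - Z" and G: "1 < G"
    and D: "\<And>x y. 0 < w x y \<Longrightarrow> \<bar>D x - D y\<bar> \<le> (1::real)"
    and flow: "k \<le> (\<Sum>x\<in>A. D x * (\<Sum>y\<in>A. cur x y))"
  shows "(\<Sum>x\<in>A. \<Sum>y\<in>A. traffic x y) / 2 \<ge> k * ((G + 1) / (G - 1) + 2 * G / (G - 1)\<^sup>2 * ln G)
      - 2 * G / (G - 1)\<^sup>2 * (\<Sum>x\<in>A. pot x * (\<Sum>y\<in>A. cur x y))"
proof -
  define c where "c = (G + 1) / (G - 1) + 2 * G / (G - 1)\<^sup>2 * ln G"
  define kap where "kap = 2 * G / (G - 1)\<^sup>2"
  have c: "0 \<le> c" using G by (simp add: c_def)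
  have "2 * k \<le> 2 * (\<Sum>x\<in>A. D x * (\<Sum>y\<in>A. cur x y))" using flow by simp
  also have "\<dots> = (\<Sum>x\<in>A. \<Sum>y\<in>A. cur x y * (D x - D y))"
    by (rule sum_antisym_weighted[symmetric]) (rule cur_antisym)
  also have "\<dots> \<le> (\<Sum>x\<in>A. \<Sum>y\<in>A. \<bar>cur x y\<bar>)"
  proof (intro sum_mono)
    fix x y
    show "cur x y * (D x - D y) \<le> \<bar>cur x y\<bar>"
    proof (cases "w x y = 0")
      case False
      then have "\<bar>D x - D y\<bar> \<le> 1" using D w_nonneg[of x y] by force
      then have "\<bar>cur x y\<bar> * \<bar>D x - D y\<bar> \<le> \<bar>cur x y\<bar> * 1" by (intro mult_left_mono) auto
      then show ?thesis by (metis abs_le_D1 abs_mult mult.right_neutral)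
    qed (simp add: cur_def)
  qed
  finally have k: "2 * k * c \<le> (\<Sum>x\<in>A. \<Sum>y\<in>A. \<bar>cur x y\<bar>) * c" using c by (rule mult_right_mono)
  have "(\<Sum>x\<in>A. \<Sum>y\<in>A. \<bar>cur x y\<bar> * c - kap * (cur x y * (pot x - pot y)))
      \<le> (\<Sum>x\<in>A. \<Sum>y\<in>A. traffic x y)"
    using A edge_bound[OF _ _ G] by (intro sum_mono) (auto simp: c_def kap_def)
  also have "(\<Sum>x\<in>A. \<Sum>y\<in>A. \<bar>cur x y\<bar> * c - kap * (cur x y * (pot x - pot y)))
     = (\<Sum>x\<in>A. \<Sum>y\<in>A. \<bar>cur x y\<bar>) * c - kap * (\<Sum>x\<in>A. \<Sum>y\<in>A. cur x y * (pot x - pot y))"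
    by (simp add: sum_subtractf sum_distrib_left sum_distrib_right)
  also have "(\<Sum>x\<in>A. \<Sum>y\<in>A. cur x y * (pot x - pot y)) = 2 * (\<Sum>x\<in>A. pot x * (\<Sum>y\<in>A. cur x y))"
    by (rule sum_antisym_weighted) (rule cur_antisym)
  finally show ?thesis using k unfolding c_def[symmetric] unfolding kap_def[symmetric] by (simp add: algebra_simps)
qed

text \<open>Jensen's inequality for the logarithm with the weights \<open>leave\<close>, in tangent form: the mean of \<open>f / v\<close>
  at the exits is at most \<open>lam\<^sup>2\<close> times the weight of the cut over \<open>f u\<close>. One factor \<open>lam\<close> comes
  from the last step and one from \<open>f x \<le> lam\<close>.\<close>
lemma pot_at_exit:
  "- (\<Sum>x\<in>K - Z. pot x * leave x) \<le> f u * ln (lam\<^sup>2 * cut_weight w K Z / f u)"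
proof -
  let ?c = "lam\<^sup>2 * cut_weight w K Z / f u"
  have c: "0 < ?c" using lam cut_weight_pos fu by simp
  have "- (leave x * pot x) \<le> leave x * ln ?c + lam\<^sup>2 * (\<Sum>z\<in>K \<inter> Z. w x z) / ?c - leave x"
    if x: "x \<in> K - Z" for x
  proof (cases "leave x = 0")
    case True
    have "0 \<le> (\<Sum>z\<in>K \<inter> Z. w x z)" using w_nonneg by (simp add: sum_nonneg)
    then have "0 \<le> lam\<^sup>2 * (\<Sum>z\<in>K \<inter> Z. w x z) / ?c" using c by (intro divide_nonneg_pos) auto
    then show ?thesis using True by simp
  next
    case False
    have v: "0 < v x" using leave_pos_imp[OF False] by blast
    have f: "0 < f x" using leave_f_pos[OF False] x by simp
    have "- pot x = ln (f x / v x)" using f v by (simp add: pot_def ln_div)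
    also have "\<dots> \<le> ln ?c + (f x / v x / ?c - 1)" using f v c by (intro ln_le_tangent) auto
    finally have "leave x * (- pot x) \<le> leave x * (ln ?c + (f x / v x / ?c - 1))"
      using leave_nonneg by (rule mult_left_mono)
    also have "\<dots> = leave x * ln ?c + lam * f x * (\<Sum>z\<in>K \<inter> Z. w x z) / ?c - leave x"
      using v by (simp add: leave_def algebra_simps)
    also have "lam * f x * (\<Sum>z\<in>K \<inter> Z. w x z) / ?c \<le> lam\<^sup>2 * (\<Sum>z\<in>K \<inter> Z. w x z) / ?c"
      using c lam f_le[of x] x w_nonneg unfolding power2_eq_square
      by (intro divide_right_mono mult_right_mono mult_left_mono sum_nonneg) auto
    finally show ?thesis by simp
  qed
  then have "(\<Sum>x\<in>K - Z. - (leave x * pot x))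
      \<le> (\<Sum>x\<in>K - Z. leave x * ln ?c + lam\<^sup>2 * (\<Sum>z\<in>K \<inter> Z. w x z) / ?c - leave x)"
    by (intro sum_mono)
  also have "\<dots> = (\<Sum>x\<in>K - Z. leave x) * ln ?c + lam\<^sup>2 * cut_weight w K Z / ?c - (\<Sum>x\<in>K - Z. leave x)"
    by (simp add: sum_subtractf sum.distrib cut_weight_def sum_distrib_left sum_distrib_right sum_divide_distrib)
  also have "\<dots> = f u * ln ?c" using lam cut_weight_pos fu by (simp add: sum_leave)
  finally show ?thesis by (simp add: sum_negf mult.commute)
qed

text \<open>The last edge of the flow accounts for one unit of distance.\<close>
lemma leave_dist_le:
  assumes D: "\<And>x y. 0 < w x y \<Longrightarrow> \<bar>D x - D y\<bar> \<le> (1::real)" and DZ: "\<And>z. z \<in> Z \<Longrightarrow> D z = 0"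
    and A: "A \<subseteq> K - Z"
  shows "(\<Sum>x\<in>A. D x * leave x) \<le> f u"
proof -
  have "D x * leave x \<le> leave x" for x
  proof (cases "leave x = 0")
    case False
    obtain z where "z \<in> K \<inter> Z" "0 < w x z" using leave_pos_imp[OF False] by blast
    then have "D x \<le> 1" using D[of x z] DZ[of z] by auto
    then show ?thesis using mult_right_mono[of "D x" 1 "leave x"] leave_nonneg[of x] by simp
  qed simp
  then have "(\<Sum>x\<in>A. D x * leave x) \<le> (\<Sum>x\<in>A. leave x)" by (intro sum_mono)
  also have "\<dots> \<le> (\<Sum>x\<in>K - Z. leave x)" using A K leave_nonneg by (intro sum_mono2) auto
  finally show ?thesis by (simp add: sum_leave)
qed

text \<open>Here \<open>v u\<close> plays the role of the effective resistance. The whole of \<open>K - Z\<close> is used; the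
  flow starts at distance \<open>n + 1\<close> from \<open>Z\<close>, and its last edge contributes exactly the term 1.
  The hypothesis on \<open>G\<close> says that \<open>n * ln G\<close> is at least the bound on the mean drop of \<open>pot\<close> before the
  last edge that \<open>pot_at_exit\<close> provides.\<close>
theorem total_time_resistance:
  assumes G: "1 < G"
    and D: "\<And>x y. 0 < w x y \<Longrightarrow> \<bar>D x - D y\<bar> \<le> (1::real)" "\<And>z. z \<in> Z \<Longrightarrow> D z = 0" "D u = real n + 1"
    and bd: "lam\<^sup>2 * cut_weight w K Z * v u \<le> (f u)\<^sup>2 * G ^ n"
  shows "f u * (1 + real n * ((G + 1) / (G - 1))) \<le> total_time"
proof -
  define m where "m = (G + 1) / (G - 1)"
  define kap where "kap = 2 * G / (G - 1)\<^sup>2"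
  have kap: "0 < kap" using G by (simp add: kap_def)
  let ?A = "K - Z"
  have div: "(\<Sum>y\<in>?A. cur x y) = (if x = u then f u else 0) - leave x" if "x \<in> ?A" for x
    using div_cur[of x] sum_split_Z[of "cur x"] sum_cur_Z[of x] that by simp
  have weigh: "(\<Sum>x\<in>?A. h x * (\<Sum>y\<in>?A. cur x y)) = h u * f u - (\<Sum>x\<in>?A. h x * leave x)" for h
  proof -
    have "(\<Sum>x\<in>?A. h x * (\<Sum>y\<in>?A. cur x y)) = (\<Sum>x\<in>?A. (if x = u then h u * f u else 0) - h x * leave x)"
      by (intro sum.cong) (auto simp: div right_diff_distrib)
    also have "\<dots> = h u * f u - (\<Sum>x\<in>?A. h x * leave x)"
      using K u by (simp add: sum_subtractf)
    finally show ?thesis .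
  qed
  have "2 * total_time - f u = (\<Sum>x\<in>?A. 2 * (W x * v x * f x) - (if x = u then f u else 0))"
    using K u by (simp add: total_time_def sum_subtractf sum_distrib_left)
  also have "\<dots> = (\<Sum>x\<in>?A. \<Sum>y\<in>K. traffic x y)"
    by (intro sum.cong) (auto simp: sum_traffic)
  also have "\<dots> = (\<Sum>x\<in>?A. \<Sum>y\<in>?A. traffic x y) + f u"
    by (simp add: sum_split_Z[of "traffic _"] sum.distrib sum_traffic_Z sum_leave)
  finally have total: "total_time = f u + (\<Sum>x\<in>?A. \<Sum>y\<in>?A. traffic x y) / 2" by simp
  have "real n * f u \<le> (\<Sum>x\<in>?A. D x * (\<Sum>y\<in>?A. cur x y))"
    unfolding weigh using leave_dist_le[OF D(1,2) order_refl] D(3) by (simp add: algebra_simps)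
  from traffic_lower_bound[OF order_refl G D(1) this]
  have "real n * f u * (m + kap * ln G) - kap * (pot u * f u - (\<Sum>x\<in>?A. pot x * leave x))
      \<le> (\<Sum>x\<in>?A. \<Sum>y\<in>?A. traffic x y) / 2"
    by (simp only: weigh m_def kap_def)
  moreover have "pot u * f u - (\<Sum>x\<in>?A. pot x * leave x) \<le> real n * f u * ln G"
  proof -
    have "pot u * f u - (\<Sum>x\<in>?A. pot x * leave x) \<le> f u * (pot u + ln (lam\<^sup>2 * cut_weight w K Z / f u))"
      using pot_at_exit by (simp add: algebra_simps)
    also have "pot u + ln (lam\<^sup>2 * cut_weight w K Z / f u) = ln (lam\<^sup>2 * cut_weight w K Z * v u / (f u)\<^sup>2)"
      using v_u fu lam cut_weight_pos by (simp add: pot_def ln_div ln_mult ln_realpow)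
    also have "\<dots> \<le> ln (G ^ n)"
      using bd v_u fu lam cut_weight_pos by (intro ln_mono) (auto simp: pos_divide_le_eq mult.commute)
    also have "\<dots> = real n * ln G" using G by (simp add: ln_realpow)
    finally show ?thesis using fu by (simp add: mult_ac)
  qed
  then have "kap * (pot u * f u - (\<Sum>x\<in>?A. pot x * leave x)) \<le> kap * (real n * f u * ln G)"
    using kap by (intro mult_left_mono) auto
  ultimately have "real n * f u * m \<le> (\<Sum>x\<in>?A. \<Sum>y\<in>?A. traffic x y) / 2"
    by (simp add: algebra_simps)
  then show ?thesis unfolding total m_def[symmetric] by (simp add: algebra_simps)
qed

text \<open>The mean potential after the first step of the flow. The neighbour \<open>x\<close> of \<open>u\<close> receives flow in proportion to
  \<open>lam * w u x * f x\<close> times the potential difference between \<open>u\<close> and \<open>x\<close>, and \<open>v\<close> at the neighbours is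
  tied to \<open>v u\<close> by the equation at \<open>u\<close>; so \<open>ln_chebyshev_tangent\<close> applies. Without loops at \<open>u\<close> the bound
  is attained if the potential is constant on the neighbours.\<close>
lemma pot_near_source:
  assumes sep: "\<And>z. z \<in> Z \<Longrightarrow> w u z = 0"
  shows "1 < W u * v u"
    and "(\<Sum>x\<in>K - Z - {u}. cur u x * pot x) \<le> f u * ln ((W u * v u - 1) / (W u * f u))"
proof -
  let ?A = "K - Z - {u}"
  \<comment> \<open>The weight that remains if the loop at \<open>u\<close> is removed; passing to \<open>W' \<le> W u\<close> at the end
    only weakens the bound.\<close>
  define W' where "W' = W u - lam * w u u"
  have restrict: "(\<Sum>y\<in>K. w u y * h y) = w u u * h u + (\<Sum>y\<in>?A. w u y * h y)" for h
  proof -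
    have "(\<Sum>y\<in>K. w u y * h y) = (\<Sum>y\<in>K - Z. w u y * h y)"
      using sep by (simp add: sum_split_Z)
    then show ?thesis using K u by (simp add: sum.remove[of "K - Z" u])
  qed
  have f': "W' * f u = lam * (\<Sum>y\<in>?A. w u y * f y)"
    using f_eq[OF u(2)] unfolding restrict[of f] by (simp add: W'_def algebra_simps)
  have v': "W' * v u = 1 + lam * (\<Sum>y\<in>?A. w u y * v y)"
    using v_eq[OF u(2)] unfolding restrict[of v] by (simp add: W'_def algebra_simps)
  have "0 \<le> lam * (\<Sum>y\<in>?A. w u y * v y)"
    using lam w_nonneg v_nonneg by (simp add: sum_nonneg)
  then have "0 < W' * v u" using v' by linarith
  then have W': "0 < W'" using v_u by (simp add: zero_less_mult_iff)
  have W'_le: "W' \<le> W u" using lam w_nonneg[of u u] by (simp add: W'_def)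
  have "(\<Sum>y\<in>?A. w u y * f y) \<noteq> 0" using f' W' fu lam by auto
  then obtain y where y: "y \<in> ?A" "w u y * f y \<noteq> 0" by (meson sum.neutral)
  then have wy: "0 < w u y" using w_nonneg[of u y] by (cases "w u y = 0") auto
  have vy: "0 < v y" using v_pos_step[of y u] y u wy v_u w_sym[of y u] by auto
  have "w u y * v y \<le> (\<Sum>y\<in>?A. w u y * v y)"
    using y K w_nonneg v_nonneg by (intro member_le_sum) auto
  then have "0 < (\<Sum>y\<in>?A. w u y * v y)" using mult_pos_pos[OF wy vy] by linarith
  then have gt: "1 < W' * v u" using v' lam by simp
  also have "W' * v u \<le> W u * v u" using W'_le v_u by (intro mult_right_mono) auto
  finally show R: "1 < W u * v u" .
  define c where "c = (W' * v u - 1) / (W' * f u)"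
  define d where "d = 1 / (W' * f u)"
  have c: "0 < c" and d: "0 < d" using gt W' fu by (auto simp: c_def d_def)
  have cd: "c + d = v u / f u" using W' fu by (simp add: c_def d_def add_divide_distrib[symmetric])
  have cW: "c * (W' * f u) = W' * v u - 1" using W' fu by (simp add: c_def)
  have "cur u x * pot x \<le> cur u x * ln c + (lam * w u x * v x - c * (lam * w u x * f x)) / (W' * c)"
    if x: "x \<in> ?A" for x
  proof (cases "w u x = 0")
    case False
    then have wx: "0 < w u x" "0 < w x u" using w_nonneg[of u x] w_sym[of u x] by auto
    have vx: "0 < v x" using v_pos_step[of x u] x u wx v_u by auto
    have fx: "0 < f x" using f_pos_step[of x u] x u wx fu by auto
    have "lam * w u x * f u * f x * ((c + d - v x / f x) * (ln (v x / f x) - ln c))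
        \<le> lam * w u x * f u * f x * (d * (v x / f x - c) / c)"
      using vx fx c d lam wx fu by (intro mult_left_mono ln_chebyshev_tangent) auto
    moreover have "lam * w u x * f u * f x * (c + d - v x / f x) = cur u x"
      unfolding cd using fu fx by (simp add: cur_def field_simps)
    moreover have "ln (v x / f x) = pot x" using vx fx by (simp add: pot_def ln_div)
    moreover have "lam * w u x * f u * f x * (d * (v x / f x - c) / c)
        = (lam * w u x * v x - c * (lam * w u x * f x)) / (W' * c)"
      using fu fx c W' by (simp add: d_def field_simps)
    ultimately have "cur u x * (pot x - ln c) \<le> (lam * w u x * v x - c * (lam * w u x * f x)) / (W' * c)"
      by (metis mult.assoc)
    then show ?thesis by (simp add: right_diff_distrib)
  qed (simp add: cur_def)
  then have "(\<Sum>x\<in>?A. cur u x * pot x)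
      \<le> (\<Sum>x\<in>?A. cur u x * ln c + (lam * w u x * v x - c * (lam * w u x * f x)) / (W' * c))"
    by (intro sum_mono)
  also have "\<dots> = (\<Sum>x\<in>?A. cur u x) * ln c
      + (lam * (\<Sum>x\<in>?A. w u x * v x) - c * (lam * (\<Sum>x\<in>?A. w u x * f x))) / (W' * c)"
    by (simp add: sum.distrib sum_distrib_right sum_distrib_left sum_subtractf mult.assoc flip: sum_divide_distrib)
  also have "lam * (\<Sum>x\<in>?A. w u x * v x) - c * (lam * (\<Sum>x\<in>?A. w u x * f x)) = 0"
  proof -
    have "lam * (\<Sum>x\<in>?A. w u x * v x) = W' * v u - 1" using v' by linarith
    then show ?thesis by (simp only: f'[symmetric] cW)
  qed
  also have "(\<Sum>x\<in>?A. cur u x) = (\<Sum>x\<in>K - Z. cur u x)"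
    using K u by (simp add: sum.remove[of "K - Z" u] cur_def)
  also have "\<dots> = (\<Sum>x\<in>K. cur u x)"
    using sep by (simp add: sum_split_Z cur_def)
  also have "\<dots> = f u" using div_cur[OF u(2)] by simp
  also have "f u * ln c + 0 / (W' * c) \<le> f u * ln ((W u * v u - 1) / (W u * f u))"
  proof -
    have "c = v u / f u - 1 / (W' * f u)" using W' fu by (simp add: c_def diff_divide_distrib)
    also have "\<dots> \<le> v u / f u - 1 / (W u * f u)"
      using W' W'_le fu W_pos[of u] by (intro diff_left_mono divide_left_mono mult_right_mono) auto
    also have "\<dots> = (W u * v u - 1) / (W u * f u)"
      using W_pos[of u] fu by (simp add: diff_divide_distrib)
    finally show ?thesis using c fu by (simp add: ln_mono)
  qed
  finally show "(\<Sum>x\<in>?A. cur u x * pot x) \<le> f u * ln ((W u * v u - 1) / (W u * f u))" .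
qed

text \<open>The resistance is eliminated. The expected number of visits to \<open>u\<close> is \<open>R = W u * v u\<close>. They cost time
  \<open>R\<close>, and the remaining \<open>n - 1\<close> edges before the last one lie in \<open>?A\<close>, where the potential starts at the value
  proportional to \<open>R - 1\<close> from \<open>pot_near_source\<close>. A large \<open>R\<close> increases the first cost and decreases the second one by a
  multiple of \<open>ln (R - 1)\<close>; the worst case is \<open>R - 1 = kap\<close>.\<close>
theorem total_time_volume:
  assumes G: "1 < G" and n: "1 \<le> n" and sep: "\<And>z. z \<in> Z \<Longrightarrow> w u z = 0"
    and D: "\<And>x y. 0 < w x y \<Longrightarrow> \<bar>D x - D y\<bar> \<le> (1::real)" "\<And>z. z \<in> Z \<Longrightarrow> D z = 0"
      "\<And>x. 0 < w u x \<Longrightarrow> D x = real n"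
    and bd: "2 * lam\<^sup>2 * cut_weight w K Z * G \<le> (f u)\<^sup>2 * W u * (G - 1)\<^sup>2 * G ^ (n - 1)"
  shows "f u * (1 + real n * ((G + 1) / (G - 1))) \<le> total_time"
proof -
  define m where "m = (G + 1) / (G - 1)"
  define kap where "kap = 2 * G / (G - 1)\<^sup>2"
  define R where "R = W u * v u"
  have kap: "0 < kap" using G by (simp add: kap_def)
  have R: "1 < R" using pot_near_source(1)[OF sep] by (simp add: R_def)
  let ?A = "K - Z - {u}"
  have A: "?A \<subseteq> K - Z" by auto
  have leave_u: "leave u = 0" using sep by (simp add: leave_def)
  have sum_K: "(\<Sum>y\<in>K. h y) = (\<Sum>y\<in>?A. h y) + h u + (\<Sum>y\<in>K \<inter> Z. h y)" for h :: "'v \<Rightarrow> real"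
    using K u by (simp add: sum_split_Z sum.remove[of "K - Z" u])
  have sum_A: "(\<Sum>y\<in>K - Z. h y * leave y) = (\<Sum>y\<in>?A. h y * leave y)" for h :: "'v \<Rightarrow> real"
    using K u leave_u by (simp add: sum.remove[of "K - Z" u])
  have div: "(\<Sum>y\<in>?A. cur x y) = cur u x - leave x" if "x \<in> ?A" for x
    using div_cur[of x] sum_K[of "cur x"] sum_cur_Z[of x] cur_antisym[of u x] that by simp
  have weigh: "(\<Sum>x\<in>?A. h x * (\<Sum>y\<in>?A. cur x y)) = (\<Sum>x\<in>?A. h x * cur u x) - (\<Sum>x\<in>?A. h x * leave x)" for h
    unfolding sum_subtractf[symmetric]
    by (intro sum.cong) (auto simp: div right_diff_distrib)
  have cur_u: "(\<Sum>x\<in>?A. cur u x) = f u"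
    using div_cur[OF u(2)] sum_K[of "cur u"] sum_cur_Z[of u] leave_u by (simp add: cur_def)
  have "2 * (\<Sum>x\<in>?A. W x * v x * f x) = (\<Sum>x\<in>?A. \<Sum>y\<in>K. traffic x y)"
    unfolding sum_distrib_left by (intro sum.cong refl) (auto simp: sum_traffic)
  also have "\<dots> = (\<Sum>x\<in>?A. \<Sum>y\<in>?A. traffic x y) + (\<Sum>x\<in>?A. traffic x u) + (\<Sum>x\<in>?A. leave x)"
    by (simp add: sum_K[of "traffic _"] sum.distrib sum_traffic_Z)
  also have "(\<Sum>x\<in>?A. leave x) = f u" using sum_leave sum_A[of "\<lambda>_. 1"] by simp
  finally have half: "2 * (\<Sum>x\<in>?A. W x * v x * f x)
      = (\<Sum>x\<in>?A. \<Sum>y\<in>?A. traffic x y) + (\<Sum>x\<in>?A. traffic x u) + f u" .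
  have "f u \<le> (\<Sum>x\<in>?A. traffic x u)"
    unfolding cur_u[symmetric]
    using abs_cur_le_traffic[of _ u] cur_antisym[of u] by (intro sum_mono) (metis abs_le_D1 abs_minus_cancel)
  moreover have "total_time = R * f u + (\<Sum>x\<in>?A. W x * v x * f x)"
    using K u by (simp add: total_time_def R_def sum.remove[of "K - Z" u])
  ultimately have total: "R * f u + f u + (\<Sum>x\<in>?A. \<Sum>y\<in>?A. traffic x y) / 2 \<le> total_time"
    using half by linarith
  have "(\<Sum>x\<in>?A. D x * cur u x) = (\<Sum>x\<in>?A. real n * cur u x)"
  proof (intro sum.cong refl)
    fix x show "D x * cur u x = real n * cur u x"
      using D(3)[of x] w_nonneg[of u x] by (cases "w u x = 0") (auto simp: cur_def)
  qed
  also have "\<dots> = real n * f u" by (simp add: cur_u sum_distrib_left[symmetric])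
  finally have "(real n - 1) * f u \<le> (\<Sum>x\<in>?A. D x * (\<Sum>y\<in>?A. cur x y))"
    unfolding weigh using leave_dist_le[OF D(1,2) A] by (simp add: algebra_simps)
  from traffic_lower_bound[OF A G D(1) this]
  have low: "(real n - 1) * f u * (m + kap * ln G) - kap * ((\<Sum>x\<in>?A. pot x * cur u x) - (\<Sum>x\<in>?A. pot x * leave x))
      \<le> (\<Sum>x\<in>?A. \<Sum>y\<in>?A. traffic x y) / 2"
    by (simp only: weigh m_def kap_def)
  have "(\<Sum>x\<in>?A. pot x * cur u x) - (\<Sum>x\<in>?A. pot x * leave x)
      \<le> f u * (ln ((R - 1) / (W u * f u)) + ln (lam\<^sup>2 * cut_weight w K Z / f u))"
    using pot_near_source(2)[OF sep] pot_at_exit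
    unfolding sum_A R_def by (simp add: algebra_simps)
  also have "ln ((R - 1) / (W u * f u)) + ln (lam\<^sup>2 * cut_weight w K Z / f u)
      = ln ((R - 1) * (lam\<^sup>2 * cut_weight w K Z / (W u * (f u)\<^sup>2)))"
    using R W_pos[of u] fu lam cut_weight_pos by (simp add: ln_div ln_mult ln_realpow)
  also have "\<dots> \<le> ln ((R - 1) * (G ^ (n - 1) / kap))"
  proof (intro ln_mono mult_left_mono mult_pos_pos)
    have "lam\<^sup>2 * cut_weight w K Z * (2 * G) \<le> W u * (f u)\<^sup>2 * ((G - 1)\<^sup>2 * G ^ (n - 1))"
      using bd by (simp add: mult_ac)
    then show "lam\<^sup>2 * cut_weight w K Z / (W u * (f u)\<^sup>2) \<le> G ^ (n - 1) / kap"
      using W_pos[of u] fu G by (simp add: kap_def divide_simps mult_ac)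
  qed (use R W_pos[of u] fu lam cut_weight_pos in auto)
  also have "\<dots> = (real n - 1) * ln G + ln ((R - 1) / kap)"
    using R G kap n by (simp add: ln_div ln_mult ln_realpow of_nat_diff)
  \<comment> \<open>The optimisation over \<open>R\<close>, as the tangent of the logarithm at its worst case.\<close>
  also have "ln ((R - 1) / kap) \<le> (R - 1) / kap - 1"
    using R kap by (intro ln_le_minus_one) auto
  finally have "(\<Sum>x\<in>?A. pot x * cur u x) - (\<Sum>x\<in>?A. pot x * leave x)
      \<le> f u * ((real n - 1) * ln G + ((R - 1) / kap - 1))" using fu by simp
  then have "kap * ((\<Sum>x\<in>?A. pot x * cur u x) - (\<Sum>x\<in>?A. pot x * leave x))
      \<le> kap * (f u * ((real n - 1) * ln G + ((R - 1) / kap - 1)))" using kap by simp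
  also have "\<dots> = f u * ((real n - 1) * (kap * ln G) + (R - 1 - kap))"
    using kap by (simp add: field_simps)
  finally have "f u * (real n * m - m + R * 0 - (R - 1 - kap)) \<le> (\<Sum>x\<in>?A. \<Sum>y\<in>?A. traffic x y) / 2"
    using low by (simp add: algebra_simps)
  then have "f u * (1 + real n * m + (1 + kap - m)) \<le> total_time"
    using total by (simp add: algebra_simps)
  moreover have "0 \<le> 1 + kap - m"
  proof -
    have "m = 1 + 2 * (G - 1) / (G - 1)\<^sup>2" using G by (simp add: m_def divide_simps power2_eq_square) (simp add: algebra_simps)
    also have "\<dots> \<le> 1 + kap" unfolding kap_def by (intro add_left_mono divide_right_mono) auto
    finally show ?thesis by simp
  qed
  then have "f u * (1 + real n * m) \<le> f u * (1 + real n * m + (1 + kap - m))"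
    using fu by (intro mult_left_mono) auto
  ultimately show ?thesis by (simp add: m_def)
qed

end

section \<open>From the differential inequality to the generating function\<close>

lemma discount_range:
  fixes g Phi :: real
  assumes "1 < g" "0 < Phi" "Phi < 1"
  shows "0 < Phi * (g + 1) / (g + Phi\<^sup>2)" "Phi * (g + 1) / (g + Phi\<^sup>2) < 1"
proof -
  have pos: "0 < g + Phi\<^sup>2" using assms by (simp add: add_pos_nonneg)
  then show "0 < Phi * (g + 1) / (g + Phi\<^sup>2)" using assms by simp
  have "0 < (1 - Phi) * (g - Phi)" using assms by simp
  then have "Phi * (g + 1) < g + Phi\<^sup>2" by (simp add: algebra_simps power2_eq_square)
  then show "Phi * (g + 1) / (g + Phi\<^sup>2) < 1" using pos by simp
qed

text \<open>The map \<open>x \<mapsto> x * (g + 1) / (g + x\<^sup>2)\<close> increases on \<open>[0, 1]\<close>.\<close>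
lemma root_comparison:
  fixes F Phi g l :: real
  assumes "1 < g" "0 < F" "F \<le> 1" "0 < Phi" "Phi < 1"
    and "l = Phi * (g + 1) / (g + Phi\<^sup>2)" "F * (g + 1) / (g + F\<^sup>2) \<le> l"
  shows "F \<le> Phi"
proof (rule ccontr)
  assume "\<not> F \<le> Phi"
  have pos: "0 < g + F\<^sup>2" "0 < g + Phi\<^sup>2" using assms by (auto intro: add_pos_nonneg)
  have "F * (g + 1) / (g + F\<^sup>2) \<le> Phi * (g + 1) / (g + Phi\<^sup>2)" using assms(6,7) by simp
  then have "F * (g + 1) * (g + Phi\<^sup>2) \<le> Phi * (g + 1) * (g + F\<^sup>2)"
    using pos by (simp add: divide_simps)
  then have "(g + 1) * (F * (g + Phi\<^sup>2)) \<le> (g + 1) * (Phi * (g + F\<^sup>2))" by (simp add: mult_ac)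
  then have "F * (g + Phi\<^sup>2) \<le> Phi * (g + F\<^sup>2)" using assms by simp
  then have "(F - Phi) * (g - F * Phi) \<le> 0" by (simp add: algebra_simps power2_eq_square)
  moreover have "F * Phi < g"
    using mult_mono[of F 1 Phi 1] assms by auto
  ultimately show False using \<open>\<not> F \<le> Phi\<close> by (simp add: mult_le_0_iff)
qed

text \<open>The comparison of \<open>F = (a l / l) powr (1 / n)\<close> with the generating function \<open>Phi\<close> of the biased hitting
  time. The number \<open>E\<close> in the growth condition is \<open>F\<^sup>2\<close>. In terms of \<open>y = ln F\<close> the condition says
  that \<open>P l = ln (F * (g + 1) / (g + F\<^sup>2)) - ln l\<close> is nondecreasing. As \<open>F \<le> 1\<close>, the upper limit of \<open>P\<close> at \<open>l = 1\<close> is at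
  most 0, so \<open>P \<le> 0\<close> throughout, and \<open>root_comparison\<close> applies.\<close>
lemma growth_comparison:
  fixes a a' :: "real \<Rightarrow> real" and n :: nat
  assumes g: "1 < g" and n: "1 \<le> n"
    and der: "\<And>l. 0 < l \<Longrightarrow> l < 1 \<Longrightarrow> (a has_field_derivative a' l) (at l)"
    and pos: "\<And>l. 0 < l \<Longrightarrow> l < 1 \<Longrightarrow> 0 < a l" and le: "\<And>l. 0 < l \<Longrightarrow> l < 1 \<Longrightarrow> a l \<le> l"
    and grow: "\<And>l E. 0 < l \<Longrightarrow> l < 1 \<Longrightarrow> 0 < E \<Longrightarrow> E \<le> 1 \<Longrightarrow> E ^ n = (a l / l)\<^sup>2 \<Longrightarrow>
      a l * (1 + real n * ((g + E) / (g - E))) \<le> l * a' l"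
    and Phi: "0 < Phi" "Phi < 1" and l: "l = Phi * (g + 1) / (g + Phi\<^sup>2)"
  shows "a l \<le> l * Phi ^ n"
proof -
  define y where "y l = ln (a l / l) / real n" for l
  define P where "P l = y l + ln (g + 1) - ln (g + exp (2 * y l)) - ln l" for l
  have y_le: "y l \<le> 0" if "0 < l" "l < 1" for l
    using pos[OF that] le[OF that] that by (simp add: y_def divide_nonpos_nonneg)
  have y_pow: "exp (y l) ^ n = a l / l" if "0 < l" "l < 1" for l
    using pos[OF that] that n by (simp add: y_def exp_of_nat_mult[symmetric])
  have P_deriv: "\<exists>d. (P has_field_derivative d) (at l) \<and> 0 \<le> d" if l01: "0 < l" "l < 1" for l
  proof -
    define E where "E = exp (2 * y l)"
    have E: "0 < E" "E \<le> 1" using y_le[OF l01] by (auto simp: E_def)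
    define y' where "y' = (a' l / a l - 1 / l) / real n"
    have gE: "0 < g + E" "0 < g - E" using g E by auto
    have "E ^ n = (exp (y l) ^ n)\<^sup>2"
      by (simp add: E_def power2_eq_square exp_add[symmetric] power_mult_distrib[symmetric])
    also have "\<dots> = (a l / l)\<^sup>2" by (simp add: y_pow[OF l01])
    finally have "a l * (1 + real n * ((g + E) / (g - E))) \<le> l * a' l" by (rule grow[OF l01 E])
    then have "(1 + real n * ((g + E) / (g - E))) \<le> l * a' l / a l"
      using pos[OF l01] by (simp add: pos_le_divide_eq mult.commute)
    also have "\<dots> = l * (real n * y' + 1 / l)" using n by (simp add: y'_def)
    also have "\<dots> = l * (real n * y') + 1" using l01 by (simp add: distrib_left)
    finally have "real n * ((g + E) / (g - E)) \<le> real n * (l * y')" by (simp add: mult_ac)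
    then have "(g + E) / (g - E) \<le> l * y'"
      using n by (subst (asm) mult_le_cancel_left_pos) auto
    then have "1 \<le> l * y' * ((g - E) / (g + E))"
      using gE by (simp add: pos_divide_le_eq pos_le_divide_eq mult_ac)
    then have *: "1 / l \<le> y' * ((g - E) / (g + E))"
      using l01 by (simp add: pos_divide_le_eq mult_ac)
    have dy: "(y has_field_derivative y') (at l)"
      unfolding y_def[abs_def] y'_def
      by (rule derivative_eq_intros der l01 refl | use pos[OF l01] l01 n in \<open>simp add: field_simps\<close>)+
    have "(P has_field_derivative (y' - (exp (2 * y l) * (2 * y')) / (g + exp (2 * y l)) - 1 / l)) (at l)"
      unfolding P_def[abs_def]
      by (rule derivative_eq_intros dy refl | use gE l01 in \<open>simp add: E_def field_simps\<close>)+
    moreover have "y' - (E * (2 * y')) / (g + E) = y' * ((g - E) / (g + E))"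
      using gE by (simp add: field_simps)
    ultimately show ?thesis using * unfolding E_def[symmetric] by (intro exI conjI) auto
  qed
  have P_le: "P l' \<le> - ln l'" if "0 < l'" "l' < 1" for l'
  proof -
    define F where "F = exp (y l')"
    have F: "0 < F" "F \<le> 1" using y_le[OF that] by (auto simp: F_def)
    have "0 \<le> (1 - F) * (g - F)" using F g by simp
    then have "F * (g + 1) \<le> g + F\<^sup>2" by (simp add: algebra_simps power2_eq_square)
    then have "ln (F * (g + 1)) \<le> ln (g + F\<^sup>2)" using F g by (intro ln_mono) auto
    moreover have "F\<^sup>2 = exp (2 * y l')" by (simp add: F_def power2_eq_square exp_add[symmetric])
    moreover have "ln (F * (g + 1)) = y l' + ln (g + 1)" using g by (simp add: F_def ln_mult)
    ultimately show ?thesis by (simp add: P_def)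
  qed
  have l0: "0 < l" and l1: "l < 1" using discount_range[OF g Phi] by (simp_all add: l)
  \<comment> \<open>Compare with a point \<open>l'\<close> so close to 1 that \<open>- ln l' \<le> e\<close>.\<close>
  have "P l \<le> 0 + e" if e: "0 < e" for e
  proof -
    define l' where "l' = max ((1 + l) / 2) (exp (- e))"
    have l': "0 < l'" "l < l'" "l' < 1" "exp (- e) \<le> l'"
      using l0 l1 e by (auto simp: l'_def max_def)
    have "P l \<le> P l'"
      using l' l0 P_deriv by (intro DERIV_nonneg_imp_nondecreasing[of l l' P]) (auto intro: order_less_le_trans)
    also have "\<dots> \<le> - ln l'" using l' by (intro P_le) auto
    also have "\<dots> \<le> e" using l' by (simp add: ln_ge_iff minus_le_iff)
    finally show ?thesis by simp
  qed
  then have P0: "P l \<le> 0" by (rule field_le_epsilon)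
  define F where "F = exp (y l)"
  have F: "0 < F" "F \<le> 1" using y_le[OF l0 l1] by (auto simp: F_def)
  have "F * (g + 1) / (g + F\<^sup>2) \<le> l"
  proof -
    have F2: "F\<^sup>2 = exp (2 * y l)" by (simp add: F_def power2_eq_square exp_add[symmetric])
    have "0 < g + F\<^sup>2" using g by (simp add: add_pos_nonneg)
    then have "ln (F * (g + 1) / (g + F\<^sup>2)) = P l + ln l"
      using g F unfolding F2 by (simp add: P_def ln_div ln_mult F_def)
    also have "\<dots> \<le> ln l" using P0 by simp
    finally show ?thesis
      using l0 F g \<open>0 < g + F\<^sup>2\<close> by (subst (asm) ln_le_cancel_iff) auto
  qed
  then have "F \<le> Phi" using root_comparison[OF g F Phi l] by simp
  then have "F ^ n \<le> Phi ^ n" using F by (intro power_mono) auto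
  then have "l * F ^ n \<le> l * Phi ^ n" using l0 by simp
  then show ?thesis using y_pow[OF l0 l1] l0 by (simp add: F_def)
qed

section \<open>The walk killed outside a finite set\<close>

context weighted_graph
begin

definition jump where "jump x y = w x y / vertex_weight w x"

lemma jump_nonneg: "0 \<le> jump x y"
  using weight_nonneg[of x y] vertex_weight_pos[of x] by (simp add: jump_def)

lemma sum_weight_le: "finite K \<Longrightarrow> (\<Sum>y\<in>K. w x y) \<le> vertex_weight w x"
  unfolding vertex_weight_def
  by (rule finite_sum_le_infsum) (auto simp: weight_nonneg weight_summable)

lemma sum_jump_le: "finite K \<Longrightarrow> (\<Sum>y\<in>K. jump x y) \<le> 1"
  using sum_weight_le[of K x] vertex_weight_pos[of x]
  by (simp add: jump_def sum_divide_distrib[symmetric])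

lemma weight_jump: "vertex_weight w x * (\<Sum>y\<in>K. jump x y * h y) = (\<Sum>y\<in>K. w x y * h y)"
  using vertex_weight_pos[of x] by (simp add: jump_def sum_distrib_left)

text \<open>The expectation of \<open>s\<close> at the position of the walk after \<open>t\<close> steps from \<open>x\<close>, over those paths that take all their steps
  into \<open>K\<close> and avoid \<open>Z\<close> before time \<open>t\<close>. One recursion thus yields hitting probabilities
  (\<open>s\<close> the indicator of \<open>Z\<close>), the Green function (\<open>s\<close> concentrated at \<open>u\<close>) and the probability of staying in \<open>K\<close>
  (\<open>Z\<close> empty).\<close>
primrec killed :: "'v set \<Rightarrow> 'v set \<Rightarrow> ('v \<Rightarrow> real) \<Rightarrow> nat \<Rightarrow> 'v \<Rightarrow> real" where
  "killed K Z s 0 x = s x"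
| "killed K Z s (Suc t) x = (if x \<in> Z then 0 else \<Sum>y\<in>K. jump x y * killed K Z s t y)"

lemma killed_nonneg: "(\<And>x. 0 \<le> s x) \<Longrightarrow> 0 \<le> killed K Z s t x"
  by (induction t arbitrary: x) (auto intro!: sum_nonneg mult_nonneg_nonneg jump_nonneg)

lemma killed_le:
  assumes "finite K" "\<And>x. s x \<le> C" "0 \<le> C"
  shows "killed K Z s t x \<le> C"
proof (induction t arbitrary: x)
  case (Suc t)
  have "(\<Sum>y\<in>K. jump x y * killed K Z s t y) \<le> (\<Sum>y\<in>K. jump x y * C)"
    using Suc jump_nonneg by (intro sum_mono mult_left_mono) auto
  also have "\<dots> \<le> 1 * C"
    unfolding sum_distrib_right[symmetric] using assms sum_jump_le by (intro mult_right_mono) auto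
  finally show ?case using assms by simp
qed (use assms in auto)

lemma killed_mono:
  assumes "finite L" "K \<subseteq> L" "\<And>x. 0 \<le> s x"
  shows "killed K Z s t x \<le> killed L Z s t x"
proof (induction t arbitrary: x)
  case (Suc t)
  have "(\<Sum>y\<in>K. jump x y * killed K Z s t y) \<le> (\<Sum>y\<in>K. jump x y * killed L Z s t y)"
    using Suc jump_nonneg by (intro sum_mono mult_left_mono) auto
  also have "\<dots> \<le> (\<Sum>y\<in>L. jump x y * killed L Z s t y)"
    using assms by (intro sum_mono2) (auto intro!: mult_nonneg_nonneg jump_nonneg killed_nonneg)
  finally show ?case by simp
qed simp

text \<open>The generating function over \<open>t\<close> and its derivative with respect to \<open>l\<close>.\<close>
definition gf where "gf K Z s l x = (\<Sum>t. killed K Z s t x * l ^ t)"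
definition gf' where "gf' K Z s l x = (\<Sum>t. diffs (\<lambda>t. killed K Z s t x) t * l ^ t)"

end

locale bounded_source = weighted_graph w for w :: "'v \<Rightarrow> 'v \<Rightarrow> real" +
  fixes K Z :: "'v set" and s :: "'v \<Rightarrow> real" and C :: real
  assumes K: "finite K" and s: "\<And>x. 0 \<le> s x" "\<And>x. s x \<le> C"
begin

lemma C_nonneg: "0 \<le> C" using s[of undefined] by linarith

lemma summable_gf:
  assumes "\<bar>l\<bar> < 1"
  shows "summable (\<lambda>t. killed K Z s t x * l ^ t)"
proof (rule summable_comparison_test'[of "\<lambda>t. C * \<bar>l\<bar> ^ t" 0])
  show "summable (\<lambda>t. C * \<bar>l\<bar> ^ t)" using assms by (intro summable_mult summable_geometric) auto
  show "norm (killed K Z s t x * l ^ t) \<le> C * \<bar>l\<bar> ^ t" for t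
    using killed_nonneg[of s K Z t x] killed_le[OF K, of s C Z t x] s C_nonneg
    by (simp add: abs_mult power_abs mult_right_mono)
qed

text \<open>First-step decomposition.\<close>
lemma gf_eq:
  assumes "\<bar>l\<bar> < 1"
  shows "gf K Z s l x = s x + (if x \<in> Z then 0 else l * (\<Sum>y\<in>K. jump x y * gf K Z s l y))"
proof -
  have sums: "(\<lambda>t. killed K Z s t y * l ^ t) sums gf K Z s l y" for y
    unfolding gf_def using summable_gf[OF assms] by (rule summable_sums)
  have "(\<lambda>t. killed K Z s (Suc t) x * l ^ Suc t) sums (if x \<in> Z then 0 else l * (\<Sum>y\<in>K. jump x y * gf K Z s l y))"
  proof (cases "x \<in> Z")
    case False
    have "(\<lambda>t. l * (\<Sum>y\<in>K. jump x y * (killed K Z s t y * l ^ t))) sums (l * (\<Sum>y\<in>K. jump x y * gf K Z s l y))"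
      by (intro sums_mult sums_sum sums)
    moreover have "(\<lambda>t. l * (\<Sum>y\<in>K. jump x y * (killed K Z s t y * l ^ t))) = (\<lambda>t. killed K Z s (Suc t) x * l ^ Suc t)"
      using False by (auto simp: sum_distrib_left sum_distrib_right mult_ac)
    ultimately show ?thesis using False by simp
  qed simp
  from sums_Suc[OF this] show ?thesis using sums_unique2[OF sums[of x]] by (simp add: add.commute)
qed

lemma gf_nonneg: "0 \<le> l \<Longrightarrow> l < 1 \<Longrightarrow> 0 \<le> gf K Z s l x"
  unfolding gf_def using summable_gf[of l x] killed_nonneg[OF s(1)] by (intro suminf_nonneg) auto

lemma gf_has_derivative:
  assumes "\<bar>l\<bar> < 1"
  shows "((\<lambda>l. gf K Z s l x) has_field_derivative gf' K Z s l x) (at l)"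
proof -
  have "\<bar>l\<bar> < (1 + \<bar>l\<bar>) / 2" "(1 + \<bar>l\<bar>) / 2 < 1" using assms by auto
  then show ?thesis
    unfolding gf_def gf'_def
    by (intro termdiffs_strong[where K = "(1 + \<bar>l\<bar>) / 2"] summable_gf) auto
qed

lemma gf'_eq:
  assumes "\<bar>l\<bar> < 1"
  shows "gf' K Z s l x =
    (if x \<in> Z then 0 else (\<Sum>y\<in>K. jump x y * gf K Z s l y) + l * (\<Sum>y\<in>K. jump x y * gf' K Z s l y))"
    (is "_ = ?d")
proof -
  have "((\<lambda>l. s x + (if x \<in> Z then 0 else l * (\<Sum>y\<in>K. jump x y * gf K Z s l y))) has_field_derivative ?d) (at l)"
    by (cases "x \<in> Z") (auto intro!: derivative_eq_intros gf_has_derivative assms simp: mult_ac sum_distrib_left sum.distrib)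
  moreover have "eventually (\<lambda>l. \<bar>l\<bar> < 1) (nhds l)"
  proof -
    have "open {l::real. \<bar>l\<bar> < 1}" by (intro open_Collect_less continuous_intros)
    then show ?thesis using assms eventually_nhds_in_open by fastforce
  qed
  then have "eventually (\<lambda>l. s x + (if x \<in> Z then 0 else l * (\<Sum>y\<in>K. jump x y * gf K Z s l y)) = gf K Z s l x) (nhds l)"
    by (rule eventually_mono) (use gf_eq in simp)
  ultimately have "((\<lambda>l. gf K Z s l x) has_field_derivative ?d) (at l)"
    by (subst (asm) DERIV_cong_ev[OF refl _ refl])
  then show ?thesis using gf_has_derivative[OF assms, of x] DERIV_unique by blast
qed

end

section \<open>Distance to the target\<close>

text \<open>Truncation makes the distance finite, so that it can be weighed against a flow, and keeps it
  1-Lipschitz.\<close>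
definition truncated_dist :: "('v \<Rightarrow> 'v \<Rightarrow> real) \<Rightarrow> 'v set \<Rightarrow> nat \<Rightarrow> 'v \<Rightarrow> real" where
  "truncated_dist w Z N x = real (the_enat (min (graph_dist w x Z) (enat N)))"

lemma graph_dist_step:
  assumes "0 < w x y"
  shows "graph_dist w x Z \<le> graph_dist w y Z + 1"
proof (cases "graph_dist w y Z")
  case (enat k)
  let ?S = "{enat k | k z. z \<in> Z \<and> (y, z) \<in> edges w ^^ k}"
  have "?S \<noteq> {}"
  proof
    assume "?S = {}"
    then have "graph_dist w y Z = top" unfolding graph_dist_def by (simp only: Inf_empty)
    with enat show False by (simp add: top_enat_def)
  qed
  then obtain e where "e \<in> ?S" by (meson ex_in_conv)
  then have "Inf ?S \<in> ?S" by (rule wellorder_InfI)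
  then have "enat k \<in> ?S" using enat unfolding graph_dist_def by simp
  then obtain z where z: "z \<in> Z" "(y, z) \<in> edges w ^^ k" by auto
  have "(x, y) \<in> edges w" using assms by (simp add: edges_def)
  then have "(x, z) \<in> edges w ^^ Suc k" using z(2) by (rule relpow_Suc_I2)
  then have "graph_dist w x Z \<le> enat (Suc k)" unfolding graph_dist_def using z(1) by (intro Inf_lower) blast
  then show ?thesis by (simp add: enat one_enat_def)
qed simp

lemma truncated_dist_Z: "z \<in> Z \<Longrightarrow> truncated_dist w Z N z = 0"
proof -
  assume "z \<in> Z"
  then have "graph_dist w z Z \<le> enat 0" unfolding graph_dist_def by (intro Inf_lower) force
  then show ?thesis by (cases "graph_dist w z Z") (auto simp: truncated_dist_def min_def)
qed

lemma truncated_dist_far: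
  assumes "enat N \<le> graph_dist w x Z"
  shows "truncated_dist w Z N x = real N"
  using assms by (simp add: truncated_dist_def min_absorb2)

context weighted_graph
begin

lemma truncated_dist_Lipschitz:
  assumes "0 < w x y"
  shows "\<bar>truncated_dist w Z N x - truncated_dist w Z N y\<bar> \<le> 1"
proof -
  have "graph_dist w x Z \<le> graph_dist w y Z + 1" "graph_dist w y Z \<le> graph_dist w x Z + 1"
    using assms weight_sym[of x y] by (auto intro: graph_dist_step)
  then show ?thesis unfolding truncated_dist_def
    by (cases "graph_dist w x Z"; cases "graph_dist w y Z") (auto simp: one_enat_def min_def)
qed

end

section \<open>Generating function of the hitting time\<close>

context weighted_graph
begin

text \<open>\<open>hit\<close> and \<open>green\<close> are the functions \<open>f\<close> and \<open>v\<close> of the flow argument. Reversibility allows the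
  Green function from \<open>u\<close> to be computed with the walk started at \<open>x\<close>.\<close>
definition hit where "hit K Z = gf K Z (indicator Z)"
definition green where "green K Z u = gf K Z (\<lambda>x. if x = u then 1 / vertex_weight w u else 0)"

lemma source_hit: "finite K \<Longrightarrow> bounded_source w K (indicator Z) 1"
  by unfold_locales (auto simp: indicator_def)

lemma source_green:
  "finite K \<Longrightarrow> bounded_source w K (\<lambda>x. if x = u then 1 / vertex_weight w u else 0) (1 / vertex_weight w u)"
  using vertex_weight_pos[of u] by unfold_locales auto

lemma hit_le_1:
  assumes "finite K" "0 \<le> l" "l < 1"
  shows "hit K Z l x \<le> 1"
proof -
  have partial: "(\<Sum>t<N. killed K Z (indicator Z) t x * l ^ t) \<le> 1" for N x
  proof (induction N arbitrary: x)
    case (Suc N)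
    show ?case
    proof (cases "x \<in> Z")
      case False
      have "(\<Sum>t<Suc N. killed K Z (indicator Z) t x * l ^ t)
          = (\<Sum>t<N. (\<Sum>y\<in>K. jump x y * killed K Z (indicator Z) t y) * (l * l ^ t))"
        using False by (simp add: sum.lessThan_Suc_shift del: sum.lessThan_Suc)
      also have "\<dots> = l * (\<Sum>y\<in>K. jump x y * (\<Sum>t<N. killed K Z (indicator Z) t y * l ^ t))"
        by (simp add: sum_distrib_left sum_distrib_right mult_ac) (rule sum.swap)
      also have "\<dots> \<le> l * (\<Sum>y\<in>K. jump x y * 1)"
        using assms Suc jump_nonneg by (intro mult_left_mono sum_mono) auto
      also have "\<dots> \<le> 1 * 1"
        using assms sum_jump_le[of K x] jump_nonneg by (intro mult_mono) (auto intro: sum_nonneg)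
      finally show ?thesis by simp
    qed (simp add: sum.lessThan_Suc_shift del: sum.lessThan_Suc)
  qed simp
  interpret bounded_source w K Z "indicator Z" 1 using source_hit[OF assms(1)] .
  show ?thesis unfolding hit_def gf_def using assms summable_gf[of l x] partial
    by (intro suminf_le_const) auto
qed

lemma hit_Z:
  assumes "finite K" "0 \<le> l" "l < 1" "x \<in> Z"
  shows "hit K Z l x = 1"
proof -
  interpret bounded_source w K Z "indicator Z" 1 using source_hit[OF assms(1)] .
  show ?thesis using gf_eq[of l x] assms by (simp add: hit_def)
qed

lemma hit_le:
  assumes "finite K" "0 \<le> l" "l < 1" "x \<notin> Z"
  shows "hit K Z l x \<le> l"
proof -
  interpret bounded_source w K Z "indicator Z" 1 using source_hit[OF assms(1)] .
  have "hit K Z l x = l * (\<Sum>y\<in>K. jump x y * hit K Z l y)"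
    using gf_eq[of l x] assms by (simp add: hit_def)
  also have "\<dots> \<le> l * (\<Sum>y\<in>K. jump x y * 1)"
    using assms hit_le_1 jump_nonneg by (intro mult_left_mono sum_mono) auto
  also have "\<dots> \<le> l * 1" using assms sum_jump_le[of K x] by (intro mult_left_mono) auto
  finally show ?thesis by simp
qed

text \<open>A power series with nonnegative coefficients vanishes at one positive point only if all coefficients
  vanish. This covers sets \<open>K\<close> in which \<open>Z\<close> cannot be reached from \<open>u\<close>.\<close>
lemma hit_zero_everywhere:
  assumes K: "finite K" and l: "0 < l" "l < 1" and zero: "hit K Z l x = 0" and l': "0 \<le> l'" "l' < 1"
  shows "hit K Z l' x = 0"
proof -
  interpret bounded_source w K Z "indicator Z" 1 using source_hit[OF K] .
  have "killed K Z (indicator Z) t x * l ^ t = 0" for t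
    using zero l summable_gf[of l x] killed_nonneg[OF s(1)]
    unfolding hit_def gf_def by (subst (asm) suminf_eq_zero_iff) auto
  then have "killed K Z (indicator Z) t x = 0" for t using l by simp
  then show ?thesis by (simp add: hit_def gf_def)
qed

lemma voltage_pair_hit_green:
  assumes K: "finite K" "u \<in> K" "u \<notin> Z" and l: "0 < l" "l < 1" and pos: "0 < hit K Z l u"
  shows "voltage_pair w (vertex_weight w) K Z u l (hit K Z l) (green K Z u l)"
proof
  interpret H: bounded_source w K Z "indicator Z" 1 using source_hit[OF K(1)] .
  interpret G: bounded_source w K Z "\<lambda>x. if x = u then 1 / vertex_weight w u else 0" "1 / vertex_weight w u"
    using source_green[OF K(1)] .
  have l': "\<bar>l\<bar> < 1" using l by simp
  note h = H.gf_eq[OF l', folded hit_def] and g = G.gf_eq[OF l', folded green_def]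
  show "0 \<le> hit K Z l x" for x unfolding hit_def using l by (intro H.gf_nonneg) auto
  show "0 \<le> green K Z u l x" for x unfolding green_def using l by (intro G.gf_nonneg) auto
  show "green K Z u l x = 0" if "x \<in> Z" for x using g[of x] that K by auto
  show "vertex_weight w x * hit K Z l x = l * (\<Sum>y\<in>K. w x y * hit K Z l y)" if "x \<notin> Z" for x
    using h[of x] that weight_jump[where x = x and K = K and h = "hit K Z l"] by simp
  show "vertex_weight w x * green K Z u l x = (if x = u then 1 else 0) + l * (\<Sum>y\<in>K. w x y * green K Z u l y)"
    if "x \<notin> Z" for x
    using that weight_jump[where x = x and K = K and h = "green K Z u l"] vertex_weight_pos[of x]
    by (subst g) (auto simp: distrib_left)
qed (use K l pos hit_Z hit_le in \<open>auto simp: weight_sym weight_nonneg vertex_weight_pos\<close>)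

text \<open>The derivative of \<open>hit\<close> solves the differentiated first-step equations, whose source term at \<open>x\<close> is
  \<open>vertex_weight w x * hit K Z l x / l\<close>; pairing with the Green function evaluates it at \<open>u\<close>.\<close>
lemma total_time_hit:
  assumes K: "finite K" "u \<in> K" "u \<notin> Z" and l: "0 < l" "l < 1" and pos: "0 < hit K Z l u"
  shows "l * gf' K Z (indicator Z) l u = voltage_pair.total_time (vertex_weight w) K Z (hit K Z l) (green K Z u l)"
proof -
  interpret H: bounded_source w K Z "indicator Z" 1 using source_hit[OF K(1)] .
  interpret V: voltage_pair w "vertex_weight w" K Z u l "hit K Z l" "green K Z u l"
    by (rule voltage_pair_hit_green[OF assms])
  define h' where "h' = gf' K Z (indicator Z) l"
  define v where "v = green K Z u l"
  define h where "h = hit K Z l"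
  let ?A = "K - Z" and ?W = "vertex_weight w"
  have h'_Z: "h' x = 0" if "x \<in> Z" for x
    using H.gf'_eq[of l x] l that by (simp add: h'_def)
  have h'_eq: "?W x * h' x = (\<Sum>y\<in>K. w x y * h y) + l * (\<Sum>y\<in>?A. w x y * h' y)" if "x \<notin> Z" for x
  proof -
    have "?W x * h' x = ?W x * (\<Sum>y\<in>K. jump x y * h y) + l * (?W x * (\<Sum>y\<in>K. jump x y * h' y))"
      using H.gf'_eq[of l x] l that by (simp add: h'_def h_def hit_def distrib_left)
    moreover have "(\<Sum>y\<in>K. w x y * h' y) = (\<Sum>y\<in>?A. w x y * h' y)"
      by (subst V.sum_split_Z) (simp add: h'_Z)
    ultimately show ?thesis by (simp only: weight_jump)
  qed
  have v_eq: "?W y * v y = (if y = u then 1 else 0) + l * (\<Sum>x\<in>?A. w y x * v x)" if "y \<notin> Z" for y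
    using V.v_eq[OF that] V.sum_split_Z[of "\<lambda>x. w y x * v x"] V.v_Z by (simp add: v_def)
  have f_eq: "l * (\<Sum>y\<in>K. w x y * h y) = ?W x * h x" if "x \<notin> Z" for x
    using V.f_eq[OF that] by (simp add: h_def)
  have "(\<Sum>x\<in>?A. v x * (?W x * h' x)) = (\<Sum>x\<in>?A. v x * (\<Sum>y\<in>K. w x y * h y)) + (\<Sum>x\<in>?A. \<Sum>y\<in>?A. l * w x y * v x * h' y)"
    unfolding sum.distrib[symmetric]
  proof (intro sum.cong refl)
    fix x assume "x \<in> ?A"
    then have "x \<notin> Z" by simp
    then show "v x * (?W x * h' x) = v x * (\<Sum>y\<in>K. w x y * h y) + (\<Sum>y\<in>?A. l * w x y * v x * h' y)"
      unfolding h'_eq[OF \<open>x \<notin> Z\<close>] by (simp add: distrib_left sum_distrib_left mult_ac)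
  qed
  also have "(\<Sum>x\<in>?A. \<Sum>y\<in>?A. l * w x y * v x * h' y) = (\<Sum>y\<in>?A. \<Sum>x\<in>?A. l * w x y * v x * h' y)"
    by (rule sum.swap)
  also have "\<dots> = (\<Sum>y\<in>?A. h' y * (l * (\<Sum>x\<in>?A. w y x * v x)))"
    by (simp add: sum_distrib_left weight_sym mult_ac)
  also have "\<dots> = (\<Sum>y\<in>?A. v y * (?W y * h' y) - (if y = u then h' u else 0))"
  proof (intro sum.cong refl)
    fix y assume "y \<in> ?A"
    then have "l * (\<Sum>x\<in>?A. w y x * v x) = ?W y * v y - (if y = u then 1 else 0)"
      using v_eq[of y] by auto
    then show "h' y * (l * (\<Sum>x\<in>?A. w y x * v x)) = v y * (?W y * h' y) - (if y = u then h' u else 0)"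
      by (simp only:) (auto simp: right_diff_distrib mult_ac)
  qed
  also have "\<dots> = (\<Sum>y\<in>?A. v y * (?W y * h' y)) - h' u" using K by (simp add: sum_subtractf)
  finally have "h' u = (\<Sum>x\<in>?A. v x * (\<Sum>y\<in>K. w x y * h y))" by simp
  then have "l * h' u = (\<Sum>x\<in>?A. v x * (l * (\<Sum>y\<in>K. w x y * h y)))"
    by (simp add: sum_distrib_left mult_ac)
  also have "\<dots> = (\<Sum>x\<in>?A. ?W x * v x * h x)"
    by (intro sum.cong refl) (simp add: f_eq)
  finally show ?thesis by (simp add: V.total_time_def h'_def v_def h_def)
qed

lemma dist_not_in: "enat (n + 1) \<le> graph_dist w u Z \<Longrightarrow> u \<notin> Z"
  using truncated_dist_far[of "n + 1" w u Z] truncated_dist_Z[of u Z w "n + 1"] by auto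

lemma no_edge_if_far:
  assumes far: "enat (n + 1) \<le> graph_dist w u Z" and n: "1 \<le> n" and z: "z \<in> Z"
  shows "w u z = 0"
proof (rule ccontr)
  assume "w u z \<noteq> 0"
  then have "0 < w u z" using weight_nonneg[of u z] by simp
  then show False
    using truncated_dist_Lipschitz[of u z Z "n + 1"] truncated_dist_Z[OF z, of w "n + 1"]
      truncated_dist_far[OF far] n by simp
qed

text \<open>The flow estimates are applied with \<open>G = g / E\<close> and \<open>E = F\<^sup>2\<close>: the hypotheses involving \<open>g\<close>
  turn into those on \<open>G\<close> because \<open>(hit K Z l u)\<^sup>2 = l\<^sup>2 * E ^ n\<close>. The distance is truncated
  at \<open>n\<close> in the volume case, so that it is constant on the neighbours of \<open>u\<close>, and at \<open>n + 1\<close> in the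
  resistance case, so that it also counts the edges at \<open>u\<close>.\<close>
theorem hit_bound:
  assumes K: "finite K" "u \<in> K" and far: "enat (n + 1) \<le> graph_dist w u Z"
    and g: "1 < g" and Phi: "0 < Phi" "Phi < 1" and l: "l = Phi * (g + 1) / (g + Phi\<^sup>2)"
    and cond: "1 \<le> n \<Longrightarrow> 2 * cut_weight w K Z * g \<le> vertex_weight w u * (g - 1)\<^sup>2 * g ^ (n - 1) \<or>
      (\<forall>l. 0 < l \<longrightarrow> l < 1 \<longrightarrow> cut_weight w K Z * green K Z u l u \<le> g ^ n)"
  shows "hit K Z l u \<le> l * Phi ^ n"
proof -
  interpret H: bounded_source w K Z "indicator Z" 1 using source_hit[OF K(1)] .
  have u: "u \<notin> Z" using dist_not_in[OF far] .
  have l0: "0 < l" and l1: "l < 1" using discount_range[OF g Phi] by (simp_all add: l)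
  show ?thesis
  proof (cases "n = 0")
    case True
    then show ?thesis using hit_le[OF K(1) _ l1 u] l0 by simp
  next
    case False
    then have n: "1 \<le> n" by simp
    show ?thesis
    proof (cases "\<exists>l. 0 < l \<and> l < 1 \<and> hit K Z l u = 0")
      case True
      then have "hit K Z l u = 0" using hit_zero_everywhere[OF K(1)] l0 l1 by (meson less_imp_le)
      then show ?thesis using l0 Phi by simp
    next
      case False
      have pos: "0 < hit K Z l u" if "0 < l" "l < 1" for l
      proof -
        have "0 \<le> hit K Z l u" unfolding hit_def using that by (intro H.gf_nonneg) auto
        moreover have "hit K Z l u \<noteq> 0" using False that by blast
        ultimately show ?thesis by simp
      qed
      show ?thesis
      proof (rule growth_comparison[where a = "\<lambda>l. hit K Z l u"
            and a' = "\<lambda>l. gf' K Z (indicator Z) l u", OF g n _ pos _ _ Phi l])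
        fix l :: real assume l: "0 < l" "l < 1"
        show "((\<lambda>l. hit K Z l u) has_field_derivative gf' K Z (indicator Z) l u) (at l)"
          unfolding hit_def using l by (intro H.gf_has_derivative) auto
        show "hit K Z l u \<le> l" using hit_le[OF K(1)] l u by simp
      next
        fix l E :: real
        assume l: "0 < l" "l < 1" and E: "0 < E" "E \<le> 1" "E ^ n = (hit K Z l u / l)\<^sup>2"
        interpret V: voltage_pair w "vertex_weight w" K Z u l "hit K Z l" "green K Z u l"
          by (rule voltage_pair_hit_green[OF K u l pos[OF l]])
        have G: "1 < g / E" using g E by simp
        have GE: "(g / E + 1) / (g / E - 1) = (g + E) / (g - E)" using E g by (simp add: field_simps)
        have hE: "(hit K Z l u)\<^sup>2 = l\<^sup>2 * E ^ n" using E(3) l by (simp add: power_divide)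
        show "hit K Z l u * (1 + real n * ((g + E) / (g - E))) \<le> l * gf' K Z (indicator Z) l u"
          unfolding total_time_hit[OF K u l pos[OF l]] GE[symmetric]
          using cond[OF n]
        proof
          assume vol: "2 * cut_weight w K Z * g \<le> vertex_weight w u * (g - 1)\<^sup>2 * g ^ (n - 1)"
          have near: "w u z = 0" if "z \<in> Z" for z using no_edge_if_far[OF far n that] .
          have D: "truncated_dist w Z n x = real n" if "0 < w u x" for x
          proof (rule truncated_dist_far)
            have "enat (n + 1) \<le> graph_dist w x Z + 1" using far graph_dist_step[of w u x Z, OF that] by (rule order_trans)
            then show "enat n \<le> graph_dist w x Z" by (cases "graph_dist w x Z") (auto simp: one_enat_def)
          qed
          have "2 * cut_weight w K Z * g \<le> vertex_weight w u * (g - E)\<^sup>2 * g ^ (n - 1)"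
            using vol g E vertex_weight_pos[of u]
            by (elim order_trans) (intro mult_right_mono mult_left_mono power_mono; simp)
          then have "l\<^sup>2 / E * (2 * cut_weight w K Z * g) \<le> l\<^sup>2 / E * (vertex_weight w u * (g - E)\<^sup>2 * g ^ (n - 1))"
            using E by (intro mult_left_mono) auto
          also have "\<dots> = (l\<^sup>2 * E ^ n) * vertex_weight w u * (g / E - 1)\<^sup>2 * (g / E) ^ (n - 1)"
          proof -
            have "E ^ n = E * E ^ (n - 1)" using n by (simp add: power_eq_if)
            moreover have "(g - E)\<^sup>2 = (g / E - 1)\<^sup>2 * E\<^sup>2"
              using E by (simp add: power_mult_distrib[symmetric] left_diff_distrib)
            moreover have "g ^ (n - 1) = (g / E) ^ (n - 1) * E ^ (n - 1)"
              using E by (simp add: power_mult_distrib[symmetric])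
            ultimately show ?thesis using E by (simp add: power2_eq_square)
          qed
          finally show "hit K Z l u * (1 + real n * ((g / E + 1) / (g / E - 1))) \<le> V.total_time"
            using near D n G truncated_dist_Lipschitz[of _ _ Z n] truncated_dist_Z[of _ Z w n]
            by (intro V.total_time_volume[where D = "truncated_dist w Z n"]) (simp_all add: hE mult_ac)
        next
          assume "\<forall>l. 0 < l \<longrightarrow> l < 1 \<longrightarrow> cut_weight w K Z * green K Z u l u \<le> g ^ n"
          then have "l\<^sup>2 * (cut_weight w K Z * green K Z u l u) \<le> l\<^sup>2 * g ^ n"
            using l by (intro mult_left_mono) auto
          also have "\<dots> = (hit K Z l u)\<^sup>2 * (g / E) ^ n" using E by (simp add: hE power_divide)
          finally show "hit K Z l u * (1 + real n * ((g / E + 1) / (g / E - 1))) \<le> V.total_time"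
            using G truncated_dist_Lipschitz[of _ _ Z "n + 1"] truncated_dist_Z[of _ Z w "n + 1"] truncated_dist_far[OF far]
            by (intro V.total_time_resistance[where D = "truncated_dist w Z (n + 1)"]) (simp_all add: mult_ac)
        qed
      qed
    qed
  qed
qed

end

section \<open>Effective resistance\<close>

context weighted_graph
begin

lemma green_mono:
  assumes "finite L" "K \<subseteq> L" "0 \<le> l" "l < 1"
  shows "green K Z u l x \<le> green L Z u l x"
proof -
  let ?s = "\<lambda>x. if x = u then 1 / vertex_weight w u else 0"
  have fK: "finite K" using assms finite_subset by blast
  interpret A: bounded_source w K Z ?s "1 / vertex_weight w u" using source_green[OF fK] .
  interpret B: bounded_source w L Z ?s "1 / vertex_weight w u" using source_green[OF assms(1)] .
  show ?thesis unfolding green_def gf_def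
    using A.summable_gf B.summable_gf assms killed_mono[OF assms(1,2) A.s(1)]
    by (intro suminf_le mult_right_mono) auto
qed

text \<open>Green's formula.\<close>
lemma dirichlet_form:
  fixes a b :: "'v \<Rightarrow> real"
  shows "(\<Sum>x\<in>K. \<Sum>y\<in>K. w x y * (a x - a y) * (b x - b y)) = 2 * (\<Sum>x\<in>K. b x * (\<Sum>y\<in>K. w x y * (a x - a y)))"
  by (rule sum_antisym_weighted) (simp add: weight_sym algebra_simps)

lemma voltage_form:
  assumes "unit_current_voltage w K u Z v" "finite K" "u \<in> K" "u \<notin> Z" "\<And>z. z \<in> Z \<Longrightarrow> b z = 0"
  shows "(\<Sum>x\<in>K. b x * (\<Sum>y\<in>K. w x y * (v x - v y))) = b u"
proof -
  have "(\<Sum>x\<in>K. b x * (\<Sum>y\<in>K. w x y * (v x - v y))) = (\<Sum>x\<in>K. if x = u then b u else 0)"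
    using assms by (intro sum.cong refl) (auto simp: unit_current_voltage_def)
  then show ?thesis using assms by simp
qed

text \<open>Rayleigh's monotonicity principle. The energy form of \<open>K'\<close> reproduces values at \<open>u\<close> when paired with
  \<open>v\<close>, so \<open>v u\<close> is the energy of \<open>v\<close>, and \<open>b u\<close> for the Green function \<open>b\<close> is its pairing with
  \<open>v\<close>. The energy of \<open>b\<close> is at most \<open>b u\<close>, since \<open>b \<ge> 0\<close> and both discounting and the weight
  lost outside \<open>K\<close> act in the right direction. Nonnegativity of the energy of \<open>v - b\<close> then gives
  \<open>2 * b u \<le> v u + b u\<close>.\<close>
lemma green_le_voltage:
  assumes v: "unit_current_voltage w K' u Z v" and K': "u \<in> K'" "u \<notin> Z"
    and K: "finite K" "K' \<subseteq> K" and l: "0 < l" "l < 1"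
  shows "green K Z u l u \<le> v u"
proof -
  let ?W = "vertex_weight w"
  interpret G: bounded_source w K Z "\<lambda>x. if x = u then 1 / ?W u else 0" "1 / ?W u"
    using source_green[OF K(1)] .
  define b where "b = green K Z u l"
  have finK': "finite K'" using K finite_subset by blast
  have b_nonneg: "0 \<le> b x" for x unfolding b_def green_def using l by (intro G.gf_nonneg) auto
  have b_eq: "b x = (if x = u then 1 / ?W u else 0) + (if x \<in> Z then 0 else l * (\<Sum>y\<in>K. jump x y * b y))" for x
    using G.gf_eq[of l x] l by (simp add: b_def green_def)
  have b_Z: "b z = 0" if "z \<in> Z" for z using b_eq[of z] that K' by auto
  have b_W: "?W x * b x = (if x = u then 1 else 0) + l * (\<Sum>y\<in>K. w x y * b y)" if "x \<notin> Z" for x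
    using that vertex_weight_pos[of x] weight_jump[where x = x and K = K and h = b]
    by (subst b_eq) (auto simp: distrib_left)
  have v_Z: "v z = 0" if "z \<in> Z" for z using v that by (simp add: unit_current_voltage_def)
  have vv: "(\<Sum>x\<in>K'. \<Sum>y\<in>K'. w x y * (v x - v y) * (v x - v y)) = 2 * v u"
    by (simp add: dirichlet_form voltage_form[OF v finK' K' v_Z])
  have vb: "(\<Sum>x\<in>K'. \<Sum>y\<in>K'. w x y * (v x - v y) * (b x - b y)) = 2 * b u"
    by (simp add: dirichlet_form voltage_form[OF v finK' K' b_Z])
  have "(\<Sum>x\<in>K'. \<Sum>y\<in>K'. w x y * (b x - b y) * (b x - b y))
      \<le> (\<Sum>x\<in>K'. \<Sum>y\<in>K. w x y * (b x - b y) * (b x - b y))"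
    using K weight_nonneg by (intro sum_mono sum_mono2) (auto simp: mult.assoc)
  also have "\<dots> \<le> (\<Sum>x\<in>K. \<Sum>y\<in>K. w x y * (b x - b y) * (b x - b y))"
    using K weight_nonneg by (intro sum_mono2) (auto simp: mult.assoc intro!: sum_nonneg)
  also have "\<dots> = 2 * (\<Sum>x\<in>K. b x * (\<Sum>y\<in>K. w x y * (b x - b y)))" by (rule dirichlet_form)
  also have "\<dots> \<le> 2 * (\<Sum>x\<in>K. if x = u then b u else 0)"
  proof (intro mult_left_mono sum_mono)
    fix x assume "x \<in> K"
    show "b x * (\<Sum>y\<in>K. w x y * (b x - b y)) \<le> (if x = u then b u else 0)"
    proof (cases "x \<in> Z")
      case False
      have "0 \<le> (\<Sum>y\<in>K. w x y * b y)" using weight_nonneg b_nonneg by (simp add: sum_nonneg)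
      then have "l * (\<Sum>y\<in>K. w x y * b y) \<le> 1 * (\<Sum>y\<in>K. w x y * b y)"
        using l by (intro mult_right_mono) auto
      moreover have "(\<Sum>y\<in>K. w x y) * b x \<le> ?W x * b x"
        using sum_weight_le[OF K(1)] b_nonneg by (rule mult_right_mono)
      moreover have "(\<Sum>y\<in>K. w x y * (b x - b y)) = (\<Sum>y\<in>K. w x y) * b x - (\<Sum>y\<in>K. w x y * b y)"
        by (simp add: right_diff_distrib sum_subtractf sum_distrib_right)
      ultimately have "(\<Sum>y\<in>K. w x y * (b x - b y)) \<le> (if x = u then 1 else 0)"
        using b_W[OF False] by linarith
      then have "b x * (\<Sum>y\<in>K. w x y * (b x - b y)) \<le> b x * (if x = u then 1 else 0)"
        using b_nonneg by (rule mult_left_mono)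
      then show ?thesis by (auto split: if_splits)
    qed (use b_Z K' in auto)
  qed simp
  also have "\<dots> = 2 * b u" using K K' by auto
  finally have bb: "(\<Sum>x\<in>K'. \<Sum>y\<in>K'. w x y * (b x - b y) * (b x - b y)) \<le> 2 * b u" .
  have "0 \<le> (\<Sum>x\<in>K'. \<Sum>y\<in>K'. w x y * ((v x - v y) - (b x - b y))\<^sup>2)"
    using weight_nonneg by (intro sum_nonneg) auto
  also have "\<dots> = (\<Sum>x\<in>K'. \<Sum>y\<in>K'. w x y * (v x - v y) * (v x - v y))
      - 2 * (\<Sum>x\<in>K'. \<Sum>y\<in>K'. w x y * (v x - v y) * (b x - b y))
      + (\<Sum>x\<in>K'. \<Sum>y\<in>K'. w x y * (b x - b y) * (b x - b y))"
    unfolding sum_distrib_left sum_subtractf[symmetric] sum.distrib[symmetric]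
    by (intro sum.cong refl) (simp add: power2_eq_square algebra_simps)
  finally show ?thesis using vv vb bb by (simp add: b_def)
qed

lemma green_le_resistance:
  assumes "finite K" "u \<in> K" "u \<notin> Z" "0 < l" "l < 1"
  shows "ennreal (green K Z u l u) \<le> eff_resistance w u Z"
  unfolding eff_resistance_def
proof (rule INF_greatest, clarify)
  fix K' v assume K': "finite K'" "u \<in> K'" "unit_current_voltage w K' u Z v"
  have "green K Z u l u \<le> green (K \<union> K') Z u l u" using assms K' by (intro green_mono) auto
  also have "\<dots> \<le> v u" using assms K' by (intro green_le_voltage[of K']) auto
  finally show "ennreal (green K Z u l u) \<le> ennreal (v u)" by (rule ennreal_leI)
qed

lemma sum_vertex_weight_le:
  assumes "finite L" "L \<subseteq> Z" "set_weight w Z < \<infinity>"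
  shows "(\<Sum>z\<in>L. vertex_weight w z) \<le> enn2real (set_weight w Z)"
proof -
  have "ennreal (\<Sum>z\<in>L. vertex_weight w z) = (\<Sum>z\<in>L. ennreal (vertex_weight w z))"
    using vertex_weight_pos by (simp add: sum_ennreal less_imp_le)
  also have "\<dots> \<le> set_weight w Z"
    unfolding set_weight_def using assms(1,2)
    by (subst nonneg_infsum_complete) (auto intro!: SUP_upper)
  finally have "ennreal (\<Sum>z\<in>L. vertex_weight w z) \<le> ennreal (enn2real (set_weight w Z))"
    using assms(3) by simp
  then show ?thesis by (simp add: ennreal_le_iff)
qed

lemma cut_weight_nonneg: "0 \<le> cut_weight w K Z"
  unfolding cut_weight_def using weight_nonneg by (intro sum_nonneg) auto

lemma cut_weight_le:
  assumes "finite K" "set_weight w Z < \<infinity>"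
  shows "cut_weight w K Z \<le> enn2real (set_weight w Z)"
proof -
  have "cut_weight w K Z = (\<Sum>z\<in>K \<inter> Z. \<Sum>x\<in>K - Z. w z x)"
    unfolding cut_weight_def by (subst sum.swap) (simp add: weight_sym)
  also have "\<dots> \<le> (\<Sum>z\<in>K \<inter> Z. vertex_weight w z)"
    using assms by (intro sum_mono sum_weight_le) auto
  also have "\<dots> \<le> enn2real (set_weight w Z)" using assms by (intro sum_vertex_weight_le) auto
  finally show ?thesis .
qed

text \<open>The resistances of the cuts around \<open>u\<close> and around \<open>Z\<close> add up, since no edge joins \<open>u\<close> to \<open>Z\<close>
  (Nash-Williams). In each cut the energy of the unit current is bounded by \<open>quad\<close>, the tangent
  of the square at the constant voltage drop.\<close>
lemma voltage_lower_bound: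
  assumes v: "unit_current_voltage w K u Z v" and K: "finite K" "u \<in> K" "u \<notin> Z"
    and far: "\<And>z. z \<in> Z \<Longrightarrow> w u z = 0" and fin: "set_weight w Z < \<infinity>"
  shows "0 < enn2real (set_weight w Z)"
    and "1 / vertex_weight w u + 1 / enn2real (set_weight w Z) \<le> v u"
proof -
  let ?W = "vertex_weight w"
  define S where "S = (\<Sum>z\<in>K \<inter> Z. ?W z)"
  have v_Z: "v z = 0" if "z \<in> Z" for z using v that by (simp add: unit_current_voltage_def)
  define t where "t x y = w x y * (v x - v y) * (v x - v y)" for x y
  have t_nonneg: "0 \<le> t x y" for x y using weight_nonneg by (simp add: t_def mult.assoc)
  have t_sym: "t x y = t y x" for x y by (simp add: t_def weight_sym[of x y] algebra_simps)
  have quad: "2 * d / s - 1 / s\<^sup>2 \<le> d * d" if "0 < s" for d s :: real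
  proof -
    have "0 \<le> (d - 1 / s)\<^sup>2" by simp
    then show ?thesis by (simp add: power2_eq_square algebra_simps)
  qed
  have out: "(\<Sum>y\<in>K. w u y * (v u - v y)) = 1" using v by (simp add: unit_current_voltage_def)
  have "1 / ?W u \<le> (\<Sum>y\<in>K. w u y * (2 * (v u - v y) / ?W u - 1 / (?W u)\<^sup>2))"
  proof -
    have "(\<Sum>y\<in>K. w u y * (2 * (v u - v y) / ?W u - 1 / (?W u)\<^sup>2))
        = 2 / ?W u * (\<Sum>y\<in>K. w u y * (v u - v y)) - (\<Sum>y\<in>K. w u y) / (?W u)\<^sup>2"
      unfolding sum_distrib_left sum_divide_distrib sum_subtractf[symmetric]
      by (intro sum.cong refl) (simp add: right_diff_distrib diff_divide_distrib mult_ac)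
    moreover have "(\<Sum>y\<in>K. w u y) / (?W u)\<^sup>2 \<le> ?W u / (?W u)\<^sup>2"
      using sum_weight_le[OF K(1)] by (intro divide_right_mono) auto
    moreover have "?W u / (?W u)\<^sup>2 = 1 / ?W u" by (simp add: power2_eq_square)
    ultimately show ?thesis unfolding out by simp
  qed
  also have "\<dots> \<le> (\<Sum>y\<in>K. t u y)"
    unfolding t_def mult.assoc
    by (intro sum_mono mult_left_mono quad[OF vertex_weight_pos] weight_nonneg)
  finally have at_u: "1 / ?W u \<le> (\<Sum>y\<in>K. t u y)" .
  have "0 = 2 * (\<Sum>x\<in>K. \<Sum>y\<in>K. w x y * (v x - v y))"
    using dirichlet_form[of v "\<lambda>_. 1" K] by simp
  also have "(\<Sum>x\<in>K. \<Sum>y\<in>K. w x y * (v x - v y))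
      = (\<Sum>x\<in>K - Z. \<Sum>y\<in>K. w x y * (v x - v y)) + (\<Sum>z\<in>K \<inter> Z. \<Sum>y\<in>K. w z y * (v z - v y))"
    using sum.Int_Diff[OF K(1), of "\<lambda>x. \<Sum>y\<in>K. w x y * (v x - v y)" Z] by simp
  also have "(\<Sum>x\<in>K - Z. \<Sum>y\<in>K. w x y * (v x - v y)) = (\<Sum>x\<in>K - Z. if x = u then 1 else 0)"
    using v by (intro sum.cong refl) (auto simp: unit_current_voltage_def)
  also have "\<dots> = 1" using K by simp
  also have "(\<Sum>z\<in>K \<inter> Z. \<Sum>y\<in>K. w z y * (v z - v y)) = - (\<Sum>z\<in>K \<inter> Z. \<Sum>y\<in>K. w z y * v y)"
    by (simp add: v_Z sum_negf)
  \<comment> \<open>The unit of current that enters at \<open>u\<close> leaves the network through \<open>Z\<close>.\<close>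
  finally have inflow: "(\<Sum>z\<in>K \<inter> Z. \<Sum>y\<in>K. w z y * v y) = 1" by simp
  have "S \<noteq> 0"
  proof
    assume "S = 0"
    then have "K \<inter> Z = {}"
      using sum_pos[of "K \<inter> Z" ?W] K vertex_weight_pos unfolding S_def by auto
    then show False using inflow by simp
  qed
  moreover have "0 \<le> S" unfolding S_def using vertex_weight_pos by (intro sum_nonneg) (simp add: less_imp_le)
  ultimately have S: "0 < S" by simp
  have "1 / S \<le> (\<Sum>z\<in>K \<inter> Z. \<Sum>y\<in>K. w z y * (2 * v y / S - 1 / S\<^sup>2))"
  proof -
    have "(\<Sum>z\<in>K \<inter> Z. \<Sum>y\<in>K. w z y * (2 * v y / S - 1 / S\<^sup>2))
        = 2 / S * (\<Sum>z\<in>K \<inter> Z. \<Sum>y\<in>K. w z y * v y) - (\<Sum>z\<in>K \<inter> Z. \<Sum>y\<in>K. w z y) / S\<^sup>2"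
      by (simp add: right_diff_distrib sum_subtractf sum_distrib_left sum_divide_distrib mult_ac)
    moreover have "(\<Sum>z\<in>K \<inter> Z. \<Sum>y\<in>K. w z y) / S\<^sup>2 \<le> S / S\<^sup>2"
      unfolding S_def using K by (intro divide_right_mono sum_mono sum_weight_le) auto
    moreover have "S / S\<^sup>2 = 1 / S" by (simp add: power2_eq_square)
    ultimately show ?thesis unfolding inflow by simp
  qed
  also have "\<dots> \<le> (\<Sum>z\<in>K \<inter> Z. \<Sum>y\<in>K. t z y)"
  proof (intro sum_mono)
    fix z y assume "z \<in> K \<inter> Z"
    then have "t z y = w z y * (v y * v y)" by (simp add: t_def v_Z)
    then show "w z y * (2 * v y / S - 1 / S\<^sup>2) \<le> t z y"
      using quad[OF S, of "v y"] weight_nonneg[of z y] by (simp add: mult_left_mono)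
  qed
  also have "\<dots> = (\<Sum>z\<in>K \<inter> Z. \<Sum>y\<in>K - Z - {u}. t z y)"
  proof (rule sum.cong[OF refl], rule sum.mono_neutral_right)
    fix z assume "z \<in> K \<inter> Z"
    then show "\<forall>i\<in>K - (K - Z - {u}). t z i = 0"
      using far[of z] weight_sym[of z u] by (auto simp: t_def v_Z)
  qed (use K in auto)
  finally have at_Z: "1 / S \<le> (\<Sum>z\<in>K \<inter> Z. \<Sum>y\<in>K - Z - {u}. t z y)" .
  let ?A = "K - Z - {u}"
  have "(\<Sum>y\<in>K. t u y) = (\<Sum>y\<in>?A. t u y)"
    using K far by (intro sum.mono_neutral_right) (auto simp: t_def)
  note at_u' = at_u[unfolded this]
  have K_eq: "(\<Sum>x\<in>K. h x) = h u + (\<Sum>x\<in>?A. h x) + (\<Sum>z\<in>K \<inter> Z. h z)" for h :: "'v \<Rightarrow> real"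
  proof -
    have "(\<Sum>x\<in>K. h x) = (\<Sum>x\<in>K - Z. h x) + (\<Sum>z\<in>K \<inter> Z. h z)"
      using sum.Int_Diff[OF K(1), of h Z] by simp
    then show ?thesis using K by (simp add: sum.remove[of "K - Z" u])
  qed
  have "2 * v u = (\<Sum>x\<in>K. \<Sum>y\<in>K. t x y)"
    unfolding t_def by (simp add: dirichlet_form voltage_form[OF v K v_Z])
  also have "\<dots> = (\<Sum>y\<in>K. t u y) + (\<Sum>x\<in>?A. \<Sum>y\<in>K. t x y) + (\<Sum>z\<in>K \<inter> Z. \<Sum>y\<in>K. t z y)"
    by (rule K_eq)
  finally have "2 * v u = (\<Sum>y\<in>K. t u y) + (\<Sum>x\<in>?A. \<Sum>y\<in>K. t x y) + (\<Sum>z\<in>K \<inter> Z. \<Sum>y\<in>K. t z y)" .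
  moreover have "(\<Sum>y\<in>?A. t u y) \<le> (\<Sum>y\<in>K. t u y)"
    using K t_nonneg by (intro sum_mono2) auto
  moreover have "(\<Sum>x\<in>?A. t x u + (\<Sum>z\<in>K \<inter> Z. t x z)) \<le> (\<Sum>x\<in>?A. \<Sum>y\<in>K. t x y)"
    unfolding K_eq[of "t _"] using t_nonneg by (intro sum_mono) (simp add: sum_nonneg)
  moreover have "(\<Sum>z\<in>K \<inter> Z. \<Sum>y\<in>?A. t z y) \<le> (\<Sum>z\<in>K \<inter> Z. \<Sum>y\<in>K. t z y)"
    using K t_nonneg by (intro sum_mono sum_mono2) auto
  moreover have "(\<Sum>x\<in>?A. t x u + (\<Sum>z\<in>K \<inter> Z. t x z)) = (\<Sum>y\<in>?A. t u y) + (\<Sum>z\<in>K \<inter> Z. \<Sum>y\<in>?A. t z y)"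
  proof -
    have "(\<Sum>z\<in>K \<inter> Z. \<Sum>y\<in>?A. t z y) = (\<Sum>y\<in>?A. \<Sum>z\<in>K \<inter> Z. t y z)"
      by (subst sum.swap) (intro sum.cong refl t_sym)
    moreover have "(\<Sum>y\<in>?A. t u y) = (\<Sum>y\<in>?A. t y u)" by (intro sum.cong refl t_sym)
    ultimately show ?thesis by (simp add: sum.distrib)
  qed
  ultimately have "1 / ?W u + 1 / S \<le> v u" using at_u' at_Z by linarith
  moreover have S_le: "S \<le> enn2real (set_weight w Z)"
    unfolding S_def using K fin by (intro sum_vertex_weight_le) auto
  then have "1 / enn2real (set_weight w Z) \<le> 1 / S" using S by (intro divide_left_mono) auto
  ultimately show "1 / ?W u + 1 / enn2real (set_weight w Z) \<le> v u" by linarith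
  show "0 < enn2real (set_weight w Z)" using S S_le by linarith
qed

text \<open>This makes the parameter \<open>g\<close> of the resistance case larger than 1.\<close>
theorem weight_times_resistance:
  assumes far: "enat (n + 1) \<le> graph_dist w u Z" and n: "1 \<le> n"
    and fin: "set_weight w Z < \<infinity>" "eff_resistance w u Z < \<infinity>"
  shows "1 < enn2real (set_weight w Z * eff_resistance w u Z)"
proof -
  have u: "u \<notin> Z" using dist_not_in[OF far] .
  have sep: "w u z = 0" if "z \<in> Z" for z using no_edge_if_far[OF far n that] .
  let ?WZ = "enn2real (set_weight w Z)" and ?r = "eff_resistance w u Z"
  note low = voltage_lower_bound[OF _ _ _ u sep fin(1)]
  have "\<exists>K v. finite K \<and> u \<in> K \<and> unit_current_voltage w K u Z v"
  proof (rule ccontr)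
    assume "\<not> ?thesis"
    then have "{(K, v). finite K \<and> u \<in> K \<and> unit_current_voltage w K u Z v} = {}" by blast
    then have "?r = \<infinity>" unfolding eff_resistance_def by (simp only: image_empty Inf_empty infinity_ennreal_def)
    then show False using fin by simp
  qed
  then have WZ: "0 < ?WZ" using low(1) by blast
  let ?c = "1 / vertex_weight w u + 1 / ?WZ"
  have "ennreal ?c \<le> ?r"
    unfolding eff_resistance_def using low(2) by (intro INF_greatest) (auto intro!: ennreal_leI)
  then have "ennreal ?c \<le> ennreal (enn2real ?r)" using fin by simp
  moreover have "0 < ?c" using WZ vertex_weight_pos[of u] by (simp add: add_pos_pos)
  ultimately have "?c \<le> enn2real ?r" by (subst (asm) ennreal_le_iff2) auto
  moreover have "?WZ * ?c = 1 + ?WZ / vertex_weight w u" using WZ by (simp add: distrib_left)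
  ultimately have "1 + ?WZ / vertex_weight w u \<le> ?WZ * enn2real ?r"
    using WZ by (metis less_imp_le mult_left_mono)
  moreover have "0 < ?WZ / vertex_weight w u" using WZ vertex_weight_pos[of u] by simp
  ultimately show ?thesis by (simp add: enn2real_mult)
qed

theorem hit_bound_volume_or_resistance:
  assumes K: "finite K" "u \<in> K" and far: "enat (n + 1) \<le> graph_dist w u Z"
    and cases: "(g > 1 \<and>
           ennreal ((g - 1)^2 * g powi (int n - 2))
             = 2 * set_weight w Z / ennreal (vertex_weight w u)) \<or>
         (n \<ge> 1 \<and> set_weight w Z < \<infinity> \<and> eff_resistance w u Z < \<infinity> \<and>
           g = enn2real (set_weight w Z * eff_resistance w u Z) powr (1 / real n))"
  shows "1 < g" and "\<lbrakk>0 < Phi; Phi < 1; l = Phi * (g + 1) / (g + Phi\<^sup>2)\<rbrakk> \<Longrightarrow> hit K Z l u \<le> l * Phi ^ n"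
proof -
  let ?W = "vertex_weight w u" and ?WZ = "enn2real (set_weight w Z)"
  have W: "0 < ?W" by (rule vertex_weight_pos)
  have u: "u \<notin> Z" using dist_not_in[OF far] .
  have "1 < g \<and> (1 \<le> n \<longrightarrow> 2 * cut_weight w K Z * g \<le> ?W * (g - 1)\<^sup>2 * g ^ (n - 1) \<or>
      (\<forall>l. 0 < l \<longrightarrow> l < 1 \<longrightarrow> cut_weight w K Z * green K Z u l u \<le> g ^ n))"
    using cases
  proof
    assume a: "g > 1 \<and> ennreal ((g - 1)^2 * g powi (int n - 2)) = 2 * set_weight w Z / ennreal ?W"
    have fin: "set_weight w Z < \<infinity>"
    proof (rule ccontr)
      assume "\<not> ?thesis"
      then have "set_weight w Z = top" by (simp add: less_top[symmetric])
      then have "2 * set_weight w Z / ennreal ?W = top"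
        by (simp add: ennreal_mult_top ennreal_top_divide)
      with a show False by simp
    qed
    have "ennreal (2 * r / ?W) = 2 * ennreal r / ennreal ?W" if "0 \<le> r" for r
      using that W by (simp add: divide_ennreal[symmetric] ennreal_mult)
    from this[of ?WZ] have "2 * set_weight w Z / ennreal ?W = ennreal (2 * ?WZ / ?W)"
      using fin by simp
    with a have "ennreal ((g - 1)^2 * g powi (int n - 2)) = ennreal (2 * ?WZ / ?W)" by simp
    then have "(g - 1)^2 * g powi (int n - 2) = 2 * ?WZ / ?W"
      using W a by (subst (asm) ennreal_inj) auto
    then have eq: "2 * ?WZ = ?W * ((g - 1)^2 * g powi (int n - 2))" using W by (simp add: field_simps)
    have "2 * cut_weight w K Z * g \<le> ?W * (g - 1)\<^sup>2 * g ^ (n - 1)" if n: "1 \<le> n"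
    proof -
      have "2 * cut_weight w K Z * g \<le> 2 * ?WZ * g"
        using cut_weight_le[OF K(1) fin] a by simp
      also have "\<dots> = ?W * (g - 1)\<^sup>2 * (g powi (int n - 2) * g)" by (simp add: eq)
      also have "g powi (int n - 2) * g = g powi (int n - 2 + 1)" using a by (subst power_int_add) auto
      also have "int n - 2 + 1 = int (n - 1)" using n by simp
      finally show ?thesis by (simp only: power_int_of_nat)
    qed
    with a show ?thesis by blast
  next
    assume b: "n \<ge> 1 \<and> set_weight w Z < \<infinity> \<and> eff_resistance w u Z < \<infinity> \<and>
           g = enn2real (set_weight w Z * eff_resistance w u Z) powr (1 / real n)"
    let ?p = "enn2real (set_weight w Z * eff_resistance w u Z)"
    have p: "1 < ?p" using weight_times_resistance[OF far] b by blast
    then have "1 < g" using b by (simp add: gr_one_powr)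
    moreover have "g ^ n = ?p"
    proof -
      have "g ^ n = g powr real n" using \<open>1 < g\<close> by (simp add: powr_realpow)
      also have "\<dots> = ?p" using b p by (simp add: powr_powr)
      finally show ?thesis .
    qed
    moreover have "cut_weight w K Z * green K Z u l u \<le> ?p" if "0 < l" "l < 1" for l
    proof -
      have "ennreal (green K Z u l u) \<le> ennreal (enn2real (eff_resistance w u Z))"
        using green_le_resistance[OF K u that] b by simp
      then have "green K Z u l u \<le> enn2real (eff_resistance w u Z)"
        by (simp add: ennreal_le_iff)
      then have "cut_weight w K Z * green K Z u l u \<le> cut_weight w K Z * enn2real (eff_resistance w u Z)"
        using cut_weight_nonneg by (rule mult_left_mono)
      also have "\<dots> \<le> ?WZ * enn2real (eff_resistance w u Z)"
        using cut_weight_le[OF K(1)] b by (intro mult_right_mono) auto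
      finally show ?thesis by (simp add: enn2real_mult)
    qed
    ultimately show ?thesis by simp
  qed
  then show g: "1 < g" and "\<lbrakk>0 < Phi; Phi < 1; l = Phi * (g + 1) / (g + Phi\<^sup>2)\<rbrakk> \<Longrightarrow> hit K Z l u \<le> l * Phi ^ n"
    using hit_bound[OF K far] by blast+
qed

end

section \<open>The hitting time of the random walk\<close>

lemma hitting_time_eq_enat:
  "hitting_time X Z \<omega> = enat t \<longleftrightarrow> X t \<omega> \<in> Z \<and> (\<forall>j<t. X j \<omega> \<notin> Z)"
proof -
  have ge: "enat k \<le> hitting_time X Z \<omega> \<longleftrightarrow> (\<forall>j<k. X j \<omega> \<notin> Z)" for k
    unfolding hitting_time_def le_Inf_iff by (auto simp: not_less[symmetric])
  have "hitting_time X Z \<omega> = enat t \<longleftrightarrow> enat t \<le> hitting_time X Z \<omega> \<and> \<not> enat (Suc t) \<le> hitting_time X Z \<omega>"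
    by (cases "hitting_time X Z \<omega>") auto
  then show ?thesis unfolding ge by (auto simp: less_Suc_eq)
qed

locale walk_on_graph = weighted_graph w for w :: "'v \<Rightarrow> 'v \<Rightarrow> real" +
  fixes u :: 'v and M :: "'a measure" and X :: "nat \<Rightarrow> 'a \<Rightarrow> 'v"
  assumes walk: "random_walk w u M X"
begin

sublocale prob_space M using walk by (simp add: random_walk_def)

lemma X_measurable [measurable]: "X t \<in> measurable M (count_space UNIV)"
  using walk by (simp add: random_walk_def)

lemma X_in_measurable [measurable]: "Measurable.pred M (\<lambda>\<omega>. X t \<omega> \<in> B)"
  using measurable_compose[OF X_measurable[of t], of "\<lambda>x. x \<in> B" "count_space UNIV"] by simp

abbreviation path where "path t p \<equiv> {\<omega> \<in> space M. \<forall>i\<le>t. X i \<omega> = p i}"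

lemma prob_path:
  "prob (path t p) = (if p 0 = u then \<Prod>i<t. jump (p i) (p (Suc i)) else 0)"
  using walk by (simp add: random_walk_def jump_def)

lemma prob_path_Suc: "prob (path (Suc t) (p(Suc t := y))) = prob (path t p) * jump (p t) y"
proof -
  have "(\<Prod>i<t. jump ((p(Suc t := y)) i) ((p(Suc t := y)) (Suc i))) = (\<Prod>i<t. jump (p i) (p (Suc i)))"
    by (intro prod.cong) auto
  then show ?thesis unfolding prob_path by simp
qed

text \<open>The walk follows the path \<open>p\<close> up to time \<open>t\<close>, and its next \<open>s\<close> steps are of the kind counted by
  \<open>killed\<close>. Fixing the past as a whole path makes the Markov property a statement about the given
  finite-dimensional distributions.\<close>
definition continue where
  "continue t p K Z B s = {\<omega> \<in> space M. (\<forall>i\<le>t. X i \<omega> = p i) \<and> (\<forall>j<s. X (t + j) \<omega> \<notin> Z) \<and>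
     (\<forall>j<s. X (t + Suc j) \<omega> \<in> K) \<and> X (t + s) \<omega> \<in> B}"

lemma continue_measurable [measurable]: "continue t p K Z B s \<in> sets M"
  unfolding continue_def by measurable

text \<open>Induction over the remaining steps, splitting according to the next position in the finite set \<open>K\<close>.\<close>
lemma prob_continue:
  assumes K: "finite K"
  shows "prob (continue t p K Z B s) = prob (path t p) * killed K Z (indicator B) s (p t)"
proof (induction s arbitrary: t p)
  case 0
  have "continue t p K Z B 0 = (if p t \<in> B then path t p else {})"
    by (auto simp: continue_def)
  then show ?case by simp
next
  case (Suc s)
  show ?case
  proof (cases "p t \<in> Z")
    case True
    then have "continue t p K Z B (Suc s) = {}" by (force simp: continue_def)
    then show ?thesis using True by simp
  next
    case False
    let ?E = "\<lambda>y. continue (Suc t) (p(Suc t := y)) K Z B s"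
    have avoid: "(\<forall>j<Suc s. X (t + j) \<omega> \<notin> Z) \<longleftrightarrow> X t \<omega> \<notin> Z \<and> (\<forall>j<s. X (Suc t + j) \<omega> \<notin> Z)" for \<omega>
      by (auto simp: less_Suc_eq_0_disj)
    have stay: "(\<forall>j<Suc s. X (t + Suc j) \<omega> \<in> K) \<longleftrightarrow> X (Suc t) \<omega> \<in> K \<and> (\<forall>j<s. X (Suc t + Suc j) \<omega> \<in> K)" for \<omega>
      by (auto simp: less_Suc_eq_0_disj)
    have init: "(\<forall>i\<le>Suc t. X i \<omega> = (p(Suc t := y)) i) \<longleftrightarrow> (\<forall>i\<le>t. X i \<omega> = p i) \<and> X (Suc t) \<omega> = y" for y \<omega>
      by (auto simp: le_Suc_eq)
    have "continue t p K Z B (Suc s) = (\<Union>y\<in>K. ?E y)"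
      unfolding continue_def init avoid stay using False by auto
    moreover have "prob (\<Union>y\<in>K. ?E y) = (\<Sum>y\<in>K. prob (?E y))"
      using K by (intro finite_measure_finite_Union) (auto simp: disjoint_family_on_def continue_def init)
    ultimately show ?thesis using False
      by (simp add: Suc prob_path_Suc sum_distrib_left mult.assoc del: fun_upd_apply)
         (simp add: sum_distrib_left mult.assoc)
  qed
qed

lemma prob_start: "prob (path 0 (\<lambda>_. u)) = 1"
  using prob_path[of 0 "\<lambda>_. u"] by simp

abbreviation T where "T \<equiv> hitting_time X"

lemma T_measurable [measurable]: "{\<omega> \<in> space M. T Z \<omega> = enat t} \<in> sets M"
  unfolding hitting_time_eq_enat by measurable

text \<open>The walk can hit \<open>Z\<close> at time \<open>t\<close> either inside \<open>K\<close> or after having left \<open>K\<close>.\<close>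
lemma prob_hit_le:
  assumes "finite K"
  shows "prob {\<omega> \<in> space M. T Z \<omega> = enat t}
    \<le> killed K Z (indicator Z) t u + (1 - killed K {} (indicator UNIV) t u)"
proof -
  let ?A = "continue 0 (\<lambda>_. u) K Z Z t" and ?C = "continue 0 (\<lambda>_. u) K {} UNIV t"
  have AE_start: "AE \<omega> in M. X 0 \<omega> = u"
    using prob_start by (subst (asm) prob_Collect_eq_1) auto
  have "prob {\<omega> \<in> space M. T Z \<omega> = enat t} \<le> prob (?A \<union> (space M - ?C))"
    using AE_start by (intro finite_measure_mono_AE) (auto simp: hitting_time_eq_enat continue_def)
  also have "\<dots> \<le> prob ?A + prob (space M - ?C)" by (intro measure_Un_le) auto
  also have "prob (space M - ?C) = 1 - prob ?C" by (intro prob_compl) auto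
  finally show ?thesis using prob_start by (simp add: prob_continue[OF assms])
qed

end

context weighted_graph
begin

text \<open>The countably many steps that are possible from a vertex are covered up to a small probability by a finite
  set; iterating this \<open>t\<close> times gives a finite set again.\<close>
lemma stay_prob:
  assumes "0 < e" "e \<le> 1"
  shows "\<exists>K. finite K \<and> 1 - e \<le> killed K {} (indicator UNIV) t x"
  using assms
proof (induction t arbitrary: x e)
  case 0
  then show ?case by (auto intro!: exI[of _ "{}"])
next
  case (Suc t)
  define d where "d = e / 2"
  have d: "0 < d" "d \<le> 1" using Suc.prems by (auto simp: d_def)
  have "(sum (w x) \<longlongrightarrow> vertex_weight w x) (finite_subsets_at_top UNIV)"
    using has_sum_infsum[OF weight_summable[of x]] by (simp add: has_sum_def vertex_weight_def)
  moreover have "(1 - d) * vertex_weight w x < vertex_weight w x"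
    using d vertex_weight_pos[of x] by simp
  ultimately have "eventually (\<lambda>A. (1 - d) * vertex_weight w x < sum (w x) A) (finite_subsets_at_top UNIV)"
    by (rule order_tendstoD(1))
  then obtain A where A: "finite A" "(1 - d) * vertex_weight w x < sum (w x) A"
    unfolding eventually_finite_subsets_at_top by blast
  then have A': "1 - d \<le> (\<Sum>y\<in>A. jump x y)"
    using vertex_weight_pos[of x] by (simp add: jump_def sum_divide_distrib[symmetric] pos_le_divide_eq)
  have "\<forall>y. \<exists>K. finite K \<and> 1 - d \<le> killed K {} (indicator UNIV) t y" using Suc.IH d by blast
  then obtain k where k: "\<And>y. finite (k y)" "\<And>y. 1 - d \<le> killed (k y) {} (indicator UNIV) t y" by metis
  define L where "L = A \<union> (\<Union>y\<in>A. k y)"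
  have L: "finite L" using A k by (simp add: L_def)
  have "1 - e \<le> (1 - d) * (1 - d)" using d by (simp add: d_def algebra_simps)
  also have "\<dots> \<le> (\<Sum>y\<in>A. jump x y) * (1 - d)" using A' d by (intro mult_right_mono) auto
  also have "\<dots> \<le> (\<Sum>y\<in>A. jump x y * killed L {} (indicator UNIV) t y)"
    unfolding sum_distrib_right
  proof (intro sum_mono mult_left_mono jump_nonneg)
    fix y assume "y \<in> A"
    then have "killed (k y) {} (indicator UNIV) t y \<le> killed L {} (indicator UNIV) t y"
      using L by (intro killed_mono) (auto simp: L_def)
    then show "1 - d \<le> killed L {} (indicator UNIV) t y" using k(2)[of y] by simp
  qed
  also have "\<dots> \<le> (\<Sum>y\<in>L. jump x y * killed L {} (indicator UNIV) t y)"
    using L by (intro sum_mono2) (auto simp: L_def intro!: mult_nonneg_nonneg jump_nonneg killed_nonneg)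
  finally show ?case using L by (intro exI[of _ L]) simp
qed

end

context walk_on_graph
begin

text \<open>Bounds for all killed walks pass to the original walk: for each horizon \<open>N\<close> a finite \<open>K\<close> captures the walk
  up to time \<open>N\<close> with probability as close to 1 as desired.\<close>
lemma partial_mgf_le:
  assumes l: "0 < l" "l < 1" and bound: "\<And>K. finite K \<Longrightarrow> u \<in> K \<Longrightarrow> hit K Z l u \<le> c"
  shows "(\<Sum>t\<le>N. l ^ t * prob {\<omega> \<in> space M. T Z \<omega> = enat t}) \<le> c"
proof -
  have approx: "(\<Sum>t\<le>N. l ^ t * prob {\<omega> \<in> space M. T Z \<omega> = enat t}) \<le> c + real (Suc N) * e"
    if e: "0 < e" "e \<le> 1" for e
  proof -
    have "\<forall>t. \<exists>K. finite K \<and> 1 - e \<le> killed K {} (indicator UNIV) t u" using stay_prob[OF e] by blast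
    then obtain k where k: "\<And>t. finite (k t)" "\<And>t. 1 - e \<le> killed (k t) {} (indicator UNIV) t u" by metis
    define K where "K = insert u (\<Union>t\<le>N. k t)"
    have K: "finite K" "u \<in> K" using k by (auto simp: K_def)
    interpret H: bounded_source w K Z "indicator Z" 1 using source_hit[OF K(1)] .
    have "l ^ t * prob {\<omega> \<in> space M. T Z \<omega> = enat t} \<le> killed K Z (indicator Z) t u * l ^ t + e"
      if "t \<le> N" for t
    proof -
      have "killed (k t) {} (indicator UNIV) t u \<le> killed K {} (indicator UNIV) t u"
        using K that by (intro killed_mono) (auto simp: K_def)
      then have "prob {\<omega> \<in> space M. T Z \<omega> = enat t} \<le> killed K Z (indicator Z) t u + e"
        using prob_hit_le[OF K(1), of Z t] k(2)[of t] by linarith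
      then have "l ^ t * prob {\<omega> \<in> space M. T Z \<omega> = enat t} \<le> l ^ t * (killed K Z (indicator Z) t u + e)"
        using l by (intro mult_left_mono) auto
      also have "\<dots> = killed K Z (indicator Z) t u * l ^ t + l ^ t * e" by (simp add: algebra_simps)
      also have "l ^ t * e \<le> 1 * e" using l e by (intro mult_right_mono power_le_one) auto
      finally show ?thesis by simp
    qed
    then have "(\<Sum>t\<le>N. l ^ t * prob {\<omega> \<in> space M. T Z \<omega> = enat t})
        \<le> (\<Sum>t\<le>N. killed K Z (indicator Z) t u * l ^ t + e)" by (intro sum_mono) auto
    also have "\<dots> = (\<Sum>t\<le>N. killed K Z (indicator Z) t u * l ^ t) + real (Suc N) * e"
      by (simp add: sum.distrib)
    also have "(\<Sum>t\<le>N. killed K Z (indicator Z) t u * l ^ t) \<le> hit K Z l u"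
      unfolding hit_def gf_def using l H.summable_gf[of l u] killed_nonneg[OF H.s(1)]
      by (intro sum_le_suminf) auto
    finally show ?thesis using bound[OF K] by simp
  qed
  show ?thesis
  proof (rule field_le_epsilon)
    fix e :: real assume e: "0 < e"
    let ?d = "min 1 (e / real (Suc N))"
    have "real (Suc N) * ?d \<le> real (Suc N) * (e / real (Suc N))" by (intro mult_left_mono) auto
    also have "\<dots> = e" by (simp del: of_nat_Suc)
    finally have "real (Suc N) * ?d \<le> e" .
    moreover have "0 < ?d" "?d \<le> 1" using e by auto
    ultimately show "(\<Sum>t\<le>N. l ^ t * prob {\<omega> \<in> space M. T Z \<omega> = enat t}) \<le> c + e"
      using approx[of ?d] by linarith
  qed
qed

text \<open>Markov's inequality for \<open>l ^ T\<close>.\<close>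
lemma prob_early_hit:
  assumes l: "0 < l" "l < 1" and r: "0 \<le> r"
    and bound: "\<And>N. (\<Sum>t\<le>N. l ^ t * prob {\<omega> \<in> space M. T Z \<omega> = enat t}) \<le> c"
  shows "prob {\<omega> \<in> space M. ennreal_of_enat (T Z \<omega>) \<le> ennreal r} \<le> l powr (- r) * c"
proof -
  define N where "N = nat \<lfloor>r\<rfloor>"
  let ?E = "\<lambda>t. {\<omega> \<in> space M. T Z \<omega> = enat t}"
  have "{\<omega> \<in> space M. ennreal_of_enat (T Z \<omega>) \<le> ennreal r} \<subseteq> (\<Union>t\<in>{..N}. ?E t)"
  proof
    fix \<omega> assume \<omega>: "\<omega> \<in> {\<omega> \<in> space M. ennreal_of_enat (T Z \<omega>) \<le> ennreal r}"
    show "\<omega> \<in> (\<Union>t\<in>{..N}. ?E t)"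
    proof (cases "T Z \<omega>")
      case (enat t)
      then have "real t \<le> r" using \<omega> r by (simp add: ennreal_of_nat_eq_real_of_nat)
      then have "t \<le> N" using r by (simp add: N_def le_nat_floor)
      then show ?thesis using \<omega> enat by auto
    next
      case infinity
      then show ?thesis using \<omega> by (simp add: top_unique)
    qed
  qed
  then have "prob {\<omega> \<in> space M. ennreal_of_enat (T Z \<omega>) \<le> ennreal r} \<le> prob (\<Union>t\<in>{..N}. ?E t)"
    by (intro finite_measure_mono) auto
  also have "\<dots> \<le> (\<Sum>t\<le>N. prob (?E t))" by (intro finite_measure_subadditive_finite) auto
  also have "\<dots> \<le> (\<Sum>t\<le>N. l powr (- r) * (l ^ t * prob (?E t)))"
  proof (intro sum_mono)
    fix t assume "t \<in> {..N}"
    then have "real t \<le> real N" by simp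
    also have "real N \<le> r" using of_nat_floor[OF r] by (simp add: N_def)
    finally have "real t \<le> r" .
    then have "1 \<le> l powr (real t - r)" using l powr_mono'[of "real t - r" 0 l] by simp
    then have "1 * prob (?E t) \<le> l powr (real t - r) * prob (?E t)" by (intro mult_right_mono) auto
    also have "l powr (real t - r) = l powr (- r) * l ^ t"
      using l by (simp add: powr_realpow[symmetric] powr_add[symmetric])
    finally show "prob (?E t) \<le> l powr (- r) * (l ^ t * prob (?E t))" by (simp add: mult.assoc)
  qed
  also have "\<dots> = l powr (- r) * (\<Sum>t\<le>N. l ^ t * prob (?E t))" by (simp add: sum_distrib_left)
  also have "\<dots> \<le> l powr (- r) * c" using bound by (intro mult_left_mono) auto
  finally show ?thesis .
qed

text \<open>Bernoulli's inequality \<open>T \<ge> (1 - l ^ T) / (1 - l)\<close>, integrated. The function \<open>Y\<close> is an upper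
  bound of \<open>l\<close> to the power of the minimum of \<open>T\<close> and \<open>N\<close>, so that infinite values of \<open>T\<close> need no separate treatment.\<close>
lemma mean_hit_ge:
  assumes l: "0 < l" "l < 1"
    and bound: "\<And>N. (\<Sum>t\<le>N. l ^ t * prob {\<omega> \<in> space M. T Z \<omega> = enat t}) \<le> c"
  shows "ennreal ((1 - c) / (1 - l)) \<le> (\<integral>\<^sup>+\<omega>. ennreal_of_enat (T Z \<omega>) \<partial>M)"
proof -
  let ?E = "\<lambda>t. {\<omega> \<in> space M. T Z \<omega> = enat t}"
  have step: "ennreal ((1 - c - l ^ N) / (1 - l)) \<le> (\<integral>\<^sup>+\<omega>. ennreal_of_enat (T Z \<omega>) \<partial>M)" for N
  proof -
    define e where "e t \<omega> = l ^ t * indicator (?E t) \<omega>" for t \<omega>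
    define Y where "Y \<omega> = (\<Sum>t\<le>N. e t \<omega>) + l ^ N" for \<omega>
    have e_int: "integrable M (e t)" for t
      unfolding e_def
      by (intro integrable_mult_right integrable_real_indicator T_measurable) (auto simp: emeasure_eq_measure)
    have e_exp: "integral\<^sup>L M (e t) = l ^ t * prob (?E t)" for t
      unfolding e_def by (simp add: T_measurable)
    have e_nonneg: "0 \<le> e t \<omega>" for t \<omega> using l by (simp add: e_def)
    have sum_int: "integrable M (\<lambda>\<omega>. \<Sum>t\<le>N. e t \<omega>)"
      by (intro Bochner_Integration.integrable_sum e_int)
    then have Y_int: "integrable M Y" unfolding Y_def by (intro Bochner_Integration.integrable_add) auto
    have Y_exp: "integral\<^sup>L M Y \<le> c + l ^ N"
    proof -
      have "integral\<^sup>L M Y = (\<Sum>t\<le>N. l ^ t * prob (?E t)) + l ^ N"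
        unfolding Y_def
        by (simp add: Bochner_Integration.integral_add[OF sum_int] Bochner_Integration.integral_sum[OF e_int] e_exp prob_space)
      then show ?thesis using bound[of N] by simp
    qed
    have pw: "ennreal ((1 - Y \<omega>) / (1 - l)) \<le> ennreal_of_enat (T Z \<omega>)" if \<omega>: "\<omega> \<in> space M" for \<omega>
    proof -
      have geo: "(1 - l ^ t) / (1 - l) \<le> real t" for t
      proof -
        have "(1 - l ^ t) / (1 - l) = (\<Sum>i<t. l ^ i)" using l by (simp add: sum_gp_strict)
        also have "\<dots> \<le> (\<Sum>i<t. 1)" using l by (intro sum_mono power_le_one) auto
        finally show ?thesis by simp
      qed
      show ?thesis
      proof (cases "\<exists>t\<le>N. T Z \<omega> = enat t")
        case True
        then obtain t where t: "t \<le> N" "T Z \<omega> = enat t" by blast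
        have "e t \<omega> \<le> (\<Sum>t\<le>N. e t \<omega>)"
          using t e_nonneg by (intro member_le_sum) auto
        moreover have "e t \<omega> = l ^ t" using t \<omega> by (simp add: e_def)
        ultimately have "l ^ t \<le> Y \<omega>" using l unfolding Y_def by (simp add: add_increasing2)
        then have "(1 - Y \<omega>) / (1 - l) \<le> (1 - l ^ t) / (1 - l)" using l by (intro divide_right_mono) auto
        then have "(1 - Y \<omega>) / (1 - l) \<le> real t" using geo[of t] by linarith
        then show ?thesis using t by (simp add: ennreal_of_nat_eq_real_of_nat ennreal_leI)
      next
        case False
        have "l ^ N \<le> Y \<omega>" unfolding Y_def using e_nonneg by (simp add: sum_nonneg)
        then have "(1 - Y \<omega>) / (1 - l) \<le> (1 - l ^ N) / (1 - l)" using l by (intro divide_right_mono) auto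
        then have "(1 - Y \<omega>) / (1 - l) \<le> real N" using geo[of N] by linarith
        moreover have "enat N \<le> T Z \<omega>" using False by (cases "T Z \<omega>") (auto simp: not_le)
        then have "ennreal_of_enat (enat N) \<le> ennreal_of_enat (T Z \<omega>)" by (simp only: ennreal_of_enat_le_iff)
        ultimately show ?thesis
          by (elim order_trans[rotated]) (simp add: ennreal_of_nat_eq_real_of_nat ennreal_leI)
      qed
    qed
    have "(1 - c - l ^ N) / (1 - l) \<le> (1 - integral\<^sup>L M Y) / (1 - l)"
      using Y_exp l by (intro divide_right_mono) auto
    also have "\<dots> = (\<integral>\<omega>. (1 - Y \<omega>) / (1 - l) \<partial>M)"
      using Y_int by (simp add: prob_space)
    finally have "ennreal ((1 - c - l ^ N) / (1 - l)) \<le> ennreal (\<integral>\<omega>. (1 - Y \<omega>) / (1 - l) \<partial>M)"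
      by (rule ennreal_leI)
    also have "\<dots> \<le> ennreal (\<integral>\<omega>. max 0 ((1 - Y \<omega>) / (1 - l)) \<partial>M)"
      using Y_int by (intro ennreal_leI integral_mono) auto
    also have "\<dots> = (\<integral>\<^sup>+\<omega>. ennreal (max 0 ((1 - Y \<omega>) / (1 - l))) \<partial>M)"
      using Y_int by (intro nn_integral_eq_integral[symmetric]) auto
    also have "\<dots> \<le> (\<integral>\<^sup>+\<omega>. ennreal_of_enat (T Z \<omega>) \<partial>M)"
      using pw by (intro nn_integral_mono) (simp add: max_def ennreal_neg)
    finally show ?thesis .
  qed
  have "(\<lambda>N. ennreal ((1 - c - l ^ N) / (1 - l))) \<longlonglongrightarrow> ennreal ((1 - c - 0) / (1 - l))"
    using l by (intro tendsto_ennrealI tendsto_intros LIMSEQ_power_zero) auto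
  then show ?thesis using step by (intro LIMSEQ_le_const2[where X = "\<lambda>N. ennreal ((1 - c - l ^ N) / (1 - l))"]) auto
qed

end

section \<open>Asymptotics of the biased walk and conclusion\<close>

text \<open>With \<open>L\<close> the discount factor at which the biased generating function equals \<open>Phi\<close>, the fraction is a
  quotient of difference quotients at 1. The derivative of \<open>L\<close> there is the reciprocal of the mean of the biased hitting time.\<close>
lemma mean_limit:
  fixes g :: real
  assumes g: "1 < g"
  defines "L \<equiv> \<lambda>Phi. Phi * (g + 1) / (g + Phi\<^sup>2)"
  shows "((\<lambda>Phi. (1 - L Phi * Phi ^ n) / (1 - L Phi)) \<longlongrightarrow> (g + 1) / (g - 1) * real n + 1) (at_left 1)"
proof -
  have [simp]: "g + 1 \<noteq> 0" "g - 1 \<noteq> 0" using g by auto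
  define d where "d = (g - 1) / (g + 1)"
  have d: "d \<noteq> 0" using g by (simp add: d_def)
  have pos: "0 < g + x\<^sup>2" for x using g by (simp add: add_pos_nonneg)
  have dL: "(L has_field_derivative d) (at 1)"
  proof -
    have "(L has_field_derivative ((g + 1) * (g + 1\<^sup>2) - 1 * (g + 1) * (2 * 1)) / (g + 1\<^sup>2)\<^sup>2) (at 1)"
      unfolding L_def by (rule derivative_eq_intros refl | use g in \<open>simp add: power2_eq_square\<close>)+
    moreover have "((g + 1) * (g + 1\<^sup>2) - 1 * (g + 1) * (2 * 1)) / (g + 1\<^sup>2)\<^sup>2 = d"
      using g by (simp add: d_def power2_eq_square divide_simps) (simp add: algebra_simps)
    ultimately show ?thesis by simp
  qed
  have L1: "L 1 = 1" using g by (simp add: L_def)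
  have dLn: "((\<lambda>x. L x * x ^ n) has_field_derivative d + real n) (at 1)"
    by (auto intro!: derivative_eq_intros dL simp: L1)
  have "((\<lambda>x. (L x * x ^ n - L 1 * 1 ^ n) / (x - 1)) \<longlongrightarrow> d + real n) (at 1)"
    using dLn by (simp add: has_field_derivative_iff)
  moreover have "((\<lambda>x. (L x - L 1) / (x - 1)) \<longlongrightarrow> d) (at 1)"
    using dL by (simp add: has_field_derivative_iff)
  ultimately have "((\<lambda>x. ((L x * x ^ n - L 1 * 1 ^ n) / (x - 1)) / ((L x - L 1) / (x - 1))) \<longlongrightarrow> (d + real n) / d) (at 1)"
    using d by (intro tendsto_divide) auto
  then have "((\<lambda>x. ((L x * x ^ n - L 1 * 1 ^ n) / (x - 1)) / ((L x - L 1) / (x - 1))) \<longlongrightarrow> (d + real n) / d) (at_left 1)"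
    by (rule tendsto_within_subset) auto
  moreover have "eventually (\<lambda>x. ((L x * x ^ n - L 1 * 1 ^ n) / (x - 1)) / ((L x - L 1) / (x - 1))
      = (1 - L x * x ^ n) / (1 - L x)) (at_left 1)"
  proof (rule eventually_at_leftI[of 0])
    fix x :: real assume x: "x \<in> {0<..<1}"
    have "a / b / (c / b) = a / c" if "b \<noteq> 0" for a b c :: real using that by simp
    then have "((L x * x ^ n - L 1 * 1 ^ n) / (x - 1)) / ((L x - L 1) / (x - 1)) = (L x * x ^ n - 1) / (L x - 1)"
      using x by (simp add: L1)
    also have "\<dots> = (1 - L x * x ^ n) / (1 - L x)" by (metis minus_diff_eq minus_divide_divide)
    finally show "((L x * x ^ n - L 1 * 1 ^ n) / (x - 1)) / ((L x - L 1) / (x - 1)) = (1 - L x * x ^ n) / (1 - L x)" .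
  qed simp
  ultimately have "((\<lambda>x. (1 - L x * x ^ n) / (1 - L x)) \<longlongrightarrow> (d + real n) / d) (at_left 1)"
    using tendsto_cong by fast
  moreover have "(d + real n) / d = (g + 1) / (g - 1) * real n + 1"
  proof -
    have "(d + real n) / d = 1 + real n / d" using d by (simp add: add_divide_distrib)
    then show ?thesis by (simp add: d_def mult.commute)
  qed
  ultimately show ?thesis by simp
qed

text \<open>The minimum over \<open>Phi\<close> of \<open>l powr (- a) * Phi\<close>, with \<open>l\<close> depending on \<open>Phi\<close> as before, is attained
  at this \<open>Phi\<close>, where the logarithmic derivative of \<open>l\<close> equals \<open>1 / a\<close>: it solves
  \<open>(g - Phi\<^sup>2) / (g + Phi\<^sup>2) = 1 / a\<close>. The value is the exponential of minus the rate.\<close>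
lemma optimal_exponent:
  fixes g a :: real
  assumes g: "1 < g" and a: "1 < a" "a < (g + 1) / (g - 1)"
  defines "Phi \<equiv> sqrt (g * (a - 1) / (a + 1))"
  defines "l \<equiv> Phi * (g + 1) / (g + Phi\<^sup>2)"
  shows "0 < Phi" "Phi < 1"
    and "l powr (- a) * Phi = g / (a + 1) * (g / (a\<^sup>2 - 1)) powr ((a - 1) / 2) * (2 * a / (g + 1)) powr a"
proof -
  show P0: "0 < Phi" using g a by (simp add: Phi_def)
  have "a * (g - 1) < g + 1" using a g by (simp add: pos_less_divide_eq)
  then have "g * (a - 1) < a + 1" by (simp add: algebra_simps)
  then show "Phi < 1" using a by (simp add: Phi_def)
  have P2: "Phi\<^sup>2 = g * (a - 1) / (a + 1)" using g a by (simp add: Phi_def)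
  have l_eq: "l = Phi * ((g + 1) * (a + 1) / (2 * a * g))"
  proof -
    have "g + Phi\<^sup>2 = 2 * a * g / (a + 1)" unfolding P2 using a by (simp add: field_simps)
    then show ?thesis by (simp add: l_def)
  qed
  have ln_Phi: "ln Phi = (ln g + ln (a - 1) - ln (a + 1)) / 2"
    unfolding Phi_def using g a by (simp add: ln_sqrt ln_div ln_mult)
  have ln_l: "ln l = ln Phi + (ln (g + 1) + ln (a + 1) - (ln (2 * a) + ln g))"
    unfolding l_eq using P0 g a by (simp add: ln_div ln_mult)
  have l0: "0 < l" unfolding l_eq using P0 g a by simp
  have "a\<^sup>2 - 1 = (a + 1) * (a - 1)" by (simp add: algebra_simps power2_eq_square)
  then have sq: "ln (g / (a\<^sup>2 - 1)) = ln g - (ln (a + 1) + ln (a - 1))" "0 < g / (a\<^sup>2 - 1)"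
    using g a by (simp_all add: ln_div ln_mult)
  have "l powr (- a) * Phi = exp (- a * ln l + ln Phi)"
    unfolding exp_add using l0 P0 by (simp add: powr_def)
  also have "- a * ln l + ln Phi = (ln g - ln (a + 1)) + (a - 1) / 2 * (ln g - (ln (a + 1) + ln (a - 1)))
      + a * (ln (2 * a) - ln (g + 1))"
    unfolding ln_l ln_Phi by (simp add: field_simps)
  also have "exp \<dots> = g / (a + 1) * (g / (a\<^sup>2 - 1)) powr ((a - 1) / 2) * (2 * a / (g + 1)) powr a"
  proof -
    have "g / (a + 1) = exp (ln g - ln (a + 1))" using g a by (simp add: exp_diff)
    moreover have "(g / (a\<^sup>2 - 1)) powr c = exp (c * (ln g - (ln (a + 1) + ln (a - 1))))" for c
    proof -
      have "g / (a\<^sup>2 - 1) \<noteq> 0" using sq(2) by linarith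
      then show ?thesis by (simp only: powr_def if_False sq(1))
    qed
    moreover have "(2 * a / (g + 1)) powr c = exp (c * (ln (2 * a) - ln (g + 1)))" for c
      using g a ln_div[of "2 * a" "g + 1"] by (simp only: powr_def) simp
    ultimately show ?thesis by (simp only: exp_add)
  qed
  finally show "l powr (- a) * Phi = g / (a + 1) * (g / (a\<^sup>2 - 1)) powr ((a - 1) / 2) * (2 * a / (g + 1)) powr a" .
qed

theorem theorem1:
  fixes w :: "'v \<Rightarrow> 'v \<Rightarrow> real" and u :: 'v and Z :: "'v set"
    and M :: "'a measure" and X :: "nat \<Rightarrow> 'a \<Rightarrow> 'v"
    and n :: nat and g :: real
  assumes "weighted_graph w"
    and "random_walk w u M X"
    and "graph_dist w u Z \<ge> enat (n + 1)"
    and "(g > 1 \<and>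
           ennreal ((g - 1)^2 * g powi (int n - 2))
             = 2 * set_weight w Z / ennreal (vertex_weight w u)) \<or>
         (n \<ge> 1 \<and> set_weight w Z < \<infinity> \<and> eff_resistance w u Z < \<infinity> \<and>
           g = enn2real (set_weight w Z * eff_resistance w u Z) powr (1 / real n))"
  shows "(\<integral>\<^sup>+\<omega>. ennreal_of_enat (hitting_time X Z \<omega>) \<partial>M) \<ge> ennreal (biased_mean g * real n + 1) \<and>
         (\<forall>a. 1 < a \<and> a < biased_mean g \<longrightarrow>
            measure M {\<omega> \<in> space M. ennreal_of_enat (hitting_time X Z \<omega>) \<le> ennreal (a * real n + 1)}
              \<le> exp (- biased_rate g a * real n))"
proof -
  interpret weighted_graph w by fact
  interpret walk_on_graph w u M X by unfold_locales fact
  have g: "1 < g" using hit_bound_volume_or_resistance(1)[of "{u}" u n Z g] assms(3,4) by simp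
  have bound: "(\<Sum>t\<le>N. l ^ t * prob {\<omega> \<in> space M. T Z \<omega> = enat t}) \<le> l * Phi ^ n"
    if "0 < Phi" "Phi < 1" "l = Phi * (g + 1) / (g + Phi\<^sup>2)" for Phi l N
    using discount_range[OF g that(1,2)] that(3) hit_bound_volume_or_resistance(2)[OF _ _ assms(3,4) that]
    by (intro partial_mgf_le) auto
  have "ennreal (biased_mean g * real n + 1) \<le> (\<integral>\<^sup>+\<omega>. ennreal_of_enat (T Z \<omega>) \<partial>M)"
  proof (rule tendsto_upperbound)
    let ?L = "\<lambda>Phi. Phi * (g + 1) / (g + Phi\<^sup>2)"
    show "((\<lambda>Phi. ennreal ((1 - ?L Phi * Phi ^ n) / (1 - ?L Phi))) \<longlongrightarrow> ennreal (biased_mean g * real n + 1)) (at_left 1)"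
      using mean_limit[OF g, of n] unfolding biased_mean_eq[OF g] by (intro tendsto_ennrealI)
    show "eventually (\<lambda>Phi. ennreal ((1 - ?L Phi * Phi ^ n) / (1 - ?L Phi)) \<le> (\<integral>\<^sup>+\<omega>. ennreal_of_enat (T Z \<omega>) \<partial>M)) (at_left 1)"
      by (rule eventually_at_leftI[of 0])
         (use discount_range[OF g] bound in \<open>auto intro!: mean_hit_ge\<close>)
  qed simp
  moreover have "prob {\<omega> \<in> space M. ennreal_of_enat (T Z \<omega>) \<le> ennreal (a * real n + 1)} \<le> exp (- biased_rate g a * real n)"
    if a: "1 < a" "a < biased_mean g" for a
  proof -
    define Phi where "Phi = sqrt (g * (a - 1) / (a + 1))"
    define l where "l = Phi * (g + 1) / (g + Phi\<^sup>2)"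
    have a': "a < (g + 1) / (g - 1)" using a biased_mean_eq[OF g] by simp
    note opt = optimal_exponent[OF g a(1) a', folded Phi_def, folded l_def]
    have l: "0 < l" "l < 1" using discount_range[OF g opt(1,2)] by (simp_all add: l_def)
    have "prob {\<omega> \<in> space M. ennreal_of_enat (T Z \<omega>) \<le> ennreal (a * real n + 1)}
        \<le> l powr (- (a * real n + 1)) * (l * Phi ^ n)"
      using a l bound[OF opt(1,2) l_def] by (intro prob_early_hit) auto
    also have "\<dots> = (l powr (- a) * Phi) ^ n"
    proof -
      have "l powr (- (a * real n + 1)) = (l powr (- a)) ^ n * (1 / l)"
        using l by (simp add: powr_diff powr_powr[symmetric] powr_realpow minus_mult_left[symmetric] powr_minus divide_inverse power_inverse)
      then show ?thesis using l by (simp add: power_mult_distrib)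
    qed
    also have "l powr (- a) * Phi = exp (- biased_rate g a)"
      using opt(3) exp_biased_rate_eq[OF g a] by simp
    also have "exp (- biased_rate g a) ^ n = exp (- biased_rate g a * real n)"
      by (simp add: exp_of_nat_mult[symmetric] mult.commute)
    finally show ?thesis .
  qed
  ultimately show ?thesis by blast
qed

end
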